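(* Let $\Omega\subset\mathbb{R}^3$ be a bounded convex domain with smooth boundary, $V\in L^\infty(\Omega)$, $V\ge0$, $\beta\ge0$. Let $\phi$ be a solution of $$\begin{cases}\phi_t=\Delta\phi-V\phi-\beta|\phi|^2\phi+\mu[\phi]\phi & \text{in }\Omega\times(0,\infty),\\ \phi=0 & \text{on }\partial\Omega\times(0,\infty),\\ \phi=\phi_0 & \text{at } t=0,\end{cases}\qquad \|\phi_0\|_{L^2(\Omega)}=1,$$ such that $\phi\in C^1([0,\infty);H_0^1(\Omega))\cap C([0,\infty);H^2(\Omega))$ and $\phi(t)\to\phi_{\mathrm{GS}}$ strongly in $H_0^1(\Omega)$ as $t\to\infty$. Then for every $\epsilon\in(0,\lambda_2-\lambda_{\mathrm{GS}})$ there exist $T_\epsilon>0$ and $C_\epsilon>0$ such that for all $t\ge T_\epsilon$: $$E(\phi(t))-E(\phi_{\mathrm{GS}})\le C_\epsilon\exp\big(-2(\lambda_2-\lambda_{\mathrm{GS}}-\epsilon)t\big),$$ $$\|\phi(t)-\phi_{\mathrm{GS}}\|_{L^2(\Omega)}\le C_\epsilon\exp\big(-(\lambda_2-\lambda_{\mathrm{GS}}-\epsilon)t\big),$$ $$\left|\mu[\phi(t)]-\lambda_{\mathrm{GS}}\right|\le C_\epsilon\exp\big(-(\lambda_2-\lambda_{\mathrm{GS}}-\epsilon)t\big).$$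
   Context: All functions are real-valued. For $0\neq v\in H_0^1(\Omega)$, $\mu[v]:=\frac{1}{\|v\|_{L^2(\Omega)}^2}\int_\Omega\left(|\nabla v|^2+V|v|^2+\beta|v|^4\right)\mathrm{d}x$. The energy is $E(v)=\int_\Omega\left(\frac12|\nabla v|^2+\frac12V|v|^2+\frac\beta4|v|^4\right)\mathrm{d}x$ for $v\in H_0^1(\Omega)$. The ground state $\phi_{\mathrm{GS}}$ is the positive minimizer of $E$ over $\{v\in H_0^1(\Omega):\|v\|_{L^2(\Omega)}=1\}$ (the minimizer is unique up to sign); it satisfies $-\Delta\phi_{\mathrm{GS}}+V\phi_{\mathrm{GS}}+\beta|\phi_{\mathrm{GS}}|^2\phi_{\mathrm{GS}}=\lambda_{\mathrm{GS}}\phi_{\mathrm{GS}}$, where $\lambda_{\mathrm{GS}}=\mu[\phi_{\mathrm{GS}}]$. $\lambda_2$ denotes the second eigenvalue (counted with multiplicity) of the linear eigenvalue problem: find $(u,\lambda)\in H_0^1(\Omega)\times\mathbb{R}$ with $-\Delta u+Vu+\beta|\phi_{\mathrm{GS}}|^2u=\lambda u$. *)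

theory Defs
  imports "HOL-Analysis.Analysis"
begin

section \<open>Smooth functions and domains with smooth boundary\<close>

text \<open>Meant for open \<open>S\<close> only.\<close>

primrec Ck_on :: "nat \<Rightarrow> 'a::euclidean_space set \<Rightarrow> ('a \<Rightarrow> real) \<Rightarrow> bool" where
  "Ck_on 0 S f \<longleftrightarrow> continuous_on S f"
| "Ck_on (Suc k) S f \<longleftrightarrow>
     (\<exists>f'. (\<forall>x\<in>S. (f has_derivative f' x) (at x)) \<and> (\<forall>v. Ck_on k S (\<lambda>x. f' x v)))"

definition smooth_on :: "'a::euclidean_space set \<Rightarrow> ('a \<Rightarrow> real) \<Rightarrow> bool" where
  "smooth_on S f \<longleftrightarrow> (\<forall>k. Ck_on k S f)"

text \<open>
  Locally, after a rotation, the domain is the region strictly above the graph of a smooth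
  function. The unit vector \<open>e\<close> is the vertical direction, and \<open>\<gamma>\<close> is only evaluated on the
  hyperplane orthogonal to \<open>e\<close>.
\<close>

definition smooth_boundary :: "'a::euclidean_space set \<Rightarrow> bool" where
  "smooth_boundary \<Omega> \<longleftrightarrow>
     (\<forall>p\<in>frontier \<Omega>. \<exists>r e \<gamma>. r > 0 \<and> norm e = 1 \<and> smooth_on UNIV \<gamma> \<and>
        \<Omega> \<inter> ball p r = {x \<in> ball p r. x \<bullet> e > \<gamma> (x - (x \<bullet> e) *\<^sub>R e)})"

section \<open>Lebesgue and Sobolev spaces\<close>

text \<open>
  Elements of the function spaces are representatives; only their values on \<open>\<Omega>\<close> up to
  null sets matter.
\<close>

definition L2 :: "'a::euclidean_space set \<Rightarrow> ('a \<Rightarrow> real) set" where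
  "L2 \<Omega> = {u \<in> borel_measurable (lebesgue_on \<Omega>). integrable (lebesgue_on \<Omega>) (\<lambda>x. (u x)\<^sup>2)}"

definition L2_norm :: "'a::euclidean_space set \<Rightarrow> ('a \<Rightarrow> real) \<Rightarrow> real" where
  "L2_norm \<Omega> u = sqrt (LINT x|lebesgue_on \<Omega>. (u x)\<^sup>2)"

definition Linfty :: "'a::euclidean_space set \<Rightarrow> ('a \<Rightarrow> real) set" where
  "Linfty \<Omega> = {u \<in> borel_measurable (lebesgue_on \<Omega>). \<exists>M. AE x in lebesgue_on \<Omega>. \<bar>u x\<bar> \<le> M}"

definition test_functions :: "'a::euclidean_space set \<Rightarrow> ('a \<Rightarrow> real) set" where
  "test_functions \<Omega> = {\<psi>. smooth_on UNIV \<psi> \<and> (\<exists>K. compact K \<and> K \<subseteq> \<Omega> \<and> (\<forall>x. x \<notin> K \<longrightarrow> \<psi> x = 0))}"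

definition has_weak_deriv ::
  "'a::euclidean_space set \<Rightarrow> 'a \<Rightarrow> ('a \<Rightarrow> real) \<Rightarrow> ('a \<Rightarrow> real) \<Rightarrow> bool" where
  "has_weak_deriv \<Omega> b u g \<longleftrightarrow>
     (\<forall>\<psi>\<in>test_functions \<Omega>.
        (LINT x|lebesgue_on \<Omega>. u x * frechet_derivative \<psi> (at x) b) =
        - (LINT x|lebesgue_on \<Omega>. g x * \<psi> x))"

text \<open>Unique up to null sets whenever a weak derivative in \<open>L2 \<Omega>\<close> exists.\<close>

definition weak_deriv ::
  "'a::euclidean_space set \<Rightarrow> 'a \<Rightarrow> ('a \<Rightarrow> real) \<Rightarrow> 'a \<Rightarrow> real" where
  "weak_deriv \<Omega> b u = (SOME g. g \<in> L2 \<Omega> \<and> has_weak_deriv \<Omega> b u g)"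

definition weak_grad :: "'a::euclidean_space set \<Rightarrow> ('a \<Rightarrow> real) \<Rightarrow> 'a \<Rightarrow> 'a" where
  "weak_grad \<Omega> u x = (\<Sum>b\<in>Basis. weak_deriv \<Omega> b u x *\<^sub>R b)"

definition weak_laplacian :: "'a::euclidean_space set \<Rightarrow> ('a \<Rightarrow> real) \<Rightarrow> 'a \<Rightarrow> real" where
  "weak_laplacian \<Omega> u x = (\<Sum>b\<in>Basis. weak_deriv \<Omega> b (weak_deriv \<Omega> b u) x)"

definition H1 :: "'a::euclidean_space set \<Rightarrow> ('a \<Rightarrow> real) set" where
  "H1 \<Omega> = {u \<in> L2 \<Omega>. \<forall>b\<in>Basis. \<exists>g\<in>L2 \<Omega>. has_weak_deriv \<Omega> b u g}"

definition H1_norm :: "'a::euclidean_space set \<Rightarrow> ('a \<Rightarrow> real) \<Rightarrow> real" where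
  "H1_norm \<Omega> u = sqrt ((L2_norm \<Omega> u)\<^sup>2 + (\<Sum>b\<in>Basis. (L2_norm \<Omega> (weak_deriv \<Omega> b u))\<^sup>2))"

definition H2 :: "'a::euclidean_space set \<Rightarrow> ('a \<Rightarrow> real) set" where
  "H2 \<Omega> = {u \<in> H1 \<Omega>. \<forall>b\<in>Basis. weak_deriv \<Omega> b u \<in> H1 \<Omega>}"

definition H2_norm :: "'a::euclidean_space set \<Rightarrow> ('a \<Rightarrow> real) \<Rightarrow> real" where
  "H2_norm \<Omega> u = sqrt ((H1_norm \<Omega> u)\<^sup>2 +
     (\<Sum>b\<in>Basis. \<Sum>c\<in>Basis. (L2_norm \<Omega> (weak_deriv \<Omega> c (weak_deriv \<Omega> b u)))\<^sup>2))"

text \<open>Closure of the test functions in \<open>H1 \<Omega>\<close>.\<close>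

definition H01 :: "'a::euclidean_space set \<Rightarrow> ('a \<Rightarrow> real) set" where
  "H01 \<Omega> = {u \<in> H1 \<Omega>. \<forall>\<delta>>0. \<exists>\<psi>\<in>test_functions \<Omega>. H1_norm \<Omega> (\<lambda>x. u x - \<psi> x) < \<delta>}"

section \<open>Continuity and differentiability in time with respect to a spatial norm\<close>

definition time_continuous ::
  "(('a \<Rightarrow> real) \<Rightarrow> real) \<Rightarrow> (real \<Rightarrow> 'a \<Rightarrow> real) \<Rightarrow> bool" where
  "time_continuous nrm \<phi> \<longleftrightarrow>
     (\<forall>t\<ge>0. ((\<lambda>s. nrm (\<lambda>x. \<phi> s x - \<phi> t x)) \<longlongrightarrow> 0) (at t within {0..}))"

definition has_time_deriv ::
  "(('a \<Rightarrow> real) \<Rightarrow> real) \<Rightarrow> (real \<Rightarrow> 'a \<Rightarrow> real) \<Rightarrow> (real \<Rightarrow> 'a \<Rightarrow> real) \<Rightarrow> bool" where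
  "has_time_deriv nrm \<phi> \<phi>' \<longleftrightarrow>
     (\<forall>t\<ge>0. ((\<lambda>s. nrm (\<lambda>x. (\<phi> s x - \<phi> t x) / (s - t) - \<phi>' t x)) \<longlongrightarrow> 0) (at t within {0..}))"

section \<open>Energy, ground state and eigenvalues\<close>

text \<open>
  The Bochner integral of a non-integrable function is 0. In dimension 3 this does not matter
  for the integrals below, since \<open>H01 \<Omega>\<close> embeds into the fourth-power integrable functions.
\<close>

definition energy :: "(real^3) set \<Rightarrow> (real^3 \<Rightarrow> real) \<Rightarrow> real \<Rightarrow> (real^3 \<Rightarrow> real) \<Rightarrow> real" where
  "energy \<Omega> V \<beta> v =
     (LINT x|lebesgue_on \<Omega>.
        1/2 * (norm (weak_grad \<Omega> v x))\<^sup>2 + 1/2 * V x * \<bar>v x\<bar>\<^sup>2 + \<beta>/4 * \<bar>v x\<bar>^4)"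

definition mu :: "(real^3) set \<Rightarrow> (real^3 \<Rightarrow> real) \<Rightarrow> real \<Rightarrow> (real^3 \<Rightarrow> real) \<Rightarrow> real" where
  "mu \<Omega> V \<beta> v = 1 / (L2_norm \<Omega> v)\<^sup>2 *
     (LINT x|lebesgue_on \<Omega>. (norm (weak_grad \<Omega> v x))\<^sup>2 + V x * \<bar>v x\<bar>\<^sup>2 + \<beta> * \<bar>v x\<bar>^4)"

definition is_ground_state ::
  "(real^3) set \<Rightarrow> (real^3 \<Rightarrow> real) \<Rightarrow> real \<Rightarrow> (real^3 \<Rightarrow> real) \<Rightarrow> bool" where
  "is_ground_state \<Omega> V \<beta> u \<longleftrightarrow>
     u \<in> H01 \<Omega> \<and> L2_norm \<Omega> u = 1 \<and> (AE x in lebesgue_on \<Omega>. u x > 0) \<and>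
     (\<forall>v\<in>H01 \<Omega>. L2_norm \<Omega> v = 1 \<longrightarrow> energy \<Omega> V \<beta> u \<le> energy \<Omega> V \<beta> v)"

text \<open>Weak solutions of \<open>- \<Delta>u + W u = \<nu> u\<close> with Dirichlet boundary values.\<close>

definition solves_eigenproblem ::
  "(real^3) set \<Rightarrow> (real^3 \<Rightarrow> real) \<Rightarrow> (real^3 \<Rightarrow> real) \<Rightarrow> real \<Rightarrow> bool" where
  "solves_eigenproblem \<Omega> W u \<nu> \<longleftrightarrow>
     u \<in> H01 \<Omega> \<and>
     (\<forall>v\<in>H01 \<Omega>.
        (LINT x|lebesgue_on \<Omega>. weak_grad \<Omega> u x \<bullet> weak_grad \<Omega> v x + W x * u x * v x) =
        \<nu> * (LINT x|lebesgue_on \<Omega>. u x * v x))"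

definition ae_independent ::
  "'a::euclidean_space set \<Rightarrow> nat \<Rightarrow> (nat \<Rightarrow> 'a \<Rightarrow> real) \<Rightarrow> bool" where
  "ae_independent \<Omega> n u \<longleftrightarrow>
     (\<forall>c. (AE x in lebesgue_on \<Omega>. (\<Sum>i<n. c i * u i x) = 0) \<longrightarrow> (\<forall>i<n. c i = 0))"

text \<open>
  The \<open>n\<close>-th eigenvalue (\<open>n \<ge> 1\<close>) counted with multiplicity: the smallest \<open>\<Lambda>\<close> for which there
  are \<open>n\<close> linearly independent eigenfunctions with eigenvalues at most \<open>\<Lambda>\<close>. The infimum is
  attained because the spectrum is discrete.
\<close>

definition nth_eigenvalue :: "(real^3) set \<Rightarrow> (real^3 \<Rightarrow> real) \<Rightarrow> nat \<Rightarrow> real" where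
  "nth_eigenvalue \<Omega> W n =
     Inf {\<Lambda>. \<exists>u \<nu>. ae_independent \<Omega> n u \<and>
                 (\<forall>i<n. solves_eigenproblem \<Omega> W (u i) (\<nu> i) \<and> \<nu> i \<le> \<Lambda>)}"

section \<open>The gradient flow\<close>

text \<open>
  Solutions in \<open>C\<^sup>1([0,\<infinity>); H01 \<Omega>) \<inter> C([0,\<infinity>); H2 \<Omega>)\<close>; \<open>\<phi>'\<close> is the time derivative as a curve
  in \<open>H01 \<Omega>\<close>, one-sided at 0. The Dirichlet condition is membership in \<open>H01 \<Omega>\<close>.
\<close>

definition is_flow_solution ::
  "(real^3) set \<Rightarrow> (real^3 \<Rightarrow> real) \<Rightarrow> real \<Rightarrow> (real^3 \<Rightarrow> real) \<Rightarrow> (real \<Rightarrow> real^3 \<Rightarrow> real) \<Rightarrow> bool" where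
  "is_flow_solution \<Omega> V \<beta> \<phi>\<^sub>0 \<phi> \<longleftrightarrow>
     (\<forall>t\<ge>0. \<phi> t \<in> H01 \<Omega> \<and> \<phi> t \<in> H2 \<Omega>) \<and>
     time_continuous (H2_norm \<Omega>) \<phi> \<and>
     (AE x in lebesgue_on \<Omega>. \<phi> 0 x = \<phi>\<^sub>0 x) \<and>
     (\<exists>\<phi>'. (\<forall>t\<ge>0. \<phi>' t \<in> H01 \<Omega>) \<and>
        has_time_deriv (H1_norm \<Omega>) \<phi> \<phi>' \<and> time_continuous (H1_norm \<Omega>) \<phi>' \<and>
        (\<forall>t>0. AE x in lebesgue_on \<Omega>.
           \<phi>' t x = weak_laplacian \<Omega> (\<phi> t) x - V x * \<phi> t x - \<beta> * \<bar>\<phi> t x\<bar>\<^sup>2 * \<phi> t x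
                     + mu \<Omega> V \<beta> (\<phi> t) * \<phi> t x))"

end

(* Write w = phi - phi_GS, and let a be the quadratic form of the operator linearized at phi_GS
   (without the shift by lambda_GS). Conservation of the norm gives <phi_GS, w> = -|w|^2/2, so w is
   orthogonal to phi_GS up to second order and a(w) - lambda_GS |w|^2 is bounded below by
   (lambda_2 - lambda_GS)(|w|^2 - |w|^4/4). Testing the equation with w then yields
     d/dt |w|^2 <= -2 (lambda_2 - lambda_GS - eps/2) |w|^2 - theta |grad w|^2
   as soon as w is small in H^1; the cubic and quartic terms are absorbed through the embedding of
   H^1_0 into L^4. The energy excess D is nonincreasing and bounded by a multiple of
   |w|^2 + |grad w|^2, so exp(2 (lambda_2 - lambda_GS - eps) t) (|w|^2 + eta D) is nonincreasing for
   small eta. Finally |grad w|^2 <= 2 D + lambda_GS |w|^2, because the quartic part of D - of density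
   w^2 ((w + 2 phi_GS)^2 + 2 phi_GS^2) - is nonnegative; this controls mu.

   The spectral gap comes from minimizing a on the orthogonal complement of phi_GS (Rellich plus the
   parallelogram law): the minimizer is an eigenfunction independent of phi_GS. *)

theory Submission
  imports Defs "HOL-Computational_Algebra.Polynomial" "HOL-Complex_Analysis.Great_Picard"
begin

section \<open>Smooth functions and bump functions\<close>

text \<open>The cubic error is controlled by the \<open>H1\<close> norm of w only, so an inequality
  in |w|^2 alone does not close; keeping a fraction \<open>\<theta>\<close> of the gradient cures
  this at the price of a little rate. Decay of |w|^2 in turn says nothing about the gradient, on
  which \<open>mu\<close> depends; the energy excess in the Lyapunov function supplies it. The bound
  for \<open>mu\<close> has half the rate of the energy: on the sphere the energy has no first-order
  term at the ground state, whereas \<open>mu\<close> keeps 2 \<beta> <phi_GS^3, w>.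

  Since \<open>lambda_2\<close> is an infimum, one exhibited pair of eigenfunctions bounds it from
  above by the larger of their eigenvalues; \<open>lambda_GS < lambda_2\<close> forces this to be
  the eigenvalue of the minimizer on the complement.

  Functions are representatives and weak derivatives are chosen, so their rules hold almost
  everywhere and rest on the fundamental lemma. Inequalities on \<open>H01\<close> are proved for
  test functions on the whole space, where translations and Fubini are available, and then extended
  by density.\<close>

lemma Ck_on_cong:
  assumes "\<And>x. f x = g x" "Ck_on k S f" shows "Ck_on k S g"
proof -
  have "f = g" using assms(1) by auto
  then show ?thesis using assms(2) by simp
qed

lemma Ck_on_const: "Ck_on k UNIV (\<lambda>x. c)"
proof (induction k arbitrary: c)
  case (Suc k)
  show ?case by (auto intro!: exI[of _ "\<lambda>x v. 0"] derivative_eq_intros Suc)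
qed simp

text \<open>\<open>Ck_on (Suc k)\<close> speaks about the derivatives only, so the lower regularity
  of the function itself has to be recovered, starting from differentiable implies continuous. The
  product rule needs it, since each of its terms keeps one undifferentiated factor.\<close>

lemma Ck_on_Suc_D: "Ck_on (Suc k) UNIV f \<Longrightarrow> Ck_on k UNIV f"
proof (induction k arbitrary: f)
  case 0
  then obtain f' where "\<And>x. (f has_derivative f' x) (at x)" by auto
  then show ?case
    by (auto simp: continuous_on_eq_continuous_at intro: has_derivative_continuous)
next
  case (Suc k)
  then show ?case unfolding Ck_on.simps(2)[of "Suc k"] Ck_on.simps(2)[of k] by blast
qed

lemma Ck_on_lincomb:
  "Ck_on k UNIV f \<Longrightarrow> Ck_on k UNIV g \<Longrightarrow> Ck_on k UNIV (\<lambda>x. f x + c * g x)"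
proof (induction k arbitrary: f g)
  case 0
  then show ?case by (auto intro!: continuous_intros)
next
  case (Suc k)
  from Suc.prems obtain f' g' where
    f: "\<And>x. (f has_derivative f' x) (at x)" "\<And>v. Ck_on k UNIV (\<lambda>x. f' x v)" and
    g: "\<And>x. (g has_derivative g' x) (at x)" "\<And>v. Ck_on k UNIV (\<lambda>x. g' x v)" by auto
  show ?case
    by (auto intro!: exI[of _ "\<lambda>x v. f' x v + c * g' x v"] derivative_eq_intros f g Suc.IH)
qed

lemma Ck_on_mult:
  "Ck_on k UNIV f \<Longrightarrow> Ck_on k UNIV g \<Longrightarrow> Ck_on k UNIV (\<lambda>x. f x * g x)"
proof (induction k arbitrary: f g)
  case 0
  then show ?case by (auto intro!: continuous_intros)
next
  case (Suc k)
  have fg: "Ck_on k UNIV f" "Ck_on k UNIV g" using Suc.prems Ck_on_Suc_D by auto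
  from Suc.prems obtain f' g' where
    f: "\<And>x. (f has_derivative f' x) (at x)" "\<And>v. Ck_on k UNIV (\<lambda>x. f' x v)" and
    g: "\<And>x. (g has_derivative g' x) (at x)" "\<And>v. Ck_on k UNIV (\<lambda>x. g' x v)" by auto
  have "((\<lambda>x. f x * g x) has_derivative (\<lambda>v. f x * g' x v + f' x v * g x)) (at x)" for x
    by (rule has_derivative_mult) (auto intro: f g)
  moreover have "Ck_on k UNIV (\<lambda>x. f x * g' x v + 1 * (f' x v * g x))" for v
    by (intro Ck_on_lincomb Suc.IH fg f g)
  ultimately show ?case by (auto intro!: exI[of _ "\<lambda>x v. f x * g' x v + f' x v * g x"])
qed

lemma Ck_on_prod:
  assumes "finite I" "\<And>i. i \<in> I \<Longrightarrow> Ck_on k UNIV (f i)"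
  shows "Ck_on k UNIV (\<lambda>x. \<Prod>i\<in>I. f i x)"
  using assms by (induction I) (auto intro: Ck_on_const Ck_on_mult)

text \<open>For \<open>p = 1\<close> this is the classical smooth function exp(-1/t), continued by
  zero. The polynomial in 1/t closes the family under differentiation, so that smoothness becomes an
  induction in which \<open>p\<close> varies.\<close>

definition flat :: "real poly \<Rightarrow> real \<Rightarrow> real" where
  "flat p t = (if t > 0 then poly p (1/t) * exp (- (1/t)) else 0)"

lemma flat_limit_0: "(flat p \<longlongrightarrow> 0) (at 0)"
proof -
  have "((\<lambda>t. poly p t * exp (- t)) \<longlongrightarrow> 0) at_top"
    unfolding poly_altdef sum_distrib_right
  proof (intro tendsto_null_sum)
    fix i
    have "((\<lambda>t::real. coeff p i * (t ^ i / exp t)) \<longlongrightarrow> coeff p i * 0) at_top"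
      by (intro tendsto_intros tendsto_power_div_exp_0)
    then show "((\<lambda>x. coeff p i * x ^ i * exp (- x)) \<longlongrightarrow> 0) at_top"
      by (simp add: exp_minus field_simps)
  qed
  then have "((\<lambda>t. poly p (1/t) * exp (- (1/t))) \<longlongrightarrow> 0) (at_right 0)"
    by (rule filterlim_compose) (simp add: inverse_eq_divide[symmetric] filterlim_inverse_at_top_right)
  then have "(flat p \<longlongrightarrow> 0) (at_right 0)"
    by (rule Lim_transform_eventually) (auto simp: flat_def eventually_at_filter)
  moreover have "(flat p \<longlongrightarrow> 0) (at_left 0)"
    by (rule Lim_transform_eventually[OF tendsto_const]) (auto simp: flat_def eventually_at_filter)
  ultimately show ?thesis using filterlim_at_split by blast
qed

text \<open>Differentiating \<open>p(1/t) e\<^sup>-\<^sup>1\<^sup>/\<^sup>t\<close> gives \<open>q(1/t) e\<^sup>-\<^sup>1\<^sup>/\<^sup>t\<close> with \<open>q(s) = s\<^sup>2 (p(s) - p'(s))\<close>.\<close>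

lemma flat_deriv:
  "(flat p has_field_derivative flat ([:0,0,1:] * (p - pderiv p)) t) (at t)"
proof -
  consider "t > 0" | "t < 0" | "t = 0" by linarith
  then show ?thesis
  proof cases
    case 1
    have "((\<lambda>t. poly p (1/t) * exp (- (1/t))) has_field_derivative
        flat ([:0,0,1:] * (p - pderiv p)) t) (at t)"
      using 1 by (auto intro!: derivative_eq_intros DERIV_chain2[OF poly_DERIV]
          simp: flat_def field_simps power2_eq_square)
    then show ?thesis
      by (rule has_field_derivative_transform_within_open[of _ _ _ "{0<..}"])
        (use 1 in \<open>auto simp: flat_def\<close>)
  next
    case 2
    have "((\<lambda>t. 0) has_field_derivative flat ([:0,0,1:] * (p - pderiv p)) t) (at t)"
      using 2 by (auto simp: flat_def)
    then show ?thesis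
      by (rule has_field_derivative_transform_within_open[of _ _ _ "{..<0}"])
        (use 2 in \<open>auto simp: flat_def\<close>)
  next
    case 3
    \<comment> \<open>Dividing by t multiplies the polynomial in 1/t by its variable: the difference
      quotient at 0 is itself of the form \<open>flat\<close> and tends to 0.\<close>
    have "((\<lambda>t. (flat p t - flat p 0) / (t - 0)) \<longlongrightarrow> 0) (at 0)"
    proof (rule Lim_transform_eventually[OF flat_limit_0[of "[:0,1:] * p"]])
      show "\<forall>\<^sub>F x in at 0. flat ([:0, 1:] * p) x = (flat p x - flat p 0) / (x - 0)"
        by (auto simp: eventually_at_filter flat_def field_simps)
    qed
    then show ?thesis using 3 by (simp add: has_field_derivative_iff flat_def)
  qed
qed

lemma Ck_on_flat_affine:
  fixes e :: "'a::euclidean_space"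
  shows "Ck_on k UNIV (\<lambda>x. flat p (x \<bullet> e + c))"
proof (induction k arbitrary: p)
  case 0
  have "continuous_on UNIV (flat p)"
    by (meson DERIV_isCont continuous_at_imp_continuous_on flat_deriv)
  then show ?case
    by (auto intro!: continuous_intros continuous_on_compose2[of UNIV "flat p"])
next
  case (Suc k)
  let ?q = "[:0,0,1:] * (p - pderiv p)"
  have "((\<lambda>x. flat p (x \<bullet> e + c)) has_derivative (\<lambda>v. flat ?q (x \<bullet> e + c) * (v \<bullet> e))) (at x)" for x
  proof -
    have "((\<lambda>x. x \<bullet> e + c) has_derivative (\<lambda>v. v \<bullet> e)) (at x)"
      by (auto intro!: derivative_eq_intros)
    from has_derivative_compose[OF this flat_deriv[unfolded has_field_derivative_def]]
    show ?thesis .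
  qed
  moreover have "Ck_on k UNIV (\<lambda>x. 0 + (v \<bullet> e) * flat ?q (x \<bullet> e + c))" for v
    by (intro Ck_on_lincomb Suc.IH Ck_on_const)
  ultimately show ?case
    by (auto intro!: exI[of _ "\<lambda>x v. flat ?q (x \<bullet> e + c) * (v \<bullet> e)"] simp: mult.commute)
qed

text \<open>The values \<open>e\<^sup>-\<^sup>1\<^sup>/\<^sup>(\<^sup>n\<^sup>s\<^sup>)\<close> increase to \<open>1\<close> for \<open>s > 0\<close>, so these bumps converge to the indicator of the box.\<close>

definition box_bump :: "'a::euclidean_space \<Rightarrow> 'a \<Rightarrow> nat \<Rightarrow> 'a \<Rightarrow> real" where
  "box_bump a b n x = (\<Prod>i\<in>Basis. flat 1 (real (Suc n) * (x \<bullet> i - a \<bullet> i)) *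
                                     flat 1 (real (Suc n) * (b \<bullet> i - x \<bullet> i)))"

lemma flat_1_bounds: "0 \<le> flat 1 t" "flat 1 t \<le> 1"
  by (auto simp: flat_def)

lemma flat_1_limit: "(\<lambda>n. flat 1 (real (Suc n) * s)) \<longlonglongrightarrow> (if s > 0 then 1 else 0)"
proof (cases "s > 0")
  case True
  have "(\<lambda>n. exp (- (1 / s * inverse (real (Suc n))))) \<longlonglongrightarrow> exp (- (1 / s * 0))"
    by (intro tendsto_intros LIMSEQ_inverse_real_of_nat)
  moreover have "flat 1 (real (Suc n) * s) = exp (- (1 / s * inverse (real (Suc n))))" for n
    using True by (simp add: flat_def field_simps add_pos_nonneg)
  ultimately show ?thesis using True by simp
next
  case False
  then have "flat 1 (real (Suc n) * s) = 0" for n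
    by (simp add: flat_def zero_less_mult_iff)
  then show ?thesis using False by simp
qed

lemma box_bump_bounds: "0 \<le> box_bump a b n x" "box_bump a b n x \<le> 1"
  unfolding box_bump_def by (auto intro!: prod_nonneg prod_le_1 mult_le_one flat_1_bounds mult_nonneg_nonneg)

lemma box_bump_eq_0: "x \<notin> box a b \<Longrightarrow> box_bump a b n x = 0"
  by (force simp: box_bump_def mem_box flat_def zero_less_mult_iff not_less)

lemma box_bump_limit: "(\<lambda>n. box_bump a b n x) \<longlonglongrightarrow> indicator (box a b) x"
proof -
  have "(\<lambda>n. box_bump a b n x) \<longlonglongrightarrow> (\<Prod>i\<in>Basis. (if x \<bullet> i - a \<bullet> i > 0 then 1 else 0) * (if b \<bullet> i - x \<bullet> i > 0 then 1 else 0))"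
    unfolding box_bump_def by (intro tendsto_prod tendsto_mult flat_1_limit)
  also have "(\<Prod>i\<in>Basis. (if x \<bullet> i - a \<bullet> i > 0 then 1 else 0) * (if b \<bullet> i - x \<bullet> i > 0 then 1 else 0)) = indicat_real (box a b) x"
    by (cases "x \<in> box a b") (auto simp: mem_box intro!: prod.neutral)
  finally show ?thesis .
qed

lemma smooth_box_bump: "smooth_on UNIV (box_bump a b n)"
  unfolding smooth_on_def
proof
  fix k
  have 1: "Ck_on k UNIV (\<lambda>x. flat 1 (real (Suc n) * (x \<bullet> i - a \<bullet> i)))" for i
    by (rule Ck_on_cong[OF _ Ck_on_flat_affine[of k 1 "real (Suc n) *\<^sub>R i" "- real (Suc n) * (a \<bullet> i)"]])
      (simp add: algebra_simps)
  have 2: "Ck_on k UNIV (\<lambda>x. flat 1 (real (Suc n) * (b \<bullet> i - x \<bullet> i)))" for i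
    by (rule Ck_on_cong[OF _ Ck_on_flat_affine[of k 1 "- real (Suc n) *\<^sub>R i" "real (Suc n) * (b \<bullet> i)"]])
      (simp add: algebra_simps)
  show "Ck_on k UNIV (box_bump a b n)"
    unfolding box_bump_def[abs_def] by (rule Ck_on_prod[OF finite_Basis Ck_on_mult[OF 1 2]])
qed

lemma box_bump_test: "cbox a b \<subseteq> \<Omega> \<Longrightarrow> box_bump a b n \<in> test_functions \<Omega>"
  unfolding test_functions_def
  by (auto intro!: exI[of _ "cbox a b"] smooth_box_bump box_bump_eq_0 dest: subsetD[OF box_subset_cbox])

section \<open>Operations on test functions\<close>

lemma test_functions_lincomb:
  assumes "\<psi> \<in> test_functions \<Omega>" "\<eta> \<in> test_functions \<Omega>"
  shows "(\<lambda>x. \<psi> x + c * \<eta> x) \<in> test_functions \<Omega>"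
proof -
  obtain K L where "compact K" "K \<subseteq> \<Omega>" "\<And>x. x \<notin> K \<Longrightarrow> \<psi> x = 0"
    "compact L" "L \<subseteq> \<Omega>" "\<And>x. x \<notin> L \<Longrightarrow> \<eta> x = 0" "smooth_on UNIV \<psi>" "smooth_on UNIV \<eta>"
    using assms unfolding test_functions_def by blast
  then have "smooth_on UNIV (\<lambda>x. \<psi> x + c * \<eta> x)" "compact (K \<union> L)" "K \<union> L \<subseteq> \<Omega>"
    "\<forall>x. x \<notin> K \<union> L \<longrightarrow> \<psi> x + c * \<eta> x = 0"
    by (auto intro!: Ck_on_lincomb simp: smooth_on_def)
  then show ?thesis unfolding test_functions_def by blast
qed

lemma test_functions_0: "(\<lambda>x. 0) \<in> test_functions \<Omega>"
  unfolding test_functions_def by (auto intro!: exI[of _ "{}"] Ck_on_const simp: smooth_on_def)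

lemma smooth_on_differentiable:
  assumes "smooth_on UNIV \<psi>"
  shows "(\<psi> has_derivative frechet_derivative \<psi> (at x)) (at x)"
proof -
  have "Ck_on (Suc 0) UNIV \<psi>" using assms by (simp add: smooth_on_def del: Ck_on.simps)
  then show ?thesis unfolding frechet_derivative_works[symmetric] differentiable_def by auto
qed

lemma smooth_on_frechet_derivative:
  assumes "smooth_on UNIV \<psi>"
  shows "smooth_on UNIV (\<lambda>x. frechet_derivative \<psi> (at x) v)"
  unfolding smooth_on_def
proof
  fix k
  have "Ck_on (Suc k) UNIV \<psi>" using assms by (simp add: smooth_on_def del: Ck_on.simps)
  then obtain f' where f': "\<And>x. (\<psi> has_derivative f' x) (at x)" "\<And>v. Ck_on k UNIV (\<lambda>x. f' x v)" by auto
  then have "f' x = frechet_derivative \<psi> (at x)" for x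
    using frechet_derivative_at by metis
  then show "Ck_on k UNIV (\<lambda>x. frechet_derivative \<psi> (at x) v)" using f'(2)[of v] by simp
qed

lemma smooth_on_continuous: "smooth_on UNIV \<psi> \<Longrightarrow> continuous_on UNIV \<psi>"
  unfolding smooth_on_def using Ck_on.simps(1) by blast

lemma test_functions_frechet_derivative:
  assumes "\<psi> \<in> test_functions \<Omega>"
  shows "(\<lambda>x. frechet_derivative \<psi> (at x) v) \<in> test_functions \<Omega>"
proof -
  obtain K where K: "smooth_on UNIV \<psi>" "compact K" "K \<subseteq> \<Omega>" "\<And>x. x \<notin> K \<Longrightarrow> \<psi> x = 0"
    using assms unfolding test_functions_def by blast
  have "frechet_derivative \<psi> (at x) v = 0" if "x \<notin> K" for x
  proof -
    have "((\<lambda>x. 0) has_derivative frechet_derivative \<psi> (at x)) (at x)"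
      by (rule has_derivative_transform_within_open[OF smooth_on_differentiable[OF K(1)], of "- K"])
        (use that K compact_imp_closed in auto)
    then have "frechet_derivative \<psi> (at x) = (\<lambda>v. 0)"
      by (metis frechet_derivative_at frechet_derivative_const)
    then show ?thesis by simp
  qed
  then show ?thesis unfolding test_functions_def
    using K smooth_on_frechet_derivative by blast
qed

lemma test_functions_compact_support:
  assumes "\<psi> \<in> test_functions \<Omega>"
  obtains K where "compact K" "K \<subseteq> \<Omega>" "\<And>x. x \<notin> K \<Longrightarrow> \<psi> x = 0" "continuous_on UNIV \<psi>"
  using assms smooth_on_continuous unfolding test_functions_def by blast

section \<open>The fundamental lemma of the calculus of variations\<close>

text \<open>The positive and the negative part of \<open>f\<close> are densities of two finite
  measures. These agree on boxes, an intersection-stable generator, and hence on all Borel sets, in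
  particular on the sets where \<open>f\<close> has a fixed sign.\<close>

lemma AE_0_of_box_integrals:
  fixes f :: "'a::euclidean_space \<Rightarrow> real"
  assumes f: "integrable lborel f" and 0: "\<And>a b. (LINT x|lborel. f x * indicator (box a b) x) = 0"
  shows "AE x in lborel. f x = 0"
proof -
  define P where "P = density lborel (\<lambda>x. ennreal (max 0 (f x)))"
  define N where "N = density lborel (\<lambda>x. ennreal (max 0 (- f x)))"
  have [measurable]: "f \<in> borel_measurable lborel" using f by auto
  have ip: "integrable lborel (\<lambda>x. max 0 (f x) * indicator A x)"
    and im: "integrable lborel (\<lambda>x. max 0 (- f x) * indicator A x)" if [measurable]: "A \<in> sets borel" for A
    by (rule Bochner_Integration.integrable_bound[OF f]; auto simp: indicator_def)+
  have P: "emeasure P A = ennreal (LINT x|lborel. max 0 (f x) * indicator A x)"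
    and N: "emeasure N A = ennreal (LINT x|lborel. max 0 (- f x) * indicator A x)"
    if [measurable]: "A \<in> sets borel" for A
  proof -
    have "emeasure P A = (\<integral>\<^sup>+x. ennreal (max 0 (f x) * indicator A x) \<partial>lborel)"
      unfolding P_def by (subst emeasure_density) (auto intro!: nn_integral_cong simp: indicator_def)
    then show "emeasure P A = ennreal (LINT x|lborel. max 0 (f x) * indicator A x)"
      by (subst (asm) nn_integral_eq_integral[OF ip[OF that]]) auto
    have "emeasure N A = (\<integral>\<^sup>+x. ennreal (max 0 (- f x) * indicator A x) \<partial>lborel)"
      unfolding N_def by (subst emeasure_density) (auto intro!: nn_integral_cong simp: indicator_def)
    then show "emeasure N A = ennreal (LINT x|lborel. max 0 (- f x) * indicator A x)"
      by (subst (asm) nn_integral_eq_integral[OF im[OF that]]) auto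
  qed
  have "P = N"
  proof (rule measure_eqI_generator_eq[where E = "range (\<lambda>(a,b). box a b :: 'a set)" and \<Omega> = UNIV
        and A = "\<lambda>n. box (- (real n *\<^sub>R One)) (real n *\<^sub>R One)"])
    show "Int_stable (range (\<lambda>(a,b). box a b :: 'a set))"
      by (auto simp: Int_stable_def box_Int_box)
    show "emeasure P X = emeasure N X" if "X \<in> range (\<lambda>(a, b). box a b)" for X
    proof -
      obtain a b where X: "X = box a b"
      proof -
        from \<open>X \<in> _\<close> obtain z where "X = (case z of (a, b) \<Rightarrow> box a b)" by blast
        then show thesis using that by (cases z) simp
      qed
      have "(LINT x|lborel. max 0 (f x) * indicator X x) - (LINT x|lborel. max 0 (- f x) * indicator X x)
        = (LINT x|lborel. f x * indicator X x)"
        by (subst Bochner_Integration.integral_diff[OF ip im, symmetric])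
          (auto simp: X max_def indicator_def intro!: Bochner_Integration.integral_cong)
      then show ?thesis using 0[of a b] P[of X] N[of X] by (simp add: X)
    qed
    have "sets (borel :: 'a measure) = sigma_sets UNIV (range (\<lambda>(a, b). box a b))"
      by (subst borel_eq_box) (rule sets_measure_of, simp)
    then show "sets P = sigma_sets UNIV (range (\<lambda>(a, b). box a b))"
      "sets N = sigma_sets UNIV (range (\<lambda>(a, b). box a b))"
      by (simp_all only: P_def N_def sets_density sets_lborel)
    show "range (\<lambda>n. box (- (real n *\<^sub>R One)) (real n *\<^sub>R One)) \<subseteq> range (\<lambda>(a, b). box a b :: 'a set)"
      by blast
    show "(\<Union>i. box (- (real i *\<^sub>R One)) (real i *\<^sub>R One)) = (UNIV :: 'a set)"
      by (rule UN_box_eq_UNIV)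
    show "emeasure P (box (- (real i *\<^sub>R One)) (real i *\<^sub>R One)) \<noteq> \<infinity>" for i
      using P[of "box (- (real i *\<^sub>R One)) (real i *\<^sub>R One)"] by simp
  qed simp
  then have eq: "(LINT x|lborel. max 0 (f x) * indicator A x) = (LINT x|lborel. max 0 (- f x) * indicator A x)"
    if "A \<in> sets borel" for A
  proof -
    have "0 \<le> (LINT x|lborel. max 0 (f x) * indicator A x)" "0 \<le> (LINT x|lborel. max 0 (- f x) * indicator A x)"
      by (auto intro!: integral_nonneg_AE)
    then show ?thesis using P[OF that] N[OF that] \<open>P = N\<close> by (metis ennreal_inj)
  qed
  have "AE x in lborel. max 0 (f x) = 0"
  proof -
    \<comment> \<open>Where \<open>f > 0\<close> the density of \<open>N\<close> vanishes, so
      equality of the measures annihilates the positive part.\<close>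
    have "(LINT x|lborel. max 0 (f x) * indicator {x. f x > 0} x) =
        (LINT x|lborel. max 0 (- f x) * indicator {x. f x > 0} x)"
      by (rule eq) measurable
    also have "\<dots> = (LINT x|(lborel :: 'a measure). 0)"
      by (rule Bochner_Integration.integral_cong) (auto simp: indicator_def)
    finally have "AE x in lborel. max 0 (f x) * indicator {x. f x > 0} x = 0"
      by (subst integral_nonneg_eq_0_iff_AE[symmetric]) (auto intro!: ip)
    then show ?thesis by eventually_elim (auto simp: indicator_def split: if_splits)
  qed
  moreover have "AE x in lborel. max 0 (- f x) = 0"
  proof -
    have "(LINT x|lborel. max 0 (- f x) * indicator {x. f x < 0} x) =
        (LINT x|lborel. max 0 (f x) * indicator {x. f x < 0} x)"
      by (rule eq[symmetric]) measurable
    also have "\<dots> = (LINT x|(lborel :: 'a measure). 0)"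
      by (rule Bochner_Integration.integral_cong) (auto simp: indicator_def)
    finally have "AE x in lborel. max 0 (- f x) * indicator {x. f x < 0} x = 0"
      by (subst integral_nonneg_eq_0_iff_AE[symmetric]) (auto intro!: im)
    then show ?thesis by eventually_elim (auto simp: indicator_def split: if_splits)
  qed
  ultimately show ?thesis by eventually_elim (auto simp: max_def split: if_splits)
qed

section \<open>Spaces of functions with a positive semidefinite form\<close>

text \<open>A carrier set instead of a type, and semidefinite instead of definite: elements are
  representatives, so null functions have norm zero. The instances are the \<open>L2\<close>
  product, the Dirichlet form, the \<open>H1\<close> product on \<open>H1\<close> and on
  \<open>H01\<close>, the forms \<open>A\<close> and \<open>a\<close>, and a shifted form on
  \<open>perp\<close> that degenerates at the minimizer.\<close>

locale pre_inner =
  fixes S :: "('a \<Rightarrow> real) set" and B :: "('a \<Rightarrow> real) \<Rightarrow> ('a \<Rightarrow> real) \<Rightarrow> real"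
  assumes zero: "(\<lambda>x. 0) \<in> S"
    and lin: "u \<in> S \<Longrightarrow> v \<in> S \<Longrightarrow> (\<lambda>x. u x + c * v x) \<in> S"
    and sym: "u \<in> S \<Longrightarrow> v \<in> S \<Longrightarrow> B u v = B v u"
    and lin_left: "u \<in> S \<Longrightarrow> v \<in> S \<Longrightarrow> w \<in> S \<Longrightarrow>
      B (\<lambda>x. u x + c * v x) w = B u w + c * B v w"
    and nonneg: "u \<in> S \<Longrightarrow> 0 \<le> B u u"
begin

definition nrm :: "('a \<Rightarrow> real) \<Rightarrow> real" where "nrm u = sqrt (B u u)"

lemma scale: "u \<in> S \<Longrightarrow> (\<lambda>x. c * u x) \<in> S"
  using lin[OF zero, of u c] by simp

lemma add: "u \<in> S \<Longrightarrow> v \<in> S \<Longrightarrow> (\<lambda>x. u x + v x) \<in> S"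
  using lin[of u v 1] by simp

lemma diff: "u \<in> S \<Longrightarrow> v \<in> S \<Longrightarrow> (\<lambda>x. u x - v x) \<in> S"
  using lin[of u v "-1"] by simp

lemma lin_right: "u \<in> S \<Longrightarrow> v \<in> S \<Longrightarrow> w \<in> S \<Longrightarrow> B w (\<lambda>x. u x + c * v x) = B w u + c * B w v"
  using lin_left[of u v w c] sym lin by simp

lemma diff_left: "u \<in> S \<Longrightarrow> v \<in> S \<Longrightarrow> w \<in> S \<Longrightarrow> B (\<lambda>x. u x - v x) w = B u w - B v w"
  using lin_left[of u v w "-1"] by simp

lemma diff_right: "u \<in> S \<Longrightarrow> v \<in> S \<Longrightarrow> w \<in> S \<Longrightarrow> B w (\<lambda>x. u x - v x) = B w u - B w v"
  using lin_right[of u v w "-1"] by simp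

lemma zero_left: "w \<in> S \<Longrightarrow> B (\<lambda>x. 0) w = 0"
  using lin_left[OF zero zero, of w 1] by simp

lemma scale_left: "u \<in> S \<Longrightarrow> w \<in> S \<Longrightarrow> B (\<lambda>x. c * u x) w = c * B u w"
  using lin_left[OF zero, of u w c] zero_left by simp

lemma scale_right: "u \<in> S \<Longrightarrow> w \<in> S \<Longrightarrow> B w (\<lambda>x. c * u x) = c * B w u"
  using scale_left[of u w c] sym scale by simp

lemma square_lincomb:
  assumes "u \<in> S" "v \<in> S"
  shows "B (\<lambda>x. u x + c * v x) (\<lambda>x. u x + c * v x) = B u u + 2 * c * B u v + c\<^sup>2 * B v v"
  using assms lin[OF assms, of c] sym[OF assms]
  by (simp add: lin_left lin_right algebra_simps power2_eq_square)

lemma square_diff: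
  assumes "u \<in> S" "v \<in> S"
  shows "B (\<lambda>x. u x - v x) (\<lambda>x. u x - v x) = B u u - 2 * B u v + B v v"
  using square_lincomb[OF assms, of "-1"] by simp

lemma Cauchy_Schwarz_square:
  assumes "u \<in> S" "v \<in> S" shows "(B u v)\<^sup>2 \<le> B u u * B v v"
proof -
  have q: "0 \<le> B u u + 2 * c * B u v + c\<^sup>2 * B v v" for c
    using square_lincomb[OF assms, of c] nonneg[OF lin[OF assms, of c]] by simp
  show ?thesis
  proof (cases "B v v = 0")
    case True
    have "B u v = 0"
    proof (rule ccontr)
      assume "B u v \<noteq> 0"
      \<comment> \<open>With \<open>B v v = 0\<close> the quadratic in \<open>c\<close> is affine;
        this \<open>c\<close> would give it the value -1.\<close>
      then show False using q[of "- (B u u + 1) / (2 * B u v)"] True by (simp add: field_simps)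
    qed
    then show ?thesis using True by simp
  next
    case False
    then have "B v v > 0" using nonneg[OF assms(2)] by simp
    \<comment> \<open>The minimizer of the quadratic in \<open>c\<close>.\<close>
    then show ?thesis using q[of "- B u v / B v v"]
      by (simp add: field_simps power2_eq_square)
  qed
qed

lemma Cauchy_Schwarz: assumes "u \<in> S" "v \<in> S" shows "\<bar>B u v\<bar> \<le> nrm u * nrm v"
  using real_sqrt_le_mono[OF Cauchy_Schwarz_square[OF assms]]
  by (simp add: nrm_def real_sqrt_mult)

lemma nrm_nonneg: "u \<in> S \<Longrightarrow> 0 \<le> nrm u" by (simp add: nrm_def nonneg)

lemma nrm_square: "u \<in> S \<Longrightarrow> (nrm u)\<^sup>2 = B u u" by (simp add: nrm_def nonneg)

lemma nrm_scale: "u \<in> S \<Longrightarrow> nrm (\<lambda>x. c * u x) = \<bar>c\<bar> * nrm u"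
  by (simp add: nrm_def scale_left scale_right scale real_sqrt_mult)

lemma nrm_triangle: assumes "u \<in> S" "v \<in> S" shows "nrm (\<lambda>x. u x + v x) \<le> nrm u + nrm v"
proof (rule power2_le_imp_le)
  have "(nrm (\<lambda>x. u x + v x))\<^sup>2 = B u u + 2 * B u v + B v v"
    using square_lincomb[OF assms, of 1] add[OF assms] by (simp add: nrm_square)
  also have "\<dots> \<le> (nrm u)\<^sup>2 + 2 * (nrm u * nrm v) + (nrm v)\<^sup>2"
    using Cauchy_Schwarz[OF assms] assms by (simp add: nrm_square)
  finally show "(nrm (\<lambda>x. u x + v x))\<^sup>2 \<le> (nrm u + nrm v)\<^sup>2"
    by (simp add: power2_eq_square algebra_simps)
qed (use assms nrm_nonneg in auto)

lemma nrm_minus_commute: "u \<in> S \<Longrightarrow> v \<in> S \<Longrightarrow> nrm (\<lambda>x. u x - v x) = nrm (\<lambda>x. v x - u x)"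
  using nrm_scale[of "\<lambda>x. v x - u x" "-1"] diff[of v u] by simp

lemma nrm_le_add: assumes "u \<in> S" "v \<in> S" shows "nrm u \<le> nrm v + nrm (\<lambda>x. u x - v x)"
  using nrm_triangle[OF assms(2) diff[OF assms]] by simp

lemma nrm_diff_triangle:
  assumes "u \<in> S" "v \<in> S" "w \<in> S"
  shows "nrm (\<lambda>x. u x - w x) \<le> nrm (\<lambda>x. u x - v x) + nrm (\<lambda>x. v x - w x)"
  using nrm_triangle[OF diff[OF assms(1,2)] diff[OF assms(2,3)]] by simp

lemma tendsto_nrm:
  assumes "\<forall>\<^sub>F s in F. u s \<in> S" "u' \<in> S" "((\<lambda>s. nrm (\<lambda>x. u s x - u' x)) \<longlongrightarrow> 0) F"
  shows "((\<lambda>s. nrm (u s)) \<longlongrightarrow> nrm u') F"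
proof (rule LIM_zero_cancel, rule Lim_null_comparison[OF _ assms(3)])
  show "\<forall>\<^sub>F s in F. norm (nrm (u s) - nrm u') \<le> nrm (\<lambda>x. u s x - u' x)"
    using assms(1)
  proof eventually_elim
    case (elim s)
    then show ?case
      using nrm_le_add[OF elim assms(2)] nrm_le_add[OF assms(2) elim] nrm_minus_commute[OF elim assms(2)]
      by simp
  qed
qed

lemma tendsto_form:
  assumes u: "\<forall>\<^sub>F s in F. u s \<in> S" "u' \<in> S" "((\<lambda>s. nrm (\<lambda>x. u s x - u' x)) \<longlongrightarrow> 0) F"
    and v: "\<forall>\<^sub>F s in F. v s \<in> S" "v' \<in> S" "((\<lambda>s. nrm (\<lambda>x. v s x - v' x)) \<longlongrightarrow> 0) F"
  shows "((\<lambda>s. B (u s) (v s)) \<longlongrightarrow> B u' v') F"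
proof (rule LIM_zero_cancel, rule Lim_null_comparison)
  show "\<forall>\<^sub>F s in F. norm (B (u s) (v s) - B u' v') \<le>
      nrm (\<lambda>x. u s x - u' x) * nrm (v s) + nrm u' * nrm (\<lambda>x. v s x - v' x)"
    using u(1) v(1)
  proof eventually_elim
    case (elim s)
    have "B (u s) (v s) - B u' v' = B (\<lambda>x. u s x - u' x) (v s) + B u' (\<lambda>x. v s x - v' x)"
      using elim u(2) v(2) by (simp add: diff_left diff_right)
    then show ?case
      using Cauchy_Schwarz[OF diff[OF elim(1) u(2)] elim(2)] Cauchy_Schwarz[OF u(2) diff[OF elim(2) v(2)]]
      by simp
  qed
  have "((\<lambda>s. nrm (\<lambda>x. u s x - u' x) * nrm (v s) + nrm u' * nrm (\<lambda>x. v s x - v' x)) \<longlongrightarrow>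
      0 * nrm v' + nrm u' * 0) F"
    by (intro tendsto_intros u v tendsto_nrm)
  then show "((\<lambda>s. nrm (\<lambda>x. u s x - u' x) * nrm (v s) + nrm u' * nrm (\<lambda>x. v s x - v' x)) \<longlongrightarrow> 0) F"
    by simp
qed

text \<open>The increment is \<open>s - t\<close> times the difference quotient, whose norm
  converges to that of \<open>\<phi>'\<close>.\<close>

lemma difference_quotient_imp_continuous:
  fixes \<phi> :: "real \<Rightarrow> 'a \<Rightarrow> real"
  assumes \<phi>: "\<forall>\<^sub>F s in at t. \<phi> s \<in> S" "\<phi> t \<in> S" and "\<phi>' \<in> S"
    and lim: "((\<lambda>s. nrm (\<lambda>x. (\<phi> s x - \<phi> t x) / (s - t) - \<phi>' x)) \<longlongrightarrow> 0) (at t)"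
  shows "((\<lambda>s. nrm (\<lambda>x. \<phi> s x - \<phi> t x)) \<longlongrightarrow> 0) (at t)"
proof -
  let ?q = "\<lambda>s x. (\<phi> s x - \<phi> t x) / (s - t)"
  have q: "\<forall>\<^sub>F s in at t. ?q s \<in> S"
    using \<phi>(1)
  proof eventually_elim
    case (elim s)
    show ?case using scale[OF diff[OF elim \<phi>(2)], of "1 / (s - t)"] by simp
  qed
  have "((\<lambda>s. \<bar>s - t\<bar> * nrm (?q s)) \<longlongrightarrow> \<bar>t - t\<bar> * nrm \<phi>') (at t)"
    by (intro tendsto_intros tendsto_nrm q lim assms)
  then have "((\<lambda>s. \<bar>s - t\<bar> * nrm (?q s)) \<longlongrightarrow> 0) (at t)" by simp
  then show ?thesis
  proof (rule Lim_transform_eventually)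
    have "\<forall>\<^sub>F s in at t. s \<noteq> t" by (simp add: eventually_at_filter)
    then show "\<forall>\<^sub>F s in at t. \<bar>s - t\<bar> * nrm (?q s) = nrm (\<lambda>x. \<phi> s x - \<phi> t x)"
      using q
    proof eventually_elim
      case (elim s)
      then show ?case using nrm_scale[OF elim(2), of "s - t"] by simp
    qed
  qed
qed

text \<open>Symmetry factors the increment of the square as \<open>B (\<phi> s - \<phi> t) (\<phi>
  s) + B (\<phi> s - \<phi> t) (\<phi> t)\<close>; after division by \<open>s - t\<close> both terms
  converge by joint continuity of \<open>B\<close>.\<close>

lemma has_derivative_form:
  fixes \<phi> :: "real \<Rightarrow> 'a \<Rightarrow> real"
  assumes \<phi>: "\<forall>\<^sub>F s in at t. \<phi> s \<in> S" "\<phi> t \<in> S" and \<phi>': "\<phi>' \<in> S"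
    and lim: "((\<lambda>s. nrm (\<lambda>x. (\<phi> s x - \<phi> t x) / (s - t) - \<phi>' x)) \<longlongrightarrow> 0) (at t)"
  shows "((\<lambda>s. B (\<phi> s) (\<phi> s)) has_real_derivative 2 * B \<phi>' (\<phi> t)) (at t)"
proof -
  let ?q = "\<lambda>s x. (\<phi> s x - \<phi> t x) / (s - t)"
  have q: "\<forall>\<^sub>F s in at t. ?q s \<in> S"
    using \<phi>(1)
  proof eventually_elim
    case (elim s)
    show ?case using scale[OF diff[OF elim \<phi>(2)], of "1 / (s - t)"] by simp
  qed
  have "nrm (\<lambda>x. \<phi> t x - \<phi> t x) = 0" by (simp add: nrm_def zero_left zero)
  then have "((\<lambda>s. B (?q s) (\<phi> s) + B (?q s) (\<phi> t)) \<longlongrightarrow> B \<phi>' (\<phi> t) + B \<phi>' (\<phi> t)) (at t)"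
    by (intro tendsto_add tendsto_form q lim \<phi> \<phi>' difference_quotient_imp_continuous[OF \<phi> \<phi>' lim]) 
      (auto simp: \<phi>)
  then have "((\<lambda>s. B (?q s) (\<phi> s) + B (?q s) (\<phi> t)) \<longlongrightarrow> 2 * B \<phi>' (\<phi> t)) (at t)" by simp
  then have "((\<lambda>s. (B (\<phi> s) (\<phi> s) - B (\<phi> t) (\<phi> t)) / (s - t)) \<longlongrightarrow> 2 * B \<phi>' (\<phi> t)) (at t)"
  proof (rule Lim_transform_eventually)
    have "\<forall>\<^sub>F s in at t. s \<noteq> t" by (simp add: eventually_at_filter)
    then show "\<forall>\<^sub>F s in at t. B (?q s) (\<phi> s) + B (?q s) (\<phi> t) =
        (B (\<phi> s) (\<phi> s) - B (\<phi> t) (\<phi> t)) / (s - t)"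
      using \<phi>(1)
    proof eventually_elim
      case (elim s)
      have "B (?q s) w = (B (\<phi> s) w - B (\<phi> t) w) / (s - t)" if "w \<in> S" for w
        using scale_left[OF diff[OF elim(2) \<phi>(2)] that, of "1 / (s - t)"] elim \<phi> that
        by (simp add: diff_left)
      then show ?case using elim \<phi>(2) sym[OF elim(2) \<phi>(2)] by (simp add: diff_divide_distrib)
    qed
  qed
  then show ?thesis unfolding has_field_derivative_iff .
qed

end

section \<open>The space of square integrable functions\<close>

text \<open>Fatou's lemma for Bochner integrals. That it also yields integrability of the limit is
  what the completeness of \<open>L2\<close> and the passage from test functions to
  \<open>H01\<close> in the fourth-power bound rely on.\<close>

lemma integrable_Fatou:
  fixes f :: "nat \<Rightarrow> 'a \<Rightarrow> real"
  assumes f: "\<And>n. integrable M (f n)" "\<And>n x. 0 \<le> f n x" "\<And>n. integral\<^sup>L M (f n) \<le> C"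
    and g: "g \<in> borel_measurable M" "\<And>x. 0 \<le> g x" and lim: "AE x in M. (\<lambda>n. f n x) \<longlonglongrightarrow> g x"
  shows "integrable M g" "integral\<^sup>L M g \<le> C"
proof -
  have C: "0 \<le> C" by (rule order_trans[OF integral_nonneg_AE f(3)[of 0]]) (simp add: f(2))
  have "(\<integral>\<^sup>+x. ennreal (g x) \<partial>M) = (\<integral>\<^sup>+x. liminf (\<lambda>n. ennreal (f n x)) \<partial>M)"
    using lim by (intro nn_integral_cong_AE) (auto elim!: eventually_mono
        intro!: lim_imp_Liminf[symmetric] tendsto_ennrealI)
  also have "\<dots> \<le> liminf (\<lambda>n. \<integral>\<^sup>+x. ennreal (f n x) \<partial>M)"
    using f(1) by (intro nn_integral_liminf) auto
  also have "\<dots> \<le> liminf (\<lambda>n::nat. ennreal C)"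
    using f by (intro Liminf_mono always_eventually allI) (auto simp: nn_integral_eq_integral intro!: ennreal_leI)
  also have "\<dots> = ennreal C" by (simp add: Liminf_const)
  finally have le: "(\<integral>\<^sup>+x. ennreal (g x) \<partial>M) \<le> ennreal C" .
  then show int: "integrable M g"
    using g by (intro integrableI_bounded) (auto simp: top.not_eq_extremum intro: le_less_trans)
  show "integral\<^sup>L M g \<le> C"
    using le g C by (subst (asm) nn_integral_eq_integral[OF int]) auto
qed

definition ip :: "'a::euclidean_space set \<Rightarrow> ('a \<Rightarrow> real) \<Rightarrow> ('a \<Rightarrow> real) \<Rightarrow> real" where
  "ip \<Omega> u v = (LINT x|lebesgue_on \<Omega>. u x * v x)"

lemma L2_measurable: "u \<in> L2 \<Omega> \<Longrightarrow> u \<in> borel_measurable (lebesgue_on \<Omega>)"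
  by (simp add: L2_def)

lemma L2_integrable_mult:
  assumes "u \<in> L2 \<Omega>" "v \<in> L2 \<Omega>" shows "integrable (lebesgue_on \<Omega>) (\<lambda>x. u x * v x)"
proof (rule Bochner_Integration.integrable_bound)
  show "integrable (lebesgue_on \<Omega>) (\<lambda>x. (u x)\<^sup>2 + (v x)\<^sup>2)"
    using assms by (auto simp: L2_def)
  have [measurable]: "u \<in> borel_measurable (lebesgue_on \<Omega>)" "v \<in> borel_measurable (lebesgue_on \<Omega>)"
    using assms by (auto simp: L2_def)
  show "(\<lambda>x. u x * v x) \<in> borel_measurable (lebesgue_on \<Omega>)" by measurable
  have "\<bar>a * b\<bar> \<le> a\<^sup>2 + b\<^sup>2" for a b :: real
    using sum_squares_bound[of "\<bar>a\<bar>" "\<bar>b\<bar>"] mult_nonneg_nonneg[of "\<bar>a\<bar>" "\<bar>b\<bar>"]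
    unfolding abs_mult power2_abs by linarith
  then show "AE x in lebesgue_on \<Omega>. norm (u x * v x) \<le> norm ((u x)\<^sup>2 + (v x)\<^sup>2)"
    by auto
qed

lemma L2_lin:
  assumes "u \<in> L2 \<Omega>" "v \<in> L2 \<Omega>" shows "(\<lambda>x. u x + c * v x) \<in> L2 \<Omega>"
proof -
  have [measurable]: "u \<in> borel_measurable (lebesgue_on \<Omega>)" "v \<in> borel_measurable (lebesgue_on \<Omega>)"
    using assms by (auto simp: L2_def)
  have "integrable (lebesgue_on \<Omega>) (\<lambda>x. u x * u x + (2 * c) * (u x * v x) + c\<^sup>2 * (v x * v x))"
    by (intro Bochner_Integration.integrable_add integrable_mult_right L2_integrable_mult assms)
  then show ?thesis by (simp add: L2_def power2_eq_square algebra_simps)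
qed

interpretation L2: pre_inner "L2 \<Omega>" "ip \<Omega>" for \<Omega> :: "'a::euclidean_space set"
proof
  show "(\<lambda>x. 0) \<in> L2 \<Omega>" by (simp add: L2_def)
  fix u v w :: "'a \<Rightarrow> real" and c :: real assume u: "u \<in> L2 \<Omega>"
  show "0 \<le> ip \<Omega> u u" by (simp add: ip_def)
  assume v: "v \<in> L2 \<Omega>"
  show "(\<lambda>x. u x + c * v x) \<in> L2 \<Omega>" by (rule L2_lin[OF u v])
  show "ip \<Omega> u v = ip \<Omega> v u" by (simp add: ip_def mult.commute)
  assume w: "w \<in> L2 \<Omega>"
  have "ip \<Omega> (\<lambda>x. u x + c * v x) w = (LINT x|lebesgue_on \<Omega>. u x * w x + c * (v x * w x))"
    by (simp add: ip_def algebra_simps)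
  also have "\<dots> = ip \<Omega> u w + c * ip \<Omega> v w"
    by (simp add: ip_def L2_integrable_mult u v w)
  finally show "ip \<Omega> (\<lambda>x. u x + c * v x) w = ip \<Omega> u w + c * ip \<Omega> v w" .
qed

lemma nrm_L2: "L2.nrm \<Omega> = L2_norm \<Omega>"
  by (auto simp: L2.nrm_def L2_norm_def ip_def power2_eq_square)

lemma ip_cong_AE:
  assumes "AE x in lebesgue_on \<Omega>. u x = u' x" "AE x in lebesgue_on \<Omega>. v x = v' x"
    and "u \<in> borel_measurable (lebesgue_on \<Omega>)" "u' \<in> borel_measurable (lebesgue_on \<Omega>)"
    and "v \<in> borel_measurable (lebesgue_on \<Omega>)" "v' \<in> borel_measurable (lebesgue_on \<Omega>)"
  shows "ip \<Omega> u v = ip \<Omega> u' v'"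
  unfolding ip_def using assms by (intro integral_cong_AE) auto

lemma L2_AE_subseq:
  assumes u: "\<And>n. u n \<in> L2 \<Omega>" and v: "v \<in> L2 \<Omega>" and lim: "(\<lambda>n. L2_norm \<Omega> (\<lambda>x. u n x - v x)) \<longlonglongrightarrow> 0"
  obtains r :: "nat \<Rightarrow> nat" where "strict_mono r" "AE x in lebesgue_on \<Omega>. (\<lambda>n. u (r n) x) \<longlonglongrightarrow> v x"
proof -
  have "(\<lambda>n. (L2_norm \<Omega> (\<lambda>x. u n x - v x))\<^sup>2) \<longlonglongrightarrow> 0\<^sup>2" by (intro tendsto_power lim)
  then have "(\<lambda>n. LINT x|lebesgue_on \<Omega>. norm ((u n x - v x)\<^sup>2)) \<longlonglongrightarrow> 0"
    by (simp add: L2_norm_def)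
  moreover have "integrable (lebesgue_on \<Omega>) (\<lambda>x. (u n x - v x)\<^sup>2)" for n
    using L2.diff[OF u v] by (simp add: L2_def)
  ultimately obtain r :: "nat \<Rightarrow> nat" where r: "strict_mono r" "AE x in lebesgue_on \<Omega>. (\<lambda>n. (u (r n) x - v x)\<^sup>2) \<longlonglongrightarrow> 0"
    using tendsto_L1_AE_subseq[of "lebesgue_on \<Omega>" "\<lambda>n x. (u n x - v x)\<^sup>2"] by blast
  have "AE x in lebesgue_on \<Omega>. (\<lambda>n. u (r n) x) \<longlonglongrightarrow> v x"
    using r(2)
  proof eventually_elim
    case (elim x)
    have "(\<lambda>n. sqrt ((u (r n) x - v x)\<^sup>2)) \<longlonglongrightarrow> sqrt 0" by (intro tendsto_real_sqrt elim)
    then have "(\<lambda>n. \<bar>u (r n) x - v x\<bar>) \<longlonglongrightarrow> 0" by (simp only: real_sqrt_abs real_sqrt_zero)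
    then have "(\<lambda>n. u (r n) x - v x) \<longlonglongrightarrow> 0" by (rule tendsto_rabs_zero_cancel)
    then show ?case by (rule LIM_zero_cancel)
  qed
  with r(1) show thesis using that by blast
qed

text \<open>If \<open>\<parallel>d\<^sub>k\<parallel>\<^sup>2 \<le> 4\<^sup>-\<^sup>k\<close> then \<open>\<Sum>\<^sub>k 2\<^sup>k d\<^sub>k\<^sup>2\<close> has finite integral, so \<open>\<bar>d\<^sub>k\<bar> \<le> C 2\<^sup>-\<^sup>k\<^sup>/\<^sup>2\<close> almost everywhere.\<close>

lemma L2_summable_AE:
  assumes d: "\<And>k. d k \<in> L2 \<Omega>" and le: "\<And>k. L2_norm \<Omega> (d k) \<le> (1/2)^k"
  shows "AE x in lebesgue_on \<Omega>. summable (\<lambda>k. d k x)"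
proof -
  have [measurable]: "d k \<in> borel_measurable (lebesgue_on \<Omega>)" for k using d L2_measurable by blast
  have int: "integrable (lebesgue_on \<Omega>) (\<lambda>x. 2^k * (d k x)\<^sup>2)" for k
    using d[of k] by (simp add: L2_def)
  have "(\<integral>\<^sup>+x. (\<Sum>k. ennreal (2^k * (d k x)\<^sup>2)) \<partial>lebesgue_on \<Omega>) =
      (\<Sum>k. \<integral>\<^sup>+x. ennreal (2^k * (d k x)\<^sup>2) \<partial>lebesgue_on \<Omega>)"
    by (intro nn_integral_suminf) auto
  also have "\<dots> = (\<Sum>k. ennreal (2^k * (L2_norm \<Omega> (d k))\<^sup>2))"
    by (subst nn_integral_eq_integral[OF int]) (auto simp: L2_norm_def)
  also have "\<dots> \<le> (\<Sum>k. ennreal ((1/2)^k))"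
  proof (rule suminf_le)
    fix k
    have "2^k * (L2_norm \<Omega> (d k))\<^sup>2 \<le> 2^k * ((1/2)^k)\<^sup>2"
      by (intro mult_left_mono power_mono le) (auto simp: L2_norm_def)
    also have "\<dots> = (1/2)^k" by (simp add: power2_eq_square power_divide)
    finally show "ennreal (2^k * (L2_norm \<Omega> (d k))\<^sup>2) \<le> ennreal ((1/2)^k)" by (rule ennreal_leI)
  qed auto
  also have "\<dots> < \<infinity>"
    by (subst suminf_ennreal2) (auto simp: top.not_eq_extremum)
  finally have "(\<integral>\<^sup>+x. (\<Sum>k. ennreal (2^k * (d k x)\<^sup>2)) \<partial>lebesgue_on \<Omega>) < \<infinity>" .
  then have "AE x in lebesgue_on \<Omega>. (\<Sum>k. ennreal (2^k * (d k x)\<^sup>2)) \<noteq> \<infinity>"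
    by (intro nn_integral_noteq_infinite) auto
  then show ?thesis
  proof eventually_elim
    case (elim x)
    then have "summable (\<lambda>k. 2^k * (d k x)\<^sup>2)" by (intro summable_suminf_not_top) auto
    then have "(\<lambda>k. 2^k * (d k x)\<^sup>2) \<longlonglongrightarrow> 0" by (rule summable_LIMSEQ_zero)
    then have "\<forall>\<^sub>F k in sequentially. 2^k * (d k x)\<^sup>2 < 1" by (rule order_tendstoD) simp
    then have ev: "\<forall>\<^sub>F k in sequentially. norm (d k x) \<le> (1 / sqrt 2)^k"
    proof eventually_elim
      case (elim k)
      have "\<bar>d k x\<bar>\<^sup>2 \<le> ((1 / sqrt 2)^k)\<^sup>2"
      proof -
        have "((1 / sqrt 2)^k)\<^sup>2 = ((1 / sqrt 2)\<^sup>2)^k"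
          by (simp only: power_mult[symmetric] mult.commute[of k 2])
        also have "\<dots> = 1 / 2^k" by (simp add: power_divide)
        finally have "((1 / sqrt 2)^k)\<^sup>2 = 1 / 2^k" .
        then show ?thesis using elim by (simp add: field_simps)
      qed
      then show ?case by (simp add: power2_le_iff_abs_le)
    qed
    show ?case by (rule summable_comparison_test_ev[OF ev summable_geometric]) auto
  qed
qed

text \<open>Riesz-Fischer: along a subsequence with geometrically small increments the pointwise
  limit exists almost everywhere, and Fatou shows that it is also the limit in norm.\<close>

lemma L2_complete:
  assumes u: "\<And>n. u n \<in> L2 \<Omega>"
    and Cauchy: "\<And>e. 0 < e \<Longrightarrow> \<exists>N. \<forall>m\<ge>N. \<forall>n\<ge>N. L2_norm \<Omega> (\<lambda>x. u m x - u n x) < e"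
  obtains v where "v \<in> L2 \<Omega>" "(\<lambda>n. L2_norm \<Omega> (\<lambda>x. u n x - v x)) \<longlonglongrightarrow> 0"
proof -
  have "\<exists>N. \<forall>k. (\<forall>m\<ge>N k. \<forall>n\<ge>N k. L2_norm \<Omega> (\<lambda>x. u m x - u n x) < (1/2)^k)"
    by (intro choice allI Cauchy) auto
  then obtain N where N: "\<And>k m n. N k \<le> m \<Longrightarrow> N k \<le> n \<Longrightarrow> L2_norm \<Omega> (\<lambda>x. u m x - u n x) < (1/2)^k"
    by blast
  \<comment> \<open>Partial sums of the thresholds are monotone and dominate every earlier
    threshold.\<close>
  define r where "r k = (\<Sum>j\<le>k. N j)" for k
  have r: "N k \<le> r k" "r k \<le> r (Suc k)" for k
    by (auto simp: r_def intro: member_le_sum)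
  have rN: "N k \<le> r j" if "k \<le> j" for j k
    using r(1)[of k] lift_Suc_mono_le[of r, OF r(2) that] by simp
  let ?d = "\<lambda>k x. u (r (Suc k)) x - u (r k) x"
  have "AE x in lebesgue_on \<Omega>. summable (\<lambda>k. ?d k x)"
    by (rule L2_summable_AE) (auto intro!: L2.diff u less_imp_le[OF N] rN)
  then have conv: "AE x in lebesgue_on \<Omega>. convergent (\<lambda>k. u (r k) x)"
  proof eventually_elim
    case (elim x)
    then have "convergent (\<lambda>n. \<Sum>k<n. ?d k x)" by (simp add: summable_iff_convergent)
    then have "convergent (\<lambda>n. u (r n) x - u (r 0) x)" by (simp only: sum_lessThan_telescope[of "\<lambda>k. u (r k) x"])
    then have "convergent (\<lambda>n. (u (r n) x - u (r 0) x) + u (r 0) x)"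
      by (intro convergent_add convergent_const)
    then show ?case by simp
  qed
  define v where "v x = lim (\<lambda>k. u (r k) x)" for x
  have [measurable]: "u k \<in> borel_measurable (lebesgue_on \<Omega>)" for k using u L2_measurable by blast
  have v_meas[measurable]: "v \<in> borel_measurable (lebesgue_on \<Omega>)"
    unfolding v_def[abs_def] by measurable
  have lim: "AE x in lebesgue_on \<Omega>. (\<lambda>k. u (r k) x) \<longlonglongrightarrow> v x"
    using conv by eventually_elim (simp add: v_def convergent_LIMSEQ_iff)
  \<comment> \<open>Fatou in the first index with \<open>n\<close> fixed; the shift
    \<open>j + k\<close> puts every index \<open>r (j + k)\<close> beyond
    \<open>N k\<close>.\<close>
  have close: "(\<lambda>x. v x - u n x) \<in> L2 \<Omega> \<and> L2_norm \<Omega> (\<lambda>x. v x - u n x) \<le> (1/2)^k" if n: "N k \<le> n" for n k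
  proof -
    have i: "integrable (lebesgue_on \<Omega>) (\<lambda>x. (u (r (j + k)) x - u n x)\<^sup>2)" for j
      using L2.diff[OF u u] by (simp add: L2_def)
    have le: "(LINT x|lebesgue_on \<Omega>. (u (r (j + k)) x - u n x)\<^sup>2) \<le> ((1/2)^k)\<^sup>2" for j
    proof -
      have "(L2_norm \<Omega> (\<lambda>x. u (r (j + k)) x - u n x))\<^sup>2 \<le> ((1/2)^k)\<^sup>2"
        by (intro power_mono less_imp_le[OF N] rN n) (auto simp: L2_norm_def)
      then show ?thesis by (simp add: L2_norm_def)
    qed
    have c: "AE x in lebesgue_on \<Omega>. (\<lambda>j. (u (r (j + k)) x - u n x)\<^sup>2) \<longlonglongrightarrow> (v x - u n x)\<^sup>2"
      using lim by eventually_elim (intro tendsto_intros LIMSEQ_ignore_initial_segment)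
    have "integrable (lebesgue_on \<Omega>) (\<lambda>x. (v x - u n x)\<^sup>2)"
      "(LINT x|lebesgue_on \<Omega>. (v x - u n x)\<^sup>2) \<le> ((1/2)^k)\<^sup>2"
      by (rule integrable_Fatou[OF i _ le _ _ c]; simp)+
    then show ?thesis
      using real_sqrt_le_mono[of _ "((1/2)^k)\<^sup>2"] by (force simp: L2_def L2_norm_def)
  qed
  have v: "v \<in> L2 \<Omega>"
    using L2.add[OF conjunct1[OF close[of 0 "N 0"]] u[of "N 0"]] by simp
  moreover have "(\<lambda>n. L2_norm \<Omega> (\<lambda>x. u n x - v x)) \<longlonglongrightarrow> 0"
  proof (rule LIMSEQ_I)
    fix e :: real assume "0 < e"
    then obtain k where k: "(1/2)^k < e" using real_arch_pow_inv[of e "1/2"] by auto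
    have "L2_norm \<Omega> (\<lambda>x. u n x - v x) < e" if "N k \<le> n" for n
      using close[OF that] k L2.nrm_minus_commute[OF u[of n] v] by (simp add: nrm_L2)
    then show "\<exists>no. \<forall>n\<ge>no. norm (L2_norm \<Omega> (\<lambda>x. u n x - v x) - 0) < e"
      by (auto simp: L2_norm_def)
  qed
  ultimately show thesis using that by blast
qed

section \<open>Weak derivatives\<close>

lemma integrable_test_function:
  assumes "\<psi> \<in> test_functions \<Omega>" shows "integrable lborel \<psi>" "\<psi> \<in> borel_measurable borel"
proof -
  obtain K where K: "compact K" "K \<subseteq> \<Omega>" "\<And>x. x \<notin> K \<Longrightarrow> \<psi> x = 0" "continuous_on UNIV \<psi>"
    using test_functions_compact_support[OF assms] by metis
  have "integrable lborel (\<lambda>x. indicator K x *\<^sub>R \<psi> x)"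
    by (intro borel_integrable_compact K(1) continuous_on_subset[OF K(4)]) simp
  also have "(\<lambda>x. indicator K x *\<^sub>R \<psi> x) = \<psi>" by (intro ext) (auto simp: indicator_def K(3))
  finally show "integrable lborel \<psi>" .
  show "\<psi> \<in> borel_measurable borel" using K(4) by (rule borel_measurable_continuous_onI)
qed

lemma test_functions_mult:
  assumes "\<psi> \<in> test_functions \<Omega>" "\<eta> \<in> test_functions \<Omega>"
  shows "(\<lambda>x. \<psi> x * \<eta> x) \<in> test_functions \<Omega>"
proof -
  obtain K where K: "compact K" "K \<subseteq> \<Omega>" "\<And>x. x \<notin> K \<Longrightarrow> \<psi> x = 0" "continuous_on UNIV \<psi>"
    using test_functions_compact_support[OF assms(1)] by metis
  have "smooth_on UNIV (\<lambda>x. \<psi> x * \<eta> x)"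
    using assms by (auto simp: test_functions_def smooth_on_def intro: Ck_on_mult)
  moreover have "\<forall>x. x \<notin> K \<longrightarrow> \<psi> x * \<eta> x = 0" using K by simp
  ultimately show ?thesis unfolding test_functions_def using K by blast
qed

lemma test_functions_smooth: "\<psi> \<in> test_functions \<Omega> \<Longrightarrow> smooth_on UNIV \<psi>"
  by (simp add: test_functions_def)

lemma bounded_test_function:
  assumes "\<psi> \<in> test_functions \<Omega>" obtains B where "0 \<le> B" "\<And>x. \<bar>\<psi> x\<bar> \<le> B"
proof -
  obtain K where K: "compact K" "K \<subseteq> \<Omega>" "\<And>x. x \<notin> K \<Longrightarrow> \<psi> x = 0" "continuous_on UNIV \<psi>"
    using test_functions_compact_support[OF assms] by metis
  have "bounded (\<psi> ` K)"
    using K by (meson compact_continuous_image compact_imp_bounded continuous_on_subset subset_UNIV)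
  then obtain B where "\<And>x. x \<in> K \<Longrightarrow> \<bar>\<psi> x\<bar> \<le> B" by (auto simp: bounded_iff)
  then have "\<bar>\<psi> x\<bar> \<le> max B 0" for x using K(3) by (cases "x \<in> K") (auto simp: le_max_iff_disj)
  then show thesis using that[of "max B 0"] by simp
qed

lemma test_function_line_derivative:
  assumes \<psi>: "\<psi> \<in> test_functions \<Omega>"
  shows "((\<lambda>s. \<psi> (x + s *\<^sub>R y)) has_real_derivative frechet_derivative \<psi> (at (x + s *\<^sub>R y)) y) (at s)"
proof -
  have lin: "linear (frechet_derivative \<psi> (at z))" for z
    using smooth_on_differentiable[OF test_functions_smooth[OF \<psi>]] has_derivative_linear by blast
  have "((\<lambda>s. x + s *\<^sub>R y) has_derivative (\<lambda>h. h *\<^sub>R y)) (at s)"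
    by (auto intro!: derivative_eq_intros)
  from has_derivative_compose[OF this smooth_on_differentiable[OF test_functions_smooth[OF \<psi>]]]
  show ?thesis by (simp add: has_field_derivative_def linear_scale[OF lin] mult.commute[of _ "frechet_derivative \<psi> _ y"])
qed

text \<open>Supplies the dominating function for all limits of difference quotients. The mean value
  theorem gives the height; restricting to \<open>s \<le> 1\<close> keeps all quotients inside one
  ball, whose radius is that of the support plus \<open>norm y\<close>.\<close>

lemma difference_quotient_test_function:
  assumes \<psi>: "\<psi> \<in> test_functions \<Omega>"
  obtains B R where "0 \<le> B" "\<And>s x. 0 < s \<Longrightarrow> s \<le> 1 \<Longrightarrow>
    \<bar>(\<psi> (x + s *\<^sub>R y) - \<psi> x) / s\<bar> \<le> B * indicator (cball 0 R) x"
    "\<And>x. (\<lambda>n. (\<psi> (x + inverse (real (Suc n)) *\<^sub>R y) - \<psi> x) / inverse (real (Suc n)))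
      \<longlonglongrightarrow> frechet_derivative \<psi> (at x) y"
proof -
  let ?D = "\<lambda>x. frechet_derivative \<psi> (at x) y"
  obtain B where B: "0 \<le> B" "\<And>x. \<bar>?D x\<bar> \<le> B"
    using bounded_test_function[OF test_functions_frechet_derivative[OF \<psi>]] by metis
  obtain K where K: "compact K" "K \<subseteq> \<Omega>" "\<And>x. x \<notin> K \<Longrightarrow> \<psi> x = 0" "continuous_on UNIV \<psi>"
    using test_functions_compact_support[OF \<psi>] by metis
  obtain R0 where R0: "\<And>x. x \<in> K \<Longrightarrow> norm x \<le> R0"
    using compact_imp_bounded[OF K(1)] by (auto simp: bounded_iff)
  define R where "R = R0 + norm y"
  note deriv = test_function_line_derivative[OF \<psi>, where y = y]
  have "\<bar>(\<psi> (x + s *\<^sub>R y) - \<psi> x) / s\<bar> \<le> B * indicator (cball 0 R) x" if s: "0 < s" "s \<le> 1" for s x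
  proof (cases "norm x \<le> R")
    case True
    have "\<exists>z>0. z < s \<and> \<psi> (x + s *\<^sub>R y) - \<psi> (x + 0 *\<^sub>R y) = (s - 0) * ?D (x + z *\<^sub>R y)"
      by (rule MVT2) (use s deriv in auto)
    then obtain z where "\<psi> (x + s *\<^sub>R y) - \<psi> x = s * ?D (x + z *\<^sub>R y)" by auto
    then show ?thesis using s B True by simp
  next
    case False
    have "s * norm y \<le> norm y" using s by (simp add: mult_left_le_one_le)
    moreover have "norm x \<le> norm (x + s *\<^sub>R y) + s * norm y"
      using norm_triangle_ineq4[of "x + s *\<^sub>R y" "s *\<^sub>R y"] s by simp
    ultimately have "\<not> norm x \<le> R0" "\<not> norm (x + s *\<^sub>R y) \<le> R0"
      using False norm_ge_zero[of y] unfolding R_def by linarith+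
    then have "\<psi> x = 0" "\<psi> (x + s *\<^sub>R y) = 0" using K(3) R0 by blast+
    then show ?thesis using B by simp
  qed
  moreover have "(\<lambda>n. (\<psi> (x + inverse (real (Suc n)) *\<^sub>R y) - \<psi> x) / inverse (real (Suc n))) \<longlonglongrightarrow> ?D x" for x
  proof -
    have "((\<lambda>s. (\<psi> (x + s *\<^sub>R y) - \<psi> x) / s) \<longlongrightarrow> ?D x) (at 0)"
      using deriv[of x 0] by (simp add: has_field_derivative_iff)
    moreover have "filterlim (\<lambda>n. inverse (real (Suc n))) (at 0) sequentially"
      using LIMSEQ_inverse_real_of_nat by (auto simp: filterlim_at)
    ultimately show ?thesis by (rule filterlim_compose)
  qed
  ultimately show thesis using that B(1) by blast
qed

lemma lborel_integral_translate:
  fixes f :: "'a::euclidean_space \<Rightarrow> real"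
  assumes "f \<in> borel_measurable borel"
  shows "(LINT x|lborel. f (x + c)) = (LINT x|lborel. f x)"
proof -
  have "(LINT x|lborel. f x) = (LINT x|distr lborel borel ((+) c). f x)" by (simp add: lborel_distr_plus)
  also have "\<dots> = (LINT x|lborel. f (c + x))" by (rule integral_distr) (use assms in auto)
  finally show ?thesis by (simp add: add.commute)
qed

lemma lborel_integrable_translate:
  fixes f :: "'a::euclidean_space \<Rightarrow> real"
  assumes "integrable lborel f"
  shows "integrable lborel (\<lambda>x. f (x + c))"
proof -
  have "integrable (distr lborel borel ((+) c)) f" using assms by (simp add: lborel_distr_plus)
  then have "integrable lborel (\<lambda>x. f (c + x))" using assms by (subst (asm) integrable_distr_eq) auto
  then show ?thesis by (simp add: add.commute)
qed

text \<open>Translation invariance makes the integrals of the difference quotients vanish.\<close>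

lemma integral_frechet_derivative_0:
  fixes \<psi> :: "'a::euclidean_space \<Rightarrow> real"
  assumes \<psi>: "\<psi> \<in> test_functions \<Omega>"
  shows "(LINT x|lborel. frechet_derivative \<psi> (at x) y) = 0"
proof -
  obtain B R where BR: "0 \<le> B" "\<And>s x. 0 < s \<Longrightarrow> s \<le> 1 \<Longrightarrow>
    \<bar>(\<psi> (x + s *\<^sub>R y) - \<psi> x) / s\<bar> \<le> B * indicator (cball 0 R) x"
    "\<And>x. (\<lambda>n. (\<psi> (x + inverse (real (Suc n)) *\<^sub>R y) - \<psi> x) / inverse (real (Suc n)))
      \<longlonglongrightarrow> frechet_derivative \<psi> (at x) y"
    using difference_quotient_test_function[OF \<psi>] by metis
  have [measurable]: "\<psi> \<in> borel_measurable borel" by (rule integrable_test_function[OF \<psi>])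
  have [measurable]: "(\<lambda>x. frechet_derivative \<psi> (at x) y) \<in> borel_measurable borel"
    by (rule integrable_test_function[OF test_functions_frechet_derivative[OF \<psi>]])
  have "(\<lambda>n. LINT x|lborel. (\<psi> (x + inverse (real (Suc n)) *\<^sub>R y) - \<psi> x) / inverse (real (Suc n)))
      \<longlonglongrightarrow> (LINT x|lborel. frechet_derivative \<psi> (at x) y)"
  proof (rule integral_dominated_convergence)
    show "integrable lborel (\<lambda>x. B * indicator (cball 0 R) x :: real)"
      by (intro integrable_mult_right integrable_real_indicator[OF _ emeasure_lborel_cball_finite]) simp
    show "AE x in lborel. norm ((\<psi> (x + inverse (real (Suc n)) *\<^sub>R y) - \<psi> x) / inverse (real (Suc n)))
        \<le> B * indicator (cball 0 R) x" for n
      using BR(2)[of "inverse (real (Suc n))"] by (simp add: inverse_eq_divide)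
  qed (use BR(3) in auto)
  moreover have "(LINT x|lborel. (\<psi> (x + inverse (real (Suc n)) *\<^sub>R y) - \<psi> x) / inverse (real (Suc n))) = 0" for n
  proof -
    have "integrable lborel \<psi>" by (rule integrable_test_function[OF \<psi>])
    then show ?thesis
      by (simp add: lborel_integral_translate lborel_integrable_translate)
  qed
  ultimately show ?thesis by (simp only: LIMSEQ_const_iff)
qed

lemma ex_tail_less_mono:
  fixes e :: real
  assumes "\<exists>N. \<forall>m\<ge>N. \<forall>n\<ge>N. f m n < e" "\<And>m n. g m n \<le> f m n"
  shows "\<exists>N::nat. \<forall>m\<ge>N. \<forall>n\<ge>N. g m n < e"
  using assms le_less_trans by blast

section \<open>Weak derivatives on an open set\<close>

locale open_domain =
  fixes \<Omega> :: "'a::euclidean_space set"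
  assumes open_dom: "open \<Omega>"
begin

lemma dom_sets: "\<Omega> \<in> sets borel" "\<Omega> \<inter> space lebesgue \<in> sets lebesgue"
  using open_dom by auto

lemma measurable_on_domI: "f \<in> borel_measurable borel \<Longrightarrow> f \<in> borel_measurable (lebesgue_on \<Omega>)"
  by (intro measurable_restrict_space1 measurable_completion) auto

text \<open>The spaces are defined over \<open>lebesgue_on \<Omega>\<close>, whereas translation
  invariance and Fubini are applied over \<open>lborel\<close>. For Borel functions vanishing
  outside the domain, test functions in particular, the two integrals can be exchanged.\<close>

lemma integral_dom_eq_lborel:
  fixes f :: "'a \<Rightarrow> real"
  assumes "f \<in> borel_measurable borel" "\<And>x. x \<notin> \<Omega> \<Longrightarrow> f x = 0"
  shows "(LINT x|lebesgue_on \<Omega>. f x) = (LINT x|lborel. f x)"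
    and "integrable (lebesgue_on \<Omega>) f \<longleftrightarrow> integrable lborel f"
proof -
  have eq: "(\<lambda>x. indicator \<Omega> x *\<^sub>R f x) = f" by (intro ext) (auto simp: indicator_def assms(2))
  show "(LINT x|lebesgue_on \<Omega>. f x) = (LINT x|lborel. f x)"
    using assms(1) unfolding integral_restrict_space[OF dom_sets(2)] eq by (intro integral_completion) simp
  show "integrable (lebesgue_on \<Omega>) f \<longleftrightarrow> integrable lborel f"
    using assms(1) unfolding integrable_restrict_space[OF dom_sets(2)] eq by (intro integrable_completion) simp
qed

lemma test_function_outside: "\<psi> \<in> test_functions \<Omega> \<Longrightarrow> x \<notin> \<Omega> \<Longrightarrow> \<psi> x = 0"
  unfolding test_functions_def by blast

lemma test_functions_L2: assumes "\<psi> \<in> test_functions \<Omega>" shows "\<psi> \<in> L2 \<Omega>"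
proof -
  have t: "(\<lambda>x. \<psi> x * \<psi> x) \<in> test_functions \<Omega>" by (intro test_functions_mult assms)
  have "integrable (lebesgue_on \<Omega>) (\<lambda>x. \<psi> x * \<psi> x)"
    using integrable_test_function[OF t] test_function_outside[OF t]
    by (subst integral_dom_eq_lborel(2)) auto
  then show ?thesis
    using measurable_on_domI[OF integrable_test_function(2)[OF assms]]
    by (simp add: L2_def power2_eq_square)
qed

lemma ip_test_eq_lborel:
  assumes "\<psi> \<in> test_functions \<Omega>" "\<eta> \<in> test_functions \<Omega>"
  shows "ip \<Omega> \<psi> \<eta> = (LINT x|lborel. \<psi> x * \<eta> x)"
  unfolding ip_def
  using integrable_test_function(2)[OF test_functions_mult[OF assms]]
    test_function_outside[OF test_functions_mult[OF assms]]
  by (intro integral_dom_eq_lborel) auto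

abbreviation fd :: "'a \<Rightarrow> ('a \<Rightarrow> real) \<Rightarrow> 'a \<Rightarrow> real" where
  "fd b \<psi> \<equiv> (\<lambda>x. frechet_derivative \<psi> (at x) b)"

text \<open>Integration by parts: the derivative of the product, again a compactly supported
  function, has integral zero.\<close>

lemma ip_fd_test:
  assumes \<psi>: "\<psi> \<in> test_functions \<Omega>" and \<eta>: "\<eta> \<in> test_functions \<Omega>"
  shows "ip \<Omega> \<psi> (fd b \<eta>) = - ip \<Omega> (fd b \<psi>) \<eta>"
proof -
  have fd: "fd b (\<lambda>x. \<psi> x * \<eta> x) = (\<lambda>x. \<psi> x * fd b \<eta> x + fd b \<psi> x * \<eta> x)"
  proof
    fix x
    have "((\<lambda>x. \<psi> x * \<eta> x) has_derivative
        (\<lambda>v. \<psi> x * frechet_derivative \<eta> (at x) v + frechet_derivative \<psi> (at x) v * \<eta> x)) (at x)"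
      by (intro has_derivative_mult smooth_on_differentiable test_functions_smooth[OF \<psi>] test_functions_smooth[OF \<eta>])
    from frechet_derivative_at[OF this]
    show "fd b (\<lambda>x. \<psi> x * \<eta> x) x = \<psi> x * fd b \<eta> x + fd b \<psi> x * \<eta> x" by metis
  qed
  note t = test_functions_frechet_derivative
  have "(LINT x|lborel. \<psi> x * fd b \<eta> x + fd b \<psi> x * \<eta> x) = 0"
    using integral_frechet_derivative_0[OF test_functions_mult[OF \<psi> \<eta>], of b] by (simp only: fd)
  moreover have "integrable lborel (\<lambda>x. \<psi> x * fd b \<eta> x)" "integrable lborel (\<lambda>x. fd b \<psi> x * \<eta> x)"
    using integrable_test_function(1)[OF test_functions_mult[OF \<psi> t[OF \<eta>]]]
      integrable_test_function(1)[OF test_functions_mult[OF t[OF \<psi>] \<eta>]] by auto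
  ultimately show ?thesis
    by (simp add: ip_test_eq_lborel \<psi> \<eta> t)
qed

lemma has_weak_deriv_iff:
  "has_weak_deriv \<Omega> b u g \<longleftrightarrow> (\<forall>\<psi>\<in>test_functions \<Omega>. ip \<Omega> u (fd b \<psi>) = - ip \<Omega> g \<psi>)"
  by (simp add: has_weak_deriv_def ip_def)

lemma box_closure_in_domain:
  assumes "cbox a b \<subseteq> \<Omega>" "box p q \<subseteq> box a b" "box p q \<noteq> {}"
  shows "cbox p q \<subseteq> \<Omega>"
proof -
  have "closure (box p q) \<subseteq> cbox a b"
    using assms(2) box_subset_cbox by (intro closure_minimal) auto
  then show ?thesis using assms closure_box[OF assms(3)] by simp
qed

text \<open>Bumps converging to the indicator of a box turn the hypothesis into vanishing box
  integrals inside the domain. This determines \<open>g\<close> on each closed box contained in the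
  domain, and countably many of these cover it.\<close>

lemma fundamental_lemma:
  assumes g: "g \<in> L2 \<Omega>" and 0: "\<And>\<psi>. \<psi> \<in> test_functions \<Omega> \<Longrightarrow> ip \<Omega> g \<psi> = 0"
  shows "AE x in lebesgue_on \<Omega>. g x = 0"
proof -
  have [measurable]: "g \<in> borel_measurable (lebesgue_on \<Omega>)" using g by (rule L2_measurable)
  have ind: "indicator (box p q) \<in> L2 \<Omega>" for p q :: 'a
  proof -
    have "integrable lborel (\<lambda>x. indicat_real \<Omega> x * indicator (box p q) x)"
    proof (rule Bochner_Integration.integrable_bound)
      show "integrable lborel (indicat_real (box p q))"
        by (rule integrable_real_indicator[OF _ emeasure_lborel_box_finite]) simp
    qed (use dom_sets in \<open>auto simp: indicator_def\<close>)
    then have "integrable lebesgue (\<lambda>x. indicat_real \<Omega> x *\<^sub>R indicat_real (box p q) x)"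
      using dom_sets by (subst integrable_completion) auto
    then have "integrable (lebesgue_on \<Omega>) (indicat_real (box p q))"
      by (subst integrable_restrict_space[OF dom_sets(2)])
    moreover have "(indicat_real (box p q) x)\<^sup>2 = indicator (box p q) x" for x :: 'a
      by (simp add: indicator_def)
    ultimately show ?thesis unfolding L2_def by (auto intro: measurable_on_domI)
  qed
  have box0: "ip \<Omega> g (indicator (box p q)) = 0" if "cbox p q \<subseteq> \<Omega>" for p q
  proof -
    have "(\<lambda>n. ip \<Omega> g (box_bump p q n)) \<longlonglongrightarrow> ip \<Omega> g (indicator (box p q))"
      unfolding ip_def
    proof (rule integral_dominated_convergence)
      show "integrable (lebesgue_on \<Omega>) (\<lambda>x. \<bar>g x * indicator (box p q) x\<bar>)"
        by (intro integrable_abs L2_integrable_mult g ind)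
      show "AE x in lebesgue_on \<Omega>. (\<lambda>n. g x * box_bump p q n x) \<longlonglongrightarrow> g x * indicator (box p q) x"
        by (intro AE_I2 tendsto_intros box_bump_limit)
      show "AE x in lebesgue_on \<Omega>. norm (g x * box_bump p q n x) \<le> \<bar>g x * indicator (box p q) x\<bar>" for n
        using box_bump_bounds[of p q n] box_bump_eq_0[of _ p q n]
        by (intro AE_I2) (auto simp: abs_mult indicator_def intro: mult_left_le)
      show "(\<lambda>x. g x * box_bump p q n x) \<in> borel_measurable (lebesgue_on \<Omega>)" for n
        using measurable_on_domI[OF integrable_test_function(2)[OF box_bump_test[OF that]]] by measurable
      show "(\<lambda>x. g x * indicator (box p q) x) \<in> borel_measurable (lebesgue_on \<Omega>)"
        using L2_measurable[OF ind] by measurable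
    qed
    then have "(\<lambda>n. 0::real) \<longlonglongrightarrow> ip \<Omega> g (indicator (box p q))"
      using 0[OF box_bump_test[OF that]] by simp
    then show ?thesis by (simp add: LIMSEQ_const_iff)
  qed
  have inbox: "AE x in lebesgue. x \<in> cbox a b \<longrightarrow> g x = 0" if ab: "cbox a b \<subseteq> \<Omega>" for a b
  proof -
    let ?f = "\<lambda>x. indicator \<Omega> x *\<^sub>R (g x * indicator (box a b) x)"
    have int: "integrable lebesgue ?f"
      using L2_integrable_mult[OF g ind[of a b]] unfolding integrable_restrict_space[OF dom_sets(2)] .
    \<comment> \<open>The cut-off function is only Lebesgue measurable; the uniqueness result about
      box integrals is stated for \<open>lborel\<close> and needs a Borel representative.\<close>
    obtain f' where f': "f' \<in> borel_measurable lborel" "AE x in lborel. ?f x = f' x"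
      using completion_ex_borel_measurable_real[OF borel_measurable_integrable[OF int]] by blast
    have AE': "AE x in lebesgue. ?f x = f' x" using f'(2) by (rule AE_completion)
    have [measurable]: "f' \<in> borel_measurable borel" using f'(1) by simp
    have f'm: "f' \<in> borel_measurable lebesgue" using f'(1) by (rule measurable_completion)
    have "integrable lebesgue f'"
      using integrable_cong_AE[OF borel_measurable_integrable[OF int] f'm AE'] int by simp
    then have "integrable lborel f'" using f'(1) by (simp add: integrable_completion)
    moreover have "(LINT x|lborel. f' x * indicator (box c d) x) = 0" for c d
    proof -
      obtain p q where pq: "box a b \<inter> box c d = box p q" by (rule that[OF box_Int_box])
      have "(LINT x|lborel. f' x * indicator (box c d) x) = (LINT x|lebesgue. f' x * indicator (box c d) x)"
        by (rule integral_completion[symmetric]) measurable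
      also have "\<dots> = (LINT x|lebesgue. ?f x * indicator (box c d) x)"
      proof (rule integral_cong_AE)
        have [measurable]: "(indicator (box c d) :: 'a \<Rightarrow> real) \<in> borel_measurable lebesgue"
          by (rule measurable_completion) simp
        show "(\<lambda>x. f' x * indicator (box c d) x) \<in> borel_measurable lebesgue"
          "(\<lambda>x. ?f x * indicator (box c d) x) \<in> borel_measurable lebesgue"
          using f'm int by (auto intro!: borel_measurable_times)
        show "AE x in lebesgue. f' x * indicator (box c d) x = ?f x * indicator (box c d) x"
          using AE' by eventually_elim simp
      qed
      also have "\<dots> = (LINT x|lebesgue. indicator \<Omega> x *\<^sub>R (g x * indicator (box p q) x))"
        using pq by (intro Bochner_Integration.integral_cong) (auto simp: indicator_def)
      also have "\<dots> = ip \<Omega> g (indicator (box p q))"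
        unfolding ip_def by (rule integral_restrict_space[OF dom_sets(2), symmetric])
      also have "\<dots> = 0"
      proof (cases "box p q = {}")
        case True then show ?thesis by (simp add: ip_def)
      next
        case False
        then show ?thesis using box0 box_closure_in_domain[OF ab, of p q] pq by blast
      qed
      finally show ?thesis .
    qed
    ultimately have "AE x in lborel. f' x = 0" by (rule AE_0_of_box_integrals)
    then have "AE x in lebesgue. f' x = 0" by (rule AE_completion)
    \<comment> \<open>The cut-off sees the open box only; the boundary of the box is a null
      set.\<close>
    moreover have "AE x in lebesgue. x \<notin> cbox a b - box a b"
      using negligible_frontier_interval by (intro AE_not_in) (auto simp: negligible_iff_null_sets)
    ultimately show ?thesis
      using AE' by eventually_elim (use ab box_subset_cbox[of a b] in \<open>auto simp: indicator_def split: if_splits\<close>)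
  qed
  obtain D where D: "countable D" "D \<subseteq> Pow \<Omega>" "\<And>X. X \<in> D \<Longrightarrow> \<exists>a b. X = cbox a b" "\<Union>D = \<Omega>"
    using open_countable_Union_open_cbox[OF open_dom] by metis
  have "AE x in lebesgue. \<forall>X\<in>D. x \<in> X \<longrightarrow> g x = 0"
  proof (subst AE_ball_countable[OF D(1)], intro ballI)
    fix X assume "X \<in> D"
    with D obtain a b where "X = cbox a b" "cbox a b \<subseteq> \<Omega>" by blast
    then show "AE x in lebesgue. x \<in> X \<longrightarrow> g x = 0" using inbox by simp
  qed
  then show ?thesis
    unfolding AE_restrict_space_iff[OF dom_sets(2)] by eventually_elim (use D(4) in blast)
qed

lemma has_weak_deriv_unique:
  assumes "g \<in> L2 \<Omega>" "h \<in> L2 \<Omega>" "has_weak_deriv \<Omega> b u g" "has_weak_deriv \<Omega> b u h"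
  shows "AE x in lebesgue_on \<Omega>. g x = h x"
proof -
  have "AE x in lebesgue_on \<Omega>. g x - h x = 0"
  proof (rule fundamental_lemma)
    show "(\<lambda>x. g x - h x) \<in> L2 \<Omega>" by (intro L2.diff assms)
    show "ip \<Omega> (\<lambda>x. g x - h x) \<psi> = 0" if "\<psi> \<in> test_functions \<Omega>" for \<psi>
      using assms that test_functions_L2[OF that] by (simp add: L2.diff_left has_weak_deriv_iff)
  qed
  then show ?thesis by eventually_elim simp
qed

lemma has_weak_deriv_lin:
  assumes "u \<in> L2 \<Omega>" "v \<in> L2 \<Omega>" "g \<in> L2 \<Omega>" "h \<in> L2 \<Omega>" "has_weak_deriv \<Omega> b u g" "has_weak_deriv \<Omega> b v h"
  shows "has_weak_deriv \<Omega> b (\<lambda>x. u x + c * v x) (\<lambda>x. g x + c * h x)"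
  unfolding has_weak_deriv_iff
proof
  fix \<psi> assume \<psi>: "\<psi> \<in> test_functions \<Omega>"
  note L = test_functions_L2[OF \<psi>] test_functions_L2[OF test_functions_frechet_derivative[OF \<psi>]]
  show "ip \<Omega> (\<lambda>x. u x + c * v x) (fd b \<psi>) = - ip \<Omega> (\<lambda>x. g x + c * h x) \<psi>"
    using assms \<psi> L by (simp add: L2.lin_left has_weak_deriv_iff)
qed

text \<open>Pairing with a fixed test function is continuous in \<open>L2\<close>, so the defining
  identity survives the limit. This closedness is what makes \<open>H1\<close> complete.\<close>

lemma has_weak_deriv_limit:
  assumes u: "\<And>n. u n \<in> L2 \<Omega>" "v \<in> L2 \<Omega>" "(\<lambda>n. L2_norm \<Omega> (\<lambda>x. u n x - v x)) \<longlonglongrightarrow> 0"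
    and g: "\<And>n. g n \<in> L2 \<Omega>" "h \<in> L2 \<Omega>" "(\<lambda>n. L2_norm \<Omega> (\<lambda>x. g n x - h x)) \<longlonglongrightarrow> 0"
    and d: "\<And>n. has_weak_deriv \<Omega> b (u n) (g n)"
  shows "has_weak_deriv \<Omega> b v h"
  unfolding has_weak_deriv_iff
proof
  fix \<psi> assume \<psi>: "\<psi> \<in> test_functions \<Omega>"
  note L = test_functions_L2[OF \<psi>] test_functions_L2[OF test_functions_frechet_derivative[OF \<psi>]]
  have z: "L2_norm \<Omega> (\<lambda>x. 0) = 0" by (simp add: L2_norm_def)
  have "(\<lambda>n. ip \<Omega> (u n) (fd b \<psi>)) \<longlonglongrightarrow> ip \<Omega> v (fd b \<psi>)"
    by (rule L2.tendsto_form) (use u L in \<open>auto simp: nrm_L2 z\<close>)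
  moreover have "(\<lambda>n. ip \<Omega> (g n) \<psi>) \<longlonglongrightarrow> ip \<Omega> h \<psi>"
    by (rule L2.tendsto_form) (use g L in \<open>auto simp: nrm_L2 z\<close>)
  then have "(\<lambda>n. - ip \<Omega> (g n) \<psi>) \<longlonglongrightarrow> - ip \<Omega> h \<psi>" by (rule tendsto_minus)
  ultimately show "ip \<Omega> v (fd b \<psi>) = - ip \<Omega> h \<psi>"
    using d \<psi> by (simp add: has_weak_deriv_iff) (metis LIMSEQ_unique)
qed

lemma H1_L2: "u \<in> H1 \<Omega> \<Longrightarrow> u \<in> L2 \<Omega>" by (simp add: H1_def)

lemma weak_deriv:
  assumes "u \<in> H1 \<Omega>" "b \<in> Basis"
  shows weak_deriv_L2: "weak_deriv \<Omega> b u \<in> L2 \<Omega>"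
    and has_weak_deriv_weak_deriv: "has_weak_deriv \<Omega> b u (weak_deriv \<Omega> b u)"
proof -
  have "\<exists>g. g \<in> L2 \<Omega> \<and> has_weak_deriv \<Omega> b u g" using assms by (auto simp: H1_def)
  then have "weak_deriv \<Omega> b u \<in> L2 \<Omega> \<and> has_weak_deriv \<Omega> b u (weak_deriv \<Omega> b u)"
    unfolding weak_deriv_def by (rule someI_ex)
  then show "weak_deriv \<Omega> b u \<in> L2 \<Omega>" "has_weak_deriv \<Omega> b u (weak_deriv \<Omega> b u)" by auto
qed

text \<open>\<open>weak_deriv\<close> is a choice among representatives. Any explicitly known weak
  derivative may replace it up to a null set, and the calculation rules for
  \<open>weak_deriv\<close> are all obtained this way.\<close>

lemma weak_deriv_AE_eq:
  assumes "g \<in> L2 \<Omega>" "has_weak_deriv \<Omega> b u g"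
  shows "AE x in lebesgue_on \<Omega>. weak_deriv \<Omega> b u x = g x"
proof -
  have "\<exists>g. g \<in> L2 \<Omega> \<and> has_weak_deriv \<Omega> b u g" using assms by auto
  then have "weak_deriv \<Omega> b u \<in> L2 \<Omega> \<and> has_weak_deriv \<Omega> b u (weak_deriv \<Omega> b u)"
    unfolding weak_deriv_def by (rule someI_ex)
  then show ?thesis using assms by (intro has_weak_deriv_unique[of _ _ b u]) auto
qed

lemma H1_lin:
  assumes "u \<in> H1 \<Omega>" "v \<in> H1 \<Omega>" shows "(\<lambda>x. u x + c * v x) \<in> H1 \<Omega>"
proof -
  have "(\<lambda>x. weak_deriv \<Omega> b u x + c * weak_deriv \<Omega> b v x) \<in> L2 \<Omega>"
    "has_weak_deriv \<Omega> b (\<lambda>x. u x + c * v x) (\<lambda>x. weak_deriv \<Omega> b u x + c * weak_deriv \<Omega> b v x)"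
    if "b \<in> Basis" for b
    using assms that assms[THEN H1_L2] by (auto intro!: L2_lin has_weak_deriv_lin weak_deriv)
  then show ?thesis unfolding H1_def using assms L2_lin H1_L2 by blast
qed

lemma weak_deriv_lin:
  assumes "u \<in> H1 \<Omega>" "v \<in> H1 \<Omega>" "b \<in> Basis"
  shows "AE x in lebesgue_on \<Omega>. weak_deriv \<Omega> b (\<lambda>x. u x + c * v x) x = weak_deriv \<Omega> b u x + c * weak_deriv \<Omega> b v x"
  using assms assms(1,2)[THEN H1_L2]
  by (intro weak_deriv_AE_eq L2_lin has_weak_deriv_lin) (auto intro: weak_deriv)

lemma test_functions_weak_deriv:
  assumes "\<psi> \<in> test_functions \<Omega>" shows "has_weak_deriv \<Omega> b \<psi> (fd b \<psi>)"
  using assms by (simp add: has_weak_deriv_iff ip_fd_test)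

lemma test_functions_H1: assumes "\<psi> \<in> test_functions \<Omega>" shows "\<psi> \<in> H1 \<Omega>"
  unfolding H1_def
  using test_functions_L2[OF assms] test_functions_weak_deriv[OF assms]
    test_functions_L2[OF test_functions_frechet_derivative[OF assms]] by blast

lemma weak_deriv_test:
  "\<psi> \<in> test_functions \<Omega> \<Longrightarrow> AE x in lebesgue_on \<Omega>. weak_deriv \<Omega> b \<psi> x = fd b \<psi> x"
  by (intro weak_deriv_AE_eq test_functions_weak_deriv test_functions_L2 test_functions_frechet_derivative)

section \<open>Sobolev spaces\<close>

text \<open>The Dirichlet form; together with \<open>ip\<close> it makes up the \<open>H1\<close>
  product. The two are kept apart because the cell Poincare inequality and the dissipation estimate
  weight them differently.\<close>

definition dir :: "('a \<Rightarrow> real) \<Rightarrow> ('a \<Rightarrow> real) \<Rightarrow> real" where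
  "dir u v = (\<Sum>b\<in>Basis. ip \<Omega> (weak_deriv \<Omega> b u) (weak_deriv \<Omega> b v))"

definition h1 :: "('a \<Rightarrow> real) \<Rightarrow> ('a \<Rightarrow> real) \<Rightarrow> real" where
  "h1 u v = ip \<Omega> u v + dir u v"

sublocale dir: pre_inner "H1 \<Omega>" dir
proof
  show "(\<lambda>x. 0) \<in> H1 \<Omega>" by (rule test_functions_H1[OF test_functions_0])
  fix u v w :: "'a \<Rightarrow> real" and c :: real
  assume u: "u \<in> H1 \<Omega>"
  show "0 \<le> dir u u" using u by (auto simp: dir_def intro!: sum_nonneg L2.nonneg weak_deriv)
  assume v: "v \<in> H1 \<Omega>"
  show "(\<lambda>x. u x + c * v x) \<in> H1 \<Omega>" by (rule H1_lin[OF u v])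
  show "dir u v = dir v u" using u v by (auto simp: dir_def intro!: sum.cong L2.sym weak_deriv)
  assume w: "w \<in> H1 \<Omega>"
  have "ip \<Omega> (weak_deriv \<Omega> b (\<lambda>x. u x + c * v x)) (weak_deriv \<Omega> b w) =
      ip \<Omega> (weak_deriv \<Omega> b u) (weak_deriv \<Omega> b w) + c * ip \<Omega> (weak_deriv \<Omega> b v) (weak_deriv \<Omega> b w)"
    if b: "b \<in> Basis" for b
  proof -
    have "ip \<Omega> (weak_deriv \<Omega> b (\<lambda>x. u x + c * v x)) (weak_deriv \<Omega> b w) =
        ip \<Omega> (\<lambda>x. weak_deriv \<Omega> b u x + c * weak_deriv \<Omega> b v x) (weak_deriv \<Omega> b w)"
      using u v w b
      by (intro ip_cong_AE weak_deriv_lin) (auto intro!: L2_measurable weak_deriv H1_lin L2_lin)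
    then show ?thesis using u v w b by (simp add: L2.lin_left weak_deriv)
  qed
  then show "dir (\<lambda>x. u x + c * v x) w = dir u w + c * dir v w"
    by (simp add: dir_def sum.distrib sum_distrib_left)
qed

sublocale H1: pre_inner "H1 \<Omega>" h1
  by unfold_locales
    (auto simp: h1_def H1_L2 L2.lin_left dir.lin_left L2.sym dir.sym L2.nonneg dir.nonneg algebra_simps
      intro: dir.zero dir.lin)

lemma nrm_H1: assumes "u \<in> H1 \<Omega>" shows "H1.nrm u = H1_norm \<Omega> u"
proof -
  have "(L2_norm \<Omega> v)\<^sup>2 = ip \<Omega> v v" if "v \<in> L2 \<Omega>" for v
    using L2.nrm_square[OF that] by (simp add: nrm_L2)
  then show ?thesis using assms
    by (simp add: H1.nrm_def H1_norm_def h1_def dir_def weak_deriv H1_L2)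
qed

lemma L2_norm_le_H1: "u \<in> H1 \<Omega> \<Longrightarrow> L2_norm \<Omega> u \<le> H1.nrm u"
  by (simp add: H1.nrm_def h1_def dir.nonneg L2.nrm_def flip: nrm_L2)

lemma dir_le_H1: "u \<in> H1 \<Omega> \<Longrightarrow> dir.nrm u \<le> H1.nrm u"
  by (simp add: H1.nrm_def h1_def L2.nonneg H1_L2 dir.nrm_def)

lemma H1_limit_imp:
  assumes "\<forall>\<^sub>F s in F. u s \<in> H1 \<Omega>" "v \<in> H1 \<Omega>" "((\<lambda>s. H1.nrm (\<lambda>x. u s x - v x)) \<longlongrightarrow> 0) F"
  shows "((\<lambda>s. L2.nrm \<Omega> (\<lambda>x. u s x - v x)) \<longlongrightarrow> 0) F" "((\<lambda>s. dir.nrm (\<lambda>x. u s x - v x)) \<longlongrightarrow> 0) F"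
proof -
  have d: "\<forall>\<^sub>F s in F. (\<lambda>x. u s x - v x) \<in> H1 \<Omega>"
    using assms(1) by eventually_elim (intro dir.diff assms(2))
  have "\<forall>\<^sub>F s in F. norm (L2.nrm \<Omega> (\<lambda>x. u s x - v x)) \<le> H1.nrm (\<lambda>x. u s x - v x)"
    using d by eventually_elim (use L2_norm_le_H1 L2.nrm_nonneg[OF H1_L2] in \<open>auto simp: nrm_L2\<close>)
  then show "((\<lambda>s. L2.nrm \<Omega> (\<lambda>x. u s x - v x)) \<longlongrightarrow> 0) F" by (rule Lim_null_comparison[OF _ assms(3)])
  have "\<forall>\<^sub>F s in F. norm (dir.nrm (\<lambda>x. u s x - v x)) \<le> H1.nrm (\<lambda>x. u s x - v x)"
    using d by eventually_elim (simp add: dir_le_H1 dir.nrm_nonneg)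
  then show "((\<lambda>s. dir.nrm (\<lambda>x. u s x - v x)) \<longlongrightarrow> 0) F" by (rule Lim_null_comparison[OF _ assms(3)])
qed

lemma L2_norm_weak_deriv_le_H1:
  assumes "u \<in> H1 \<Omega>" "b \<in> Basis" shows "L2_norm \<Omega> (weak_deriv \<Omega> b u) \<le> H1.nrm u"
proof -
  have "ip \<Omega> (weak_deriv \<Omega> b u) (weak_deriv \<Omega> b u) \<le> dir u u"
    unfolding dir_def using assms by (intro member_le_sum) (auto intro!: L2.nonneg weak_deriv)
  then have "L2.nrm \<Omega> (weak_deriv \<Omega> b u) \<le> dir.nrm u" by (simp add: dir.nrm_def L2.nrm_def)
  then show ?thesis using dir_le_H1[OF assms(1)] by (simp add: nrm_L2)
qed

lemma weak_deriv_diff: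
  assumes "u \<in> H1 \<Omega>" "v \<in> H1 \<Omega>" "b \<in> Basis"
  shows "L2_norm \<Omega> (\<lambda>x. weak_deriv \<Omega> b u x - weak_deriv \<Omega> b v x) = L2_norm \<Omega> (weak_deriv \<Omega> b (\<lambda>x. u x - v x))"
proof -
  have "ip \<Omega> (\<lambda>x. weak_deriv \<Omega> b u x - weak_deriv \<Omega> b v x) (\<lambda>x. weak_deriv \<Omega> b u x - weak_deriv \<Omega> b v x) =
    ip \<Omega> (weak_deriv \<Omega> b (\<lambda>x. u x - v x)) (weak_deriv \<Omega> b (\<lambda>x. u x - v x))"
    using weak_deriv_lin[OF assms, of "-1"] assms
    by (intro ip_cong_AE) (auto intro!: L2_measurable L2.diff weak_deriv dir.diff elim: eventually_mono)
  then show ?thesis by (simp add: L2.nrm_def flip: nrm_L2)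
qed

text \<open>The functions and each of their partial derivatives converge in \<open>L2\<close>;
  closedness identifies the limits of the derivatives as the derivatives of the limit.\<close>

lemma H1_complete:
  assumes u: "\<And>n. u n \<in> H1 \<Omega>"
    and Cauchy: "\<And>e. 0 < e \<Longrightarrow> \<exists>N. \<forall>m\<ge>N. \<forall>n\<ge>N. H1.nrm (\<lambda>x. u m x - u n x) < e"
  obtains v where "v \<in> H1 \<Omega>" "(\<lambda>n. H1.nrm (\<lambda>x. u n x - v x)) \<longlonglongrightarrow> 0"
proof -
  have C: "\<exists>N. \<forall>m\<ge>N. \<forall>n\<ge>N. L2_norm \<Omega> (\<lambda>x. u m x - u n x) < e" if "0 < e" for e
    by (rule ex_tail_less_mono[OF Cauchy[OF that] L2_norm_le_H1[OF dir.diff[OF u u]]])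
  obtain v where v: "v \<in> L2 \<Omega>" "(\<lambda>n. L2_norm \<Omega> (\<lambda>x. u n x - v x)) \<longlonglongrightarrow> 0"
    using L2_complete[OF H1_L2[OF u] C] by metis
  have "\<exists>g. g \<in> L2 \<Omega> \<and> (\<lambda>n. L2_norm \<Omega> (\<lambda>x. weak_deriv \<Omega> b (u n) x - g x)) \<longlonglongrightarrow> 0" if b: "b \<in> Basis" for b
  proof -
    have C: "\<exists>N. \<forall>m\<ge>N. \<forall>n\<ge>N. L2_norm \<Omega> (\<lambda>x. weak_deriv \<Omega> b (u m) x - weak_deriv \<Omega> b (u n) x) < e" if "0 < e" for e
      unfolding weak_deriv_diff[OF u u b]
      by (rule ex_tail_less_mono[OF Cauchy[OF that] L2_norm_weak_deriv_le_H1[OF dir.diff[OF u u] b]])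
    show ?thesis using L2_complete[OF weak_deriv_L2[OF u b] C] by metis
  qed
  then obtain g where g: "\<And>b. b \<in> Basis \<Longrightarrow> g b \<in> L2 \<Omega>"
    "\<And>b. b \<in> Basis \<Longrightarrow> (\<lambda>n. L2_norm \<Omega> (\<lambda>x. weak_deriv \<Omega> b (u n) x - g b x)) \<longlonglongrightarrow> 0" by metis
  have hg: "has_weak_deriv \<Omega> b v (g b)" if "b \<in> Basis" for b
    by (rule has_weak_deriv_limit[of u v "\<lambda>n. weak_deriv \<Omega> b (u n)"])
      (use that u v g H1_L2 weak_deriv in auto)
  have vH: "v \<in> H1 \<Omega>" unfolding H1_def using v(1) g(1) hg by blast
  have "(\<lambda>n. (L2_norm \<Omega> (\<lambda>x. u n x - v x))\<^sup>2 + (\<Sum>b\<in>Basis. (L2_norm \<Omega> (\<lambda>x. weak_deriv \<Omega> b (u n) x - g b x))\<^sup>2))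
      \<longlonglongrightarrow> 0\<^sup>2 + (\<Sum>b\<in>(Basis::'a set). 0\<^sup>2)"
    by (intro tendsto_intros v g)
  then have "(\<lambda>n. sqrt ((L2_norm \<Omega> (\<lambda>x. u n x - v x))\<^sup>2 + (\<Sum>b\<in>Basis. (L2_norm \<Omega> (\<lambda>x. weak_deriv \<Omega> b (u n) x - g b x))\<^sup>2)))
      \<longlonglongrightarrow> sqrt 0" by (intro tendsto_real_sqrt) simp
  moreover have "L2_norm \<Omega> (\<lambda>x. weak_deriv \<Omega> b (u n) x - g b x) = L2_norm \<Omega> (weak_deriv \<Omega> b (\<lambda>x. u n x - v x))"
    if b: "b \<in> Basis" for b n
  proof -
    have "ip \<Omega> (\<lambda>x. weak_deriv \<Omega> b (u n) x - g b x) (\<lambda>x. weak_deriv \<Omega> b (u n) x - g b x) =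
      ip \<Omega> (\<lambda>x. weak_deriv \<Omega> b (u n) x - weak_deriv \<Omega> b v x) (\<lambda>x. weak_deriv \<Omega> b (u n) x - weak_deriv \<Omega> b v x)"
      using weak_deriv_AE_eq[OF g(1)[OF b] hg[OF b]] u vH b g(1)
      by (intro ip_cong_AE) (auto intro!: L2_measurable L2.diff weak_deriv elim: eventually_mono)
    then show ?thesis
      unfolding weak_deriv_diff[OF u vH b, symmetric] by (simp add: L2.nrm_def flip: nrm_L2)
  qed
  ultimately have "(\<lambda>n. H1_norm \<Omega> (\<lambda>x. u n x - v x)) \<longlonglongrightarrow> 0"
    by (simp add: H1_norm_def)
  then have "(\<lambda>n. H1.nrm (\<lambda>x. u n x - v x)) \<longlonglongrightarrow> 0"
    using nrm_H1[OF dir.diff[OF u vH]] by simp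
  with vH show thesis using that by blast
qed

lemma H01_H1: "u \<in> H01 \<Omega> \<Longrightarrow> u \<in> H1 \<Omega>" by (simp add: H01_def)

lemma H01_L2: "u \<in> H01 \<Omega> \<Longrightarrow> u \<in> L2 \<Omega>" using H01_H1 H1_L2 by blast

lemma H01_iff:
  "u \<in> H01 \<Omega> \<longleftrightarrow> u \<in> H1 \<Omega> \<and> (\<forall>e>0. \<exists>\<psi>\<in>test_functions \<Omega>. H1.nrm (\<lambda>x. u x - \<psi> x) < e)"
proof -
  have "H1.nrm (\<lambda>x. u x - \<psi> x) = H1_norm \<Omega> (\<lambda>x. u x - \<psi> x)"
    if "u \<in> H1 \<Omega>" "\<psi> \<in> test_functions \<Omega>" for \<psi>
    by (rule nrm_H1[OF dir.diff[OF that(1) test_functions_H1[OF that(2)]]])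
  then show ?thesis unfolding H01_def by auto
qed

lemma test_functions_H01: "\<psi> \<in> test_functions \<Omega> \<Longrightarrow> \<psi> \<in> H01 \<Omega>"
  unfolding H01_iff using test_functions_H1
  by (auto simp: H1.nrm_def H1.zero_left dir.zero intro!: bexI[of _ \<psi>])

lemma H01_approx:
  assumes "u \<in> H01 \<Omega>"
  obtains \<psi> where "\<And>n. \<psi> n \<in> test_functions \<Omega>" "(\<lambda>n. H1.nrm (\<lambda>x. \<psi> n x - u x)) \<longlonglongrightarrow> 0"
proof -
  have "\<exists>\<psi>\<in>test_functions \<Omega>. H1.nrm (\<lambda>x. u x - \<psi> x) < inverse (real (Suc n))" for n
    using assms unfolding H01_iff by simp
  then obtain \<psi> where \<psi>: "\<And>n. \<psi> n \<in> test_functions \<Omega>"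
    "\<And>n. H1.nrm (\<lambda>x. u x - \<psi> n x) < inverse (real (Suc n))" by metis
  have eq: "H1.nrm (\<lambda>x. \<psi> n x - u x) = H1.nrm (\<lambda>x. u x - \<psi> n x)" for n
    using H1.nrm_minus_commute[OF H01_H1[OF assms] test_functions_H1[OF \<psi>(1)]] by simp
  have "(\<lambda>n. H1.nrm (\<lambda>x. \<psi> n x - u x)) \<longlonglongrightarrow> 0"
  proof (rule Lim_null_comparison[OF _ LIMSEQ_inverse_real_of_nat])
    show "\<forall>\<^sub>F n in sequentially. norm (H1.nrm (\<lambda>x. \<psi> n x - u x)) \<le> inverse (real (Suc n))"
      using less_imp_le[OF \<psi>(2)] H1.nrm_nonneg[OF dir.diff[OF H01_H1[OF assms] test_functions_H1[OF \<psi>(1)]]]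
      by (intro always_eventually allI) (simp add: eq del: of_nat_Suc)
  qed
  with \<psi>(1) show thesis using that by blast
qed

lemma H01_lin:
  assumes "u \<in> H01 \<Omega>" "v \<in> H01 \<Omega>" shows "(\<lambda>x. u x + c * v x) \<in> H01 \<Omega>"
  unfolding H01_iff
proof (intro conjI allI impI)
  note uv = assms[THEN H01_H1]
  show "(\<lambda>x. u x + c * v x) \<in> H1 \<Omega>" by (intro H1_lin uv)
  fix e :: real assume e: "0 < e"
  define d where "d = e / (1 + \<bar>c\<bar>)"
  have "0 < d" "d * (1 + \<bar>c\<bar>) = e" using e by (auto simp: d_def add_pos_nonneg)
  then have d: "0 < d" "d + \<bar>c\<bar> * d = e" by (auto simp: algebra_simps)
  obtain \<psi> \<eta> where t: "\<psi> \<in> test_functions \<Omega>" "\<eta> \<in> test_functions \<Omega>"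
    "H1.nrm (\<lambda>x. u x - \<psi> x) < d" "H1.nrm (\<lambda>x. v x - \<eta> x) < d"
    using assms d(1) unfolding H01_iff by blast
  note H = dir.diff[OF uv(1) test_functions_H1[OF t(1)]] dir.diff[OF uv(2) test_functions_H1[OF t(2)]]
  have "H1.nrm (\<lambda>x. u x + c * v x - (\<psi> x + c * \<eta> x)) = H1.nrm (\<lambda>x. (u x - \<psi> x) + c * (v x - \<eta> x))"
    by (simp add: algebra_simps)
  also have "\<dots> \<le> H1.nrm (\<lambda>x. u x - \<psi> x) + \<bar>c\<bar> * H1.nrm (\<lambda>x. v x - \<eta> x)"
    using H1.nrm_triangle[OF H(1) dir.scale[OF H(2)]] H1.nrm_scale[OF H(2)] by simp
  also have "\<dots> < d + \<bar>c\<bar> * d"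
    using t(3,4) by (intro add_less_le_mono mult_left_mono) auto
  finally show "\<exists>\<psi>\<in>test_functions \<Omega>. H1.nrm (\<lambda>x. u x + c * v x - \<psi> x) < e"
    using d(2) test_functions_lincomb[OF t(1,2)] by auto
qed

sublocale H01: pre_inner "H01 \<Omega>" h1
  by unfold_locales (auto intro!: H1.sym H1.lin_left H1.nonneg H01_H1 H01_lin test_functions_H01[OF test_functions_0])

lemma H01_complete:
  assumes u: "\<And>n. u n \<in> H01 \<Omega>"
    and Cauchy: "\<And>e. 0 < e \<Longrightarrow> \<exists>N. \<forall>m\<ge>N. \<forall>n\<ge>N. H1.nrm (\<lambda>x. u m x - u n x) < e"
  obtains v where "v \<in> H01 \<Omega>" "(\<lambda>n. H1.nrm (\<lambda>x. u n x - v x)) \<longlonglongrightarrow> 0"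
proof -
  obtain v where v: "v \<in> H1 \<Omega>" "(\<lambda>n. H1.nrm (\<lambda>x. u n x - v x)) \<longlonglongrightarrow> 0"
    using H1_complete[OF H01_H1[OF u] Cauchy] by metis
  have "\<exists>\<psi>\<in>test_functions \<Omega>. H1.nrm (\<lambda>x. v x - \<psi> x) < e" if e: "0 < e" for e
  proof -
    have "\<forall>\<^sub>F n in sequentially. H1.nrm (\<lambda>x. u n x - v x) < e / 2"
      using e by (intro order_tendstoD[OF v(2)]) simp
    then obtain n where n: "H1.nrm (\<lambda>x. u n x - v x) < e / 2" by (auto simp: eventually_sequentially)
    obtain \<psi> where \<psi>: "\<psi> \<in> test_functions \<Omega>" "H1.nrm (\<lambda>x. u n x - \<psi> x) < e / 2"
      using u[of n] e half_gt_zero unfolding H01_iff by blast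
    have "H1.nrm (\<lambda>x. v x - \<psi> x) < e"
      using n \<psi>(2) H1.nrm_diff_triangle[OF v(1) H01_H1[OF u[of n]] test_functions_H1[OF \<psi>(1)]]
        H1.nrm_minus_commute[OF v(1) H01_H1[OF u[of n]]] by simp
    then show ?thesis using \<psi>(1) by blast
  qed
  then have "v \<in> H01 \<Omega>" unfolding H01_iff using v(1) by blast
  with v(2) show thesis using that by blast
qed

end

section \<open>The Sobolev inequality\<close>

text \<open>\<open>\<psi>\<^sup>2\<close> is the integral of \<open>2 \<psi> \<partial>\<psi>\<close> along the line up to the point in question.\<close>

lemma test_function_square_le_line_integral:
  fixes y :: "'a::euclidean_space"
  assumes \<psi>: "\<psi> \<in> test_functions \<Omega>" and y: "norm y = 1"
  shows "ennreal ((\<psi> (x + s *\<^sub>R y))\<^sup>2) \<le>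
    2 * (\<integral>\<^sup>+\<sigma>. ennreal \<bar>\<psi> (x + \<sigma> *\<^sub>R y) * frechet_derivative \<psi> (at (x + \<sigma> *\<^sub>R y)) y\<bar> \<partial>lborel)"
proof -
  let ?f = "\<lambda>\<sigma>. \<psi> (x + \<sigma> *\<^sub>R y)" and ?g = "\<lambda>\<sigma>. frechet_derivative \<psi> (at (x + \<sigma> *\<^sub>R y)) y"
  note t = test_functions_frechet_derivative[OF \<psi>, of y]
  obtain K where K: "compact K" "K \<subseteq> \<Omega>" "\<And>x. x \<notin> K \<Longrightarrow> \<psi> x = 0" "continuous_on UNIV \<psi>"
    using test_functions_compact_support[OF \<psi>] by metis
  obtain R where R: "\<And>x. x \<in> K \<Longrightarrow> norm x \<le> R"
    using compact_imp_bounded[OF K(1)] by (auto simp: bounded_iff)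
  \<comment> \<open>Starting point of the integration: not beyond \<open>s\<close>, and so far out
    on the line that \<open>x + a *\<^sub>R y\<close> has left the support and the boundary term
    vanishes.\<close>
  define a where "a = min s (- (norm x + \<bar>R\<bar> + 1))"
  have "\<bar>a\<bar> = norm (a *\<^sub>R y)" using y by simp
  also have "\<dots> \<le> norm (x + a *\<^sub>R y) + norm x"
    using norm_triangle_ineq4[of "x + a *\<^sub>R y" x] by simp
  finally have "norm (x + a *\<^sub>R y) > R" by (auto simp: a_def min_def split: if_splits)
  then have fa: "?f a = 0" using K(3) R by fastforce
  have cont: "continuous_on UNIV ?f" "continuous_on UNIV ?g"
    by (intro continuous_on_compose2[OF K(4)] continuous_on_compose2[OF smooth_on_continuous[OF test_functions_smooth[OF t]]]
        continuous_intros; simp)+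
  then have [measurable]: "?f \<in> borel_measurable borel" "?g \<in> borel_measurable borel"
    by (auto intro: borel_measurable_continuous_onI)
  have d: "((\<lambda>\<sigma>. (?f \<sigma>)\<^sup>2) has_real_derivative 2 * (?f \<sigma> * ?g \<sigma>)) (at \<sigma>)" for \<sigma>
    by (auto intro!: derivative_eq_intros test_function_line_derivative[OF \<psi>])
  have "isCont (\<lambda>\<sigma>. 2 * (?f \<sigma> * ?g \<sigma>)) \<sigma>" for \<sigma>
    using cont by (intro continuous_intros) (auto simp: continuous_on_eq_continuous_at)
  then have hb: "has_bochner_integral lborel (\<lambda>\<sigma>. 2 * (?f \<sigma> * ?g \<sigma>) * indicator {a..s} \<sigma>) ((?f s)\<^sup>2 - (?f a)\<^sup>2)"
    by (intro has_bochner_integral_FTC_Icc_real d) (auto simp: a_def)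
  then have "ennreal \<bar>(?f s)\<^sup>2\<bar> \<le> (\<integral>\<^sup>+\<sigma>. ennreal (norm (2 * (?f \<sigma> * ?g \<sigma>) * indicator {a..s} \<sigma>)) \<partial>lborel)"
    using integral_norm_bound_ennreal[of lborel "\<lambda>\<sigma>. 2 * (?f \<sigma> * ?g \<sigma>) * indicator {a..s} \<sigma>"] fa
    by (auto simp: has_bochner_integral_iff)
  also have "\<dots> \<le> (\<integral>\<^sup>+\<sigma>. 2 * ennreal \<bar>?f \<sigma> * ?g \<sigma>\<bar> \<partial>lborel)"
    by (intro nn_integral_mono)
      (auto simp: indicator_def abs_mult ennreal_mult simp flip: ennreal_numeral intro!: ennreal_leI)
  also have "\<dots> = 2 * (\<integral>\<^sup>+\<sigma>. ennreal \<bar>?f \<sigma> * ?g \<sigma>\<bar> \<partial>lborel)"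
    by (rule nn_integral_cmult) measurable
  finally show ?thesis by simp
qed

lemma ennreal_mult_le_squares: "a * b \<le> a\<^sup>2 + b\<^sup>2" for a b :: ennreal
proof (cases "a \<le> b")
  case True
  then have "a * b \<le> b * b" by (rule mult_right_mono) simp
  then show ?thesis by (simp add: power2_eq_square add_increasing)
next
  case False
  then have "a * b \<le> a * a" by (intro mult_left_mono) auto
  then show ?thesis by (simp add: power2_eq_square add_increasing2)
qed

section \<open>Coordinates and iterated integrals in three-space\<close>

abbreviation e3 :: "3 \<Rightarrow> real^3" where "e3 i \<equiv> axis i 1"

definition pt :: "(real \<times> real) \<times> real \<Rightarrow> real^3" where
  "pt p = fst (fst p) *\<^sub>R e3 1 + snd (fst p) *\<^sub>R e3 2 + snd p *\<^sub>R e3 3"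

lemma pt_nth: "pt p $ 1 = fst (fst p)" "pt p $ 2 = snd (fst p)" "pt p $ 3 = snd p"
  by (simp_all add: pt_def axis_def)

lemma pt_measurable[measurable]: "pt \<in> borel_measurable borel"
  unfolding pt_def by (intro borel_measurable_continuous_onI continuous_intros)

lemma Basis_3: "(Basis :: (real^3) set) = {e3 1, e3 2, e3 3}" "distinct [e3 1, e3 2, e3 3]"
proof -
  show "(Basis :: (real^3) set) = {e3 1, e3 2, e3 3}" unfolding Basis_vec_def UNIV_3 by auto
  have "(1::3) \<noteq> 2" "(1::3) \<noteq> 3" "(2::3) \<noteq> 3" by simp_all
  then show "distinct [e3 1, e3 2, e3 3]" by (auto simp: axis_eq_axis)
qed

text \<open>Lebesgue measure is determined by the volumes of boxes, and the preimage of a box under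
  \<open>pt\<close> is a product of three intervals.\<close>

lemma distr_pt: "distr lborel borel pt = lborel"
proof (rule lborel_eqI[symmetric])
  fix l u :: "real^3" assume lu: "\<And>b. b \<in> Basis \<Longrightarrow> l \<bullet> b \<le> u \<bullet> b"
  have le: "l $ i \<le> u $ i" for i using lu[of "e3 i"] by (auto simp: inner_axis Basis_vec_def)
  have "pt -` box l u = ({l$1<..<u$1} \<times> {l$2<..<u$2}) \<times> {l$3<..<u$3}"
    by (auto simp: mem_box_cart forall_3 pt_nth)
  then have "emeasure (distr lborel borel pt) (box l u) =
      emeasure (lborel \<Otimes>\<^sub>M lborel) (({l$1<..<u$1} \<times> {l$2<..<u$2}) \<times> {l$3<..<u$3})"
    by (subst emeasure_distr) (auto simp: lborel_prod)
  also have "\<dots> = emeasure lborel ({l$1<..<u$1} \<times> {l$2<..<u$2}) * ennreal (u$3 - l$3)"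
  proof (subst lborel.emeasure_pair_measure_Times)
    show "{l$1<..<u$1} \<times> {l$2<..<u$2} \<in> sets lborel" by (simp add: open_Times borel_open)
  qed (use le in auto)
  also have "emeasure lborel ({l$1<..<u$1} \<times> {l$2<..<u$2}) = ennreal (u$1 - l$1) * ennreal (u$2 - l$2)"
    unfolding lborel_prod[symmetric] by (subst lborel.emeasure_pair_measure_Times) (use le in auto)
  also have "ennreal (u$1 - l$1) * ennreal (u$2 - l$2) * ennreal (u$3 - l$3) = ennreal (\<Prod>b\<in>Basis. (u - l) \<bullet> b)"
    using le Basis_3(2) by (simp add: Basis_3 inner_axis ennreal_mult mult.assoc)
  finally show "emeasure (distr lborel borel pt) (box l u) = ennreal (\<Prod>b\<in>Basis. (u - l) \<bullet> b)" .
qed simp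

lemma nn_integral_pt:
  assumes [measurable]: "f \<in> borel_measurable borel"
  shows "(\<integral>\<^sup>+x. f x \<partial>lborel) = (\<integral>\<^sup>+r. \<integral>\<^sup>+q. f (pt (q, r)) \<partial>lborel \<partial>lborel)"
    and "(\<integral>\<^sup>+x. f x \<partial>lborel) = (\<integral>\<^sup>+q. \<integral>\<^sup>+r. f (pt (q, r)) \<partial>lborel \<partial>lborel)"
proof -
  have m: "(\<lambda>p. f (pt p)) \<in> borel_measurable (lborel \<Otimes>\<^sub>M lborel)"
    unfolding lborel_prod by measurable
  have eq: "(\<integral>\<^sup>+x. f x \<partial>lborel) = (\<integral>\<^sup>+p. f (pt p) \<partial>(lborel \<Otimes>\<^sub>M lborel))"
    unfolding lborel_prod by (subst distr_pt[symmetric]) (auto simp: nn_integral_distr)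
  show "(\<integral>\<^sup>+x. f x \<partial>lborel) = (\<integral>\<^sup>+r. \<integral>\<^sup>+q. f (pt (q, r)) \<partial>lborel \<partial>lborel)"
    unfolding eq by (rule lborel_pair.nn_integral_snd[OF m, symmetric])
  show "(\<integral>\<^sup>+x. f x \<partial>lborel) = (\<integral>\<^sup>+q. \<integral>\<^sup>+r. f (pt (q, r)) \<partial>lborel \<partial>lborel)"
    unfolding eq by (rule lborel.nn_integral_fst[OF m, symmetric])
qed

text \<open>
  On each horizontal slice \<open>\<psi>\<^sup>4\<close> is bounded by a function of \<open>t\<close> times a function of \<open>s\<close>,
  whose integrals are controlled by Cauchy-Schwarz; the slice norm \<open>\<integral>\<psi>\<^sup>2\<close> itself is bounded
  uniformly by integrating in the vertical direction.
\<close>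

lemma sobolev_test_function:
  fixes \<psi> :: "real^3 \<Rightarrow> real"
  assumes \<psi>: "\<psi> \<in> test_functions \<Omega>"
  defines "N \<equiv> (\<integral>\<^sup>+x. ennreal ((\<psi> x)\<^sup>2 + (\<Sum>b\<in>Basis. (frechet_derivative \<psi> (at x) b)\<^sup>2)) \<partial>lborel)"
  shows "(\<integral>\<^sup>+x. ennreal ((\<psi> x)^4) \<partial>lborel) \<le> 4 * N\<^sup>2"
proof -
  define D where "D i x = frechet_derivative \<psi> (at x) (e3 i)" for i x
  have \<psi>m[measurable]: "\<psi> \<in> borel_measurable borel" by (rule integrable_test_function[OF \<psi>])
  have Dm[measurable]: "D i \<in> borel_measurable borel" for i
    unfolding D_def[abs_def] by (rule integrable_test_function[OF test_functions_frechet_derivative[OF \<psi>]])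
  have N: "N = (\<integral>\<^sup>+x. ennreal ((\<psi> x)\<^sup>2 + (D 1 x)\<^sup>2 + (D 2 x)\<^sup>2 + (D 3 x)\<^sup>2) \<partial>lborel)"
    unfolding N_def D_def using Basis_3(2) by (simp add: Basis_3 add.assoc)
  define A where "A i x = ennreal \<bar>\<psi> x * D i x\<bar>" for i x
  have Am[measurable]: "A i \<in> borel_measurable borel" for i unfolding A_def[abs_def] by measurable
  have line: "ennreal ((\<psi> (pt ((s, t), r)))\<^sup>2) \<le> 2 * (\<integral>\<^sup>+\<sigma>. A 1 (pt ((\<sigma>, t), r)) \<partial>lborel)"
    "ennreal ((\<psi> (pt ((s, t), r)))\<^sup>2) \<le> 2 * (\<integral>\<^sup>+\<sigma>. A 2 (pt ((s, \<sigma>), r)) \<partial>lborel)"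
    "ennreal ((\<psi> (pt ((s, t), r)))\<^sup>2) \<le> 2 * (\<integral>\<^sup>+\<sigma>. A 3 (pt ((s, t), \<sigma>)) \<partial>lborel)" for s t r
    using test_function_square_le_line_integral[OF \<psi>, of "e3 1" "pt ((0, t), r)" s]
      test_function_square_le_line_integral[OF \<psi>, of "e3 2" "pt ((s, 0), r)" t]
      test_function_square_le_line_integral[OF \<psi>, of "e3 3" "pt ((s, t), 0)" r]
    by (simp_all add: A_def D_def pt_def add_ac)
  define U where "U r = (\<integral>\<^sup>+q. ennreal ((\<psi> (pt (q, r)))\<^sup>2) \<partial>lborel)" for r
  define G where "G i r = (\<integral>\<^sup>+q. ennreal ((D i (pt (q, r)))\<^sup>2) \<partial>lborel)" for i r
  define P where "P i r = (\<integral>\<^sup>+q. A i (pt (q, r)) \<partial>lborel)" for i r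
  have PUG: "(P i r)\<^sup>2 \<le> U r * G i r" for i r
  proof -
    have "P i r = (\<integral>\<^sup>+q. ennreal \<bar>\<psi> (pt (q, r))\<bar> * ennreal \<bar>D i (pt (q, r))\<bar> \<partial>lborel)"
      by (simp add: P_def A_def abs_mult ennreal_mult)
    also have "\<dots>\<^sup>2 \<le> (\<integral>\<^sup>+q. (ennreal \<bar>\<psi> (pt (q, r))\<bar>)\<^sup>2 \<partial>lborel) * (\<integral>\<^sup>+q. (ennreal \<bar>D i (pt (q, r))\<bar>)\<^sup>2 \<partial>lborel)"
      by (rule Cauchy_Schwarz_nn_integral) measurable
    also have "\<dots> = U r * G i r" by (simp add: U_def G_def ennreal_power)
    finally show ?thesis .
  qed
  \<comment> \<open>The factor 2 of the vertical line bound is absorbed exactly by 2ab <= a^2 + b^2,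
    so the slice norm is at most the full squared norm \<open>N\<close>, uniformly in the height
    \<open>r\<close>.\<close>
  have UN: "U r \<le> N" for r
  proof -
    have "U r \<le> (\<integral>\<^sup>+q. \<integral>\<^sup>+\<sigma>. ennreal ((\<psi> (pt (q, \<sigma>)))\<^sup>2 + (D 3 (pt (q, \<sigma>)))\<^sup>2) \<partial>lborel \<partial>lborel)"
      unfolding U_def
    proof (intro nn_integral_mono)
      fix q :: "real \<times> real"
      have "ennreal ((\<psi> (pt (q, r)))\<^sup>2) \<le> 2 * (\<integral>\<^sup>+\<sigma>. A 3 (pt (q, \<sigma>)) \<partial>lborel)"
        using line(3)[of "fst q" "snd q"] by simp
      also have "\<dots> = (\<integral>\<^sup>+\<sigma>. 2 * A 3 (pt (q, \<sigma>)) \<partial>lborel)"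
        by (rule nn_integral_cmult[symmetric]) measurable
      also have "\<dots> \<le> (\<integral>\<^sup>+\<sigma>. ennreal ((\<psi> (pt (q, \<sigma>)))\<^sup>2 + (D 3 (pt (q, \<sigma>)))\<^sup>2) \<partial>lborel)"
      proof (intro nn_integral_mono)
        fix \<sigma>
        let ?z = "pt (q, \<sigma>)"
        have "2 * A 3 ?z = ennreal (2 * \<bar>\<psi> ?z\<bar> * \<bar>D 3 ?z\<bar>)"
          by (simp add: A_def abs_mult ennreal_mult mult.assoc)
        also have "\<dots> \<le> ennreal ((\<psi> ?z)\<^sup>2 + (D 3 ?z)\<^sup>2)"
          using sum_squares_bound[of "\<bar>\<psi> ?z\<bar>" "\<bar>D 3 ?z\<bar>"] by (intro ennreal_leI) simp
        finally show "2 * A 3 ?z \<le> ennreal ((\<psi> ?z)\<^sup>2 + (D 3 ?z)\<^sup>2)" .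
      qed
      finally show "ennreal ((\<psi> (pt (q, r)))\<^sup>2) \<le> (\<integral>\<^sup>+\<sigma>. ennreal ((\<psi> (pt (q, \<sigma>)))\<^sup>2 + (D 3 (pt (q, \<sigma>)))\<^sup>2) \<partial>lborel)" .
    qed
    also have "\<dots> = (\<integral>\<^sup>+x. ennreal ((\<psi> x)\<^sup>2 + (D 3 x)\<^sup>2) \<partial>lborel)"
      by (rule nn_integral_pt(2)[symmetric]) measurable
    also have "\<dots> \<le> N" unfolding N by (intro nn_integral_mono ennreal_leI) simp
    finally show ?thesis .
  qed
  have slice: "(\<integral>\<^sup>+q. ennreal ((\<psi> (pt (q, r)))^4) \<partial>lborel) \<le> 4 * (P 1 r * P 2 r)" for r
  proof -
    define a where "a t = (\<integral>\<^sup>+s. A 1 (pt ((s, t), r)) \<partial>lborel)" for t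
    define b where "b s = (\<integral>\<^sup>+t. A 2 (pt ((s, t), r)) \<partial>lborel)" for s
    have [measurable]: "(\<lambda>q. A i (pt (q, r))) \<in> borel_measurable (lborel \<Otimes>\<^sub>M lborel)" for i
      unfolding lborel_prod by measurable
    have am[measurable]: "a \<in> borel_measurable borel" "b \<in> borel_measurable borel"
      unfolding a_def[abs_def] b_def[abs_def] by measurable
    have Pa: "P 1 r = (\<integral>\<^sup>+t. a t \<partial>lborel)"
      unfolding P_def a_def lborel_prod[symmetric] by (rule lborel_pair.nn_integral_snd[symmetric]) measurable
    have Pb: "P 2 r = (\<integral>\<^sup>+s. b s \<partial>lborel)"
      unfolding P_def b_def lborel_prod[symmetric] by (rule lborel.nn_integral_fst[symmetric]) measurable
    have "(\<integral>\<^sup>+q. ennreal ((\<psi> (pt (q, r)))^4) \<partial>lborel) \<le> (\<integral>\<^sup>+q. 4 * (a (snd q) * b (fst q)) \<partial>lborel)"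
    proof (intro nn_integral_mono)
      fix q :: "real \<times> real"
      let ?w = "ennreal ((\<psi> (pt (q, r)))\<^sup>2)"
      have "ennreal ((\<psi> (pt (q, r)))^4) = ?w * ?w"
        by (simp add: ennreal_mult[symmetric] power2_eq_square power4_eq_xxxx mult.assoc)
      also have "\<dots> \<le> (2 * a (snd q)) * (2 * b (fst q))"
        using line(1,2)[of "fst q" "snd q" r] by (intro mult_mono) (auto simp: a_def b_def)
      also have "\<dots> = (2 * 2) * (a (snd q) * b (fst q))" by (simp only: mult_ac)
      finally show "ennreal ((\<psi> (pt (q, r)))^4) \<le> 4 * (a (snd q) * b (fst q))" by simp
    qed
    also have "\<dots> = (\<integral>\<^sup>+q. 4 * (a (snd q) * b (fst q)) \<partial>(lborel \<Otimes>\<^sub>M lborel))"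
      by (simp only: lborel_prod)
    also have "\<dots> = 4 * (\<integral>\<^sup>+q. a (snd q) * b (fst q) \<partial>(lborel \<Otimes>\<^sub>M lborel))"
      by (rule nn_integral_cmult) measurable
    also have "(\<integral>\<^sup>+q. a (snd q) * b (fst q) \<partial>(lborel \<Otimes>\<^sub>M lborel)) = (\<integral>\<^sup>+s. \<integral>\<^sup>+t. a t * b s \<partial>lborel \<partial>lborel)"
      by (subst lborel.nn_integral_fst[symmetric]) auto
    also have "\<dots> = P 1 r * P 2 r"
      by (simp add: nn_integral_multc nn_integral_cmult Pa Pb)
    finally show ?thesis .
  qed
  have Gm[measurable]: "G i \<in> borel_measurable borel" for i
  proof -
    have "(\<lambda>p. ennreal ((D i (pt p))\<^sup>2)) \<in> borel_measurable (lborel \<Otimes>\<^sub>M lborel)"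
      unfolding lborel_prod by measurable
    then have "(\<lambda>(r, q). ennreal ((D i (pt (q, r)))\<^sup>2)) \<in> borel_measurable (lborel \<Otimes>\<^sub>M lborel)"
      by (subst (asm) measurable_pair_swap_iff)
    from lborel.borel_measurable_nn_integral[OF this] show ?thesis by (simp add: G_def[abs_def])
  qed
  have Gint: "(\<integral>\<^sup>+r. G i r \<partial>lborel) = (\<integral>\<^sup>+x. ennreal ((D i x)\<^sup>2) \<partial>lborel)" for i
    unfolding G_def by (rule nn_integral_pt(1)[symmetric]) measurable
  have "(\<integral>\<^sup>+x. ennreal ((\<psi> x)^4) \<partial>lborel) = (\<integral>\<^sup>+r. \<integral>\<^sup>+q. ennreal ((\<psi> (pt (q, r)))^4) \<partial>lborel \<partial>lborel)"
    by (rule nn_integral_pt(1)) measurable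
  also have "\<dots> \<le> (\<integral>\<^sup>+r. (4 * N) * (G 1 r + G 2 r) \<partial>lborel)"
  proof (intro nn_integral_mono)
    fix r
    have "(\<integral>\<^sup>+q. ennreal ((\<psi> (pt (q, r)))^4) \<partial>lborel) \<le> 4 * (P 1 r * P 2 r)" by (rule slice)
    \<comment> \<open>\<open>P 1 r * P 2 r\<close> is at most the sum of the squares, and
      \<open>PUG\<close> extracts the common factor \<open>U r\<close>. Once that is replaced by
      \<open>N\<close>, only the integrable slice functions \<open>G\<close> depend on
      \<open>r\<close>.\<close>
    also have "\<dots> \<le> 4 * (U r * G 1 r + U r * G 2 r)"
      by (intro mult_left_mono order_trans[OF ennreal_mult_le_squares] add_mono PUG) simp
    also have "\<dots> = 4 * (U r * (G 1 r + G 2 r))" by (simp add: distrib_left)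
    also have "\<dots> \<le> 4 * (N * (G 1 r + G 2 r))" by (intro mult_left_mono mult_right_mono UN) auto
    finally show "(\<integral>\<^sup>+q. ennreal ((\<psi> (pt (q, r)))^4) \<partial>lborel) \<le> (4 * N) * (G 1 r + G 2 r)"
      by (simp add: mult.assoc)
  qed
  also have "\<dots> = (4 * N) * (\<integral>\<^sup>+r. G 1 r + G 2 r \<partial>lborel)" by (rule nn_integral_cmult) measurable
  also have "(\<integral>\<^sup>+r. G 1 r + G 2 r \<partial>lborel) = (\<integral>\<^sup>+x. ennreal ((D 1 x)\<^sup>2) + ennreal ((D 2 x)\<^sup>2) \<partial>lborel)"
  proof -
    have "(\<integral>\<^sup>+r. G 1 r + G 2 r \<partial>lborel) = (\<integral>\<^sup>+r. G 1 r \<partial>lborel) + (\<integral>\<^sup>+r. G 2 r \<partial>lborel)"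
      by (rule nn_integral_add) measurable
    also have "\<dots> = (\<integral>\<^sup>+x. ennreal ((D 1 x)\<^sup>2) \<partial>lborel) + (\<integral>\<^sup>+x. ennreal ((D 2 x)\<^sup>2) \<partial>lborel)"
      by (simp only: Gint)
    also have "\<dots> = (\<integral>\<^sup>+x. ennreal ((D 1 x)\<^sup>2) + ennreal ((D 2 x)\<^sup>2) \<partial>lborel)"
      by (rule nn_integral_add[symmetric]) measurable
    finally show ?thesis .
  qed
  also have "(4 * N) * \<dots> \<le> (4 * N) * N"
    unfolding N by (intro mult_left_mono nn_integral_mono) (auto simp flip: ennreal_plus intro!: ennreal_leI)
  finally show ?thesis by (simp add: power2_eq_square mult.assoc)
qed

lemma (in open_domain) h1_test:
  assumes \<psi>: "\<psi> \<in> test_functions \<Omega>"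
  shows "h1 \<psi> \<psi> = (LINT x|lborel. (\<psi> x)\<^sup>2 + (\<Sum>b\<in>Basis. (fd b \<psi> x)\<^sup>2))"
    and "integrable lborel (\<lambda>x. (\<psi> x)\<^sup>2 + (\<Sum>b\<in>Basis. (fd b \<psi> x)\<^sup>2))"
proof -
  note t = test_functions_frechet_derivative[OF \<psi>]
  have i: "integrable lborel (\<lambda>x. (\<psi> x)\<^sup>2)" "\<And>b. integrable lborel (\<lambda>x. (fd b \<psi> x)\<^sup>2)"
    unfolding power2_eq_square
    using integrable_test_function(1)[OF test_functions_mult[OF \<psi> \<psi>]]
      integrable_test_function(1)[OF test_functions_mult[OF t t]] by auto
  show "integrable lborel (\<lambda>x. (\<psi> x)\<^sup>2 + (\<Sum>b\<in>Basis. (fd b \<psi> x)\<^sup>2))"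
    by (intro Bochner_Integration.integrable_add Bochner_Integration.integrable_sum i)
  have "ip \<Omega> (weak_deriv \<Omega> b \<psi>) (weak_deriv \<Omega> b \<psi>) = (LINT x|lborel. (fd b \<psi> x)\<^sup>2)" if "b \<in> Basis" for b
  proof -
    have "ip \<Omega> (weak_deriv \<Omega> b \<psi>) (weak_deriv \<Omega> b \<psi>) = ip \<Omega> (fd b \<psi>) (fd b \<psi>)"
      using L2_measurable[OF weak_deriv_L2[OF test_functions_H1[OF \<psi>] that]] L2_measurable[OF test_functions_L2[OF t]]
      by (intro ip_cong_AE weak_deriv_test \<psi>)
    also have "\<dots> = (LINT x|lborel. (fd b \<psi> x)\<^sup>2)"
      by (simp add: ip_test_eq_lborel t power2_eq_square)
    finally show ?thesis .
  qed
  then show "h1 \<psi> \<psi> = (LINT x|lborel. (\<psi> x)\<^sup>2 + (\<Sum>b\<in>Basis. (fd b \<psi> x)\<^sup>2))"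
    by (simp add: h1_def dir_def ip_test_eq_lborel[OF \<psi> \<psi>] i Bochner_Integration.integral_add
        Bochner_Integration.integral_sum flip: power2_eq_square)
qed

lemma square_square: "((x::real)\<^sup>2)\<^sup>2 = x^4"
  by (simp add: power2_eq_square power4_eq_xxxx)

section \<open>The embedding of \<open>H01\<close> into the fourth-power integrable functions and
  the quartic form\<close>

locale open_domain3 = open_domain \<Omega> for \<Omega> :: "(real^3) set"
begin

lemma L4_test_function:
  assumes \<psi>: "\<psi> \<in> test_functions \<Omega>"
  shows "integrable (lebesgue_on \<Omega>) (\<lambda>x. (\<psi> x)^4)" "(LINT x|lebesgue_on \<Omega>. (\<psi> x)^4) \<le> 4 * (H1.nrm \<psi>)^4"
proof -
  have eq: "(\<lambda>x. (\<psi> x)^4) = (\<lambda>x. (\<psi> x * \<psi> x) * (\<psi> x * \<psi> x))" by (simp add: power4_eq_xxxx mult.assoc)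
  have t: "(\<lambda>x. (\<psi> x)^4) \<in> test_functions \<Omega>" unfolding eq by (intro test_functions_mult \<psi>)
  have i: "integrable lborel (\<lambda>x. (\<psi> x)^4)" by (rule integrable_test_function[OF t])
  show "integrable (lebesgue_on \<Omega>) (\<lambda>x. (\<psi> x)^4)"
    using i integral_dom_eq_lborel(2)[OF integrable_test_function(2)[OF t] test_function_outside[OF t]] by simp
  have "(\<integral>\<^sup>+x. ennreal ((\<psi> x)^4) \<partial>lborel) = ennreal (LINT x|lborel. (\<psi> x)^4)"
    by (rule nn_integral_eq_integral[OF i]) simp
  moreover have "(\<integral>\<^sup>+x. ennreal ((\<psi> x)\<^sup>2 + (\<Sum>b\<in>Basis. (fd b \<psi> x)\<^sup>2)) \<partial>lborel) = ennreal (h1 \<psi> \<psi>)"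
    unfolding h1_test(1)[OF \<psi>] by (rule nn_integral_eq_integral[OF h1_test(2)[OF \<psi>]]) (auto intro!: add_nonneg_nonneg sum_nonneg)
  moreover have h: "0 \<le> h1 \<psi> \<psi>" by (rule H1.nonneg[OF test_functions_H1[OF \<psi>]])
  ultimately have "ennreal (LINT x|lborel. (\<psi> x)^4) \<le> ennreal (4 * (h1 \<psi> \<psi>)\<^sup>2)"
    using sobolev_test_function[OF \<psi>] by (simp add: ennreal_mult ennreal_power)
  then have "(LINT x|lborel. (\<psi> x)^4) \<le> 4 * (h1 \<psi> \<psi>)\<^sup>2"
    by (subst (asm) ennreal_le_iff) auto
  also have "h1 \<psi> \<psi> = (H1.nrm \<psi>)\<^sup>2" using H1.nrm_square[OF test_functions_H1[OF \<psi>]] by simp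
  also have "((H1.nrm \<psi>)\<^sup>2)\<^sup>2 = (H1.nrm \<psi>)^4" by (rule square_square)
  finally show "(LINT x|lebesgue_on \<Omega>. (\<psi> x)^4) \<le> 4 * (H1.nrm \<psi>)^4"
    using integral_dom_eq_lborel(1)[OF integrable_test_function(2)[OF t] test_function_outside[OF t]] by simp
qed

text \<open>Approximating test functions converge in \<open>H1\<close> and, along a subsequence,
  almost everywhere; Fatou carries their fourth-power bound over to the limit.\<close>

lemma L4_H01:
  assumes u: "u \<in> H01 \<Omega>"
  shows "integrable (lebesgue_on \<Omega>) (\<lambda>x. (u x)^4)" "(LINT x|lebesgue_on \<Omega>. (u x)^4) \<le> 4 * (H1.nrm u)^4"
proof -
  obtain \<psi> where \<psi>: "\<And>n. \<psi> n \<in> test_functions \<Omega>" "(\<lambda>n. H1.nrm (\<lambda>x. \<psi> n x - u x)) \<longlonglongrightarrow> 0"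
    by (rule H01_approx[OF u]) (rule that)
  have "(\<lambda>n. L2_norm \<Omega> (\<lambda>x. \<psi> n x - u x)) \<longlonglongrightarrow> 0"
    using H1_limit_imp(1)[OF always_eventually H01_H1[OF u] \<psi>(2)] test_functions_H1[OF \<psi>(1)] by (simp add: nrm_L2)
  then obtain r where r: "strict_mono r" "AE x in lebesgue_on \<Omega>. (\<lambda>n. \<psi> (r n) x) \<longlonglongrightarrow> u x"
    by (rule L2_AE_subseq[OF test_functions_L2[OF \<psi>(1)] H01_L2[OF u]]) (rule that)
  have [measurable]: "u \<in> borel_measurable (lebesgue_on \<Omega>)" by (rule L2_measurable[OF H01_L2[OF u]])
  have lim: "(\<lambda>n. 4 * (H1.nrm (\<psi> n))^4) \<longlonglongrightarrow> 4 * (H1.nrm u)^4"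
    using \<psi>(1) test_functions_H1 by (intro tendsto_intros H1.tendsto_nrm \<psi>(2) H01_H1[OF u]) auto
  \<comment> \<open>Fatou asks for one bound valid along the whole sequence. Any \<open>C\<close>
    above the target value provides one after finitely many terms are dropped, and \<open>C\<close>
    is lowered to the target at the end.\<close>
  have C: "integrable (lebesgue_on \<Omega>) (\<lambda>x. (u x)^4) \<and> (LINT x|lebesgue_on \<Omega>. (u x)^4) \<le> C"
    if "4 * (H1.nrm u)^4 < C" for C
  proof -
    have "\<forall>\<^sub>F n in sequentially. 4 * (H1.nrm (\<psi> n))^4 < C" by (rule order_tendstoD(2)[OF lim that])
    then obtain n0 where n0: "\<And>n. n \<ge> n0 \<Longrightarrow> 4 * (H1.nrm (\<psi> n))^4 < C" by (auto simp: eventually_sequentially)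
    have le: "(LINT x|lebesgue_on \<Omega>. (\<psi> (r (n + n0)) x)^4) \<le> C" for n
    proof -
      have "n0 \<le> r (n + n0)" using seq_suble[OF r(1), of "n + n0"] by simp
      then show ?thesis using L4_test_function(2)[OF \<psi>(1)[of "r (n + n0)"]] n0 by force
    qed
    have "AE x in lebesgue_on \<Omega>. (\<lambda>n. (\<psi> (r (n + n0)) x)^4) \<longlonglongrightarrow> (u x)^4"
      using r(2)
    proof eventually_elim
      case (elim x)
      have "(\<lambda>n. \<psi> (r (n + n0)) x) \<longlonglongrightarrow> u x" using elim by (rule LIMSEQ_ignore_initial_segment)
      then show ?case by (rule tendsto_power)
    qed
    then show ?thesis
      using integrable_Fatou[of "lebesgue_on \<Omega>" "\<lambda>n x. (\<psi> (r (n + n0)) x)^4" C "\<lambda>x. (u x)^4"]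
        L4_test_function(1)[OF \<psi>(1)] le by simp
  qed
  show "integrable (lebesgue_on \<Omega>) (\<lambda>x. (u x)^4)" using C[of "4 * (H1.nrm u)^4 + 1"] by simp
  show "(LINT x|lebesgue_on \<Omega>. (u x)^4) \<le> 4 * (H1.nrm u)^4"
    by (rule dense_ge) (use C in blast)
qed

lemma square_L2: assumes u: "u \<in> H01 \<Omega>"
  shows "(\<lambda>x. (u x)\<^sup>2) \<in> L2 \<Omega>" "L2_norm \<Omega> (\<lambda>x. (u x)\<^sup>2) \<le> 2 * (H1.nrm u)\<^sup>2"
proof -
  have [measurable]: "u \<in> borel_measurable (lebesgue_on \<Omega>)" by (rule L2_measurable[OF H01_L2[OF u]])
  show "(\<lambda>x. (u x)\<^sup>2) \<in> L2 \<Omega>" using L4_H01(1)[OF u] by (simp add: L2_def square_square)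
  have "L2_norm \<Omega> (\<lambda>x. (u x)\<^sup>2) = sqrt (LINT x|lebesgue_on \<Omega>. (u x)^4)"
    by (simp add: L2_norm_def square_square)
  also have "\<dots> \<le> sqrt (4 * (H1.nrm u)^4)" by (intro real_sqrt_le_mono L4_H01(2) u)
  also have "\<dots> = sqrt ((2 * (H1.nrm u)\<^sup>2)\<^sup>2)" by (simp add: power_mult_distrib square_square)
  also have "\<dots> = 2 * (H1.nrm u)\<^sup>2" by (subst real_sqrt_abs) simp
  finally show "L2_norm \<Omega> (\<lambda>x. (u x)\<^sup>2) \<le> 2 * (H1.nrm u)\<^sup>2" .
qed

lemma mult_L2: assumes u: "u \<in> H01 \<Omega>" and v: "v \<in> H01 \<Omega>"
  shows "(\<lambda>x. u x * v x) \<in> L2 \<Omega>" "L2_norm \<Omega> (\<lambda>x. u x * v x) \<le> 2 * H1.nrm u * H1.nrm v"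
proof -
  have [measurable]: "u \<in> borel_measurable (lebesgue_on \<Omega>)" "v \<in> borel_measurable (lebesgue_on \<Omega>)"
    by (intro L2_measurable[OF H01_L2] u v)+
  have "integrable (lebesgue_on \<Omega>) (\<lambda>x. (u x)\<^sup>2 * (v x)\<^sup>2)"
    by (intro L2_integrable_mult square_L2 u v)
  then show "(\<lambda>x. u x * v x) \<in> L2 \<Omega>" by (simp add: L2_def power_mult_distrib)
  have "L2_norm \<Omega> (\<lambda>x. u x * v x) = sqrt (ip \<Omega> (\<lambda>x. (u x)\<^sup>2) (\<lambda>x. (v x)\<^sup>2))"
    by (simp add: L2_norm_def ip_def power_mult_distrib)
  also have "\<dots> \<le> sqrt (L2_norm \<Omega> (\<lambda>x. (u x)\<^sup>2) * L2_norm \<Omega> (\<lambda>x. (v x)\<^sup>2))"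
    using L2.Cauchy_Schwarz[OF square_L2(1)[OF u] square_L2(1)[OF v]] by (simp add: nrm_L2)
  also have "\<dots> \<le> sqrt ((2 * (H1.nrm u)\<^sup>2) * (2 * (H1.nrm v)\<^sup>2))"
    by (intro real_sqrt_le_mono mult_mono square_L2 u v) (auto simp: L2_norm_def)
  also have "\<dots> = sqrt ((2 * H1.nrm u * H1.nrm v)\<^sup>2)" by (simp add: power_mult_distrib)
  also have "\<dots> = 2 * H1.nrm u * H1.nrm v"
    using H1.nrm_nonneg[OF H01_H1[OF u]] H1.nrm_nonneg[OF H01_H1[OF v]] by simp
  finally show "L2_norm \<Omega> (\<lambda>x. u x * v x) \<le> 2 * H1.nrm u * H1.nrm v" .
qed

text \<open>The symmetric four-linear form of the nonlinearity: \<open>quad v v v v\<close> is the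
  integral of v^4. Grouped in pairs, its factors are products lying in \<open>L2\<close>, so that it
  inherits its bound and its linearity from \<open>ip\<close>.\<close>

definition quad :: "(real^3 \<Rightarrow> real) \<Rightarrow> (real^3 \<Rightarrow> real) \<Rightarrow> (real^3 \<Rightarrow> real) \<Rightarrow> (real^3 \<Rightarrow> real) \<Rightarrow> real" where
  "quad u v w z = ip \<Omega> (\<lambda>x. u x * v x) (\<lambda>x. w x * z x)"

lemma quad_bound:
  assumes "u \<in> H01 \<Omega>" "v \<in> H01 \<Omega>" "w \<in> H01 \<Omega>" "z \<in> H01 \<Omega>"
  shows "\<bar>quad u v w z\<bar> \<le> 4 * (H1.nrm u * H1.nrm v * H1.nrm w * H1.nrm z)"
proof -
  have "\<bar>quad u v w z\<bar> \<le> L2_norm \<Omega> (\<lambda>x. u x * v x) * L2_norm \<Omega> (\<lambda>x. w x * z x)"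
    unfolding quad_def using L2.Cauchy_Schwarz[OF mult_L2(1)[OF assms(1,2)] mult_L2(1)[OF assms(3,4)]]
    by (simp add: nrm_L2)
  also have "\<dots> \<le> (2 * H1.nrm u * H1.nrm v) * (2 * H1.nrm w * H1.nrm z)"
    using assms[THEN H01_H1, THEN H1.nrm_nonneg]
    by (intro mult_mono mult_L2 assms) (auto simp: L2_norm_def)
  finally show ?thesis by (simp add: mult_ac)
qed

lemma quad_commute:
  "quad u v w z = quad v u w z" "quad u v w z = quad u w v z" "quad u v w z = quad u v z w"
  by (simp_all add: quad_def ip_def mult_ac)

lemma quad_integrable:
  assumes "u \<in> H01 \<Omega>" "v \<in> H01 \<Omega>" "w \<in> H01 \<Omega>" "z \<in> H01 \<Omega>"
  shows "integrable (lebesgue_on \<Omega>) (\<lambda>x. (u x * v x) * (w x * z x))"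
  by (intro L2_integrable_mult mult_L2 assms)

lemma quad_lin:
  assumes "u \<in> H01 \<Omega>" "u' \<in> H01 \<Omega>" "v \<in> H01 \<Omega>" "w \<in> H01 \<Omega>" "z \<in> H01 \<Omega>"
  shows "quad (\<lambda>x. u x + c * u' x) v w z = quad u v w z + c * quad u' v w z"
  using L2.lin_left[OF mult_L2(1)[OF assms(1,3)] mult_L2(1)[OF assms(2,3)] mult_L2(1)[OF assms(4,5)], of c]
  by (simp add: quad_def algebra_simps)

lemma quad_square_nonneg: "0 \<le> quad u u v v"
  by (auto simp: quad_def ip_def intro!: integral_nonneg_AE)

text \<open>Multiplication is bounded from pairs in \<open>H01\<close> to \<open>L2\<close>; the
  difference of products is split as \<open>(u s - u') * v s + u' * (v s - v')\<close>.\<close>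

lemma L2_tendsto_mult:
  assumes u: "\<forall>\<^sub>F s in F. u s \<in> H01 \<Omega>" "u' \<in> H01 \<Omega>" "((\<lambda>s. H1.nrm (\<lambda>x. u s x - u' x)) \<longlongrightarrow> 0) F"
    and v: "\<forall>\<^sub>F s in F. v s \<in> H01 \<Omega>" "v' \<in> H01 \<Omega>" "((\<lambda>s. H1.nrm (\<lambda>x. v s x - v' x)) \<longlongrightarrow> 0) F"
  shows "((\<lambda>s. L2.nrm \<Omega> (\<lambda>x. u s x * v s x - u' x * v' x)) \<longlongrightarrow> 0) F"
proof (rule Lim_null_comparison)
  let ?d = "\<lambda>s x. u s x - u' x" and ?e = "\<lambda>s x. v s x - v' x"
  show "\<forall>\<^sub>F s in F. norm (L2.nrm \<Omega> (\<lambda>x. u s x * v s x - u' x * v' x)) \<le>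
      2 * H1.nrm (?d s) * H1.nrm (v s) + 2 * H1.nrm u' * H1.nrm (?e s)"
    using u(1) v(1)
  proof eventually_elim
    case (elim s)
    note d = H01.diff[OF elim(1) u(2)] and e = H01.diff[OF elim(2) v(2)]
    have "(\<lambda>x. u s x * v s x - u' x * v' x) = (\<lambda>x. ?d s x * v s x + u' x * ?e s x)"
      by (auto simp: algebra_simps)
    then have "L2.nrm \<Omega> (\<lambda>x. u s x * v s x - u' x * v' x) \<le>
        L2.nrm \<Omega> (\<lambda>x. ?d s x * v s x) + L2.nrm \<Omega> (\<lambda>x. u' x * ?e s x)"
      using L2.nrm_triangle[OF mult_L2(1)[OF d elim(2)] mult_L2(1)[OF u(2) e]] by simp
    also have "\<dots> \<le> 2 * H1.nrm (?d s) * H1.nrm (v s) + 2 * H1.nrm u' * H1.nrm (?e s)"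
      using mult_L2(2)[OF d elim(2)] mult_L2(2)[OF u(2) e] by (simp add: nrm_L2)
    finally show ?case by (simp add: nrm_L2 L2_norm_def)
  qed
  have "((\<lambda>s. 2 * H1.nrm (?d s) * H1.nrm (v s) + 2 * H1.nrm u' * H1.nrm (?e s)) \<longlongrightarrow>
      2 * 0 * H1.nrm v' + 2 * H1.nrm u' * 0) F"
    by (intro tendsto_intros u v H1.tendsto_nrm H01_H1[OF v(2)] eventually_mono[OF v(1) H01_H1])
  then show "((\<lambda>s. 2 * H1.nrm (?d s) * H1.nrm (v s) + 2 * H1.nrm u' * H1.nrm (?e s)) \<longlongrightarrow> 0) F"
    by simp
qed

text \<open>The integral of \<phi>^4 is the squared \<open>L2\<close> norm of \<phi>^2. The curve of
  squares is differentiable in \<open>L2\<close>, its difference quotient being that of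
  \<open>\<phi>\<close> times \<open>\<phi> s + \<phi> t\<close>, so the rule for quadratic forms
  applies.\<close>

lemma has_derivative_quad:
  fixes \<phi> :: "real \<Rightarrow> real^3 \<Rightarrow> real"
  assumes \<phi>: "\<forall>\<^sub>F s in at t. \<phi> s \<in> H01 \<Omega>" "\<phi> t \<in> H01 \<Omega>" and \<phi>': "\<phi>' \<in> H01 \<Omega>"
    and lim: "((\<lambda>s. H1.nrm (\<lambda>x. (\<phi> s x - \<phi> t x) / (s - t) - \<phi>' x)) \<longlongrightarrow> 0) (at t)"
  shows "((\<lambda>s. quad (\<phi> s) (\<phi> s) (\<phi> s) (\<phi> s)) has_real_derivative 4 * quad (\<phi> t) (\<phi> t) (\<phi> t) \<phi>') (at t)"
proof -
  let ?q = "\<lambda>s x. (\<phi> s x - \<phi> t x) / (s - t)" and ?p = "\<lambda>s x. \<phi> s x + \<phi> t x"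
  have q: "\<forall>\<^sub>F s in at t. ?q s \<in> H01 \<Omega>"
    using \<phi>(1)
  proof eventually_elim
    case (elim s)
    show ?case using H01.scale[OF H01.diff[OF elim \<phi>(2)], of "1 / (s - t)"] by simp
  qed
  have p: "\<forall>\<^sub>F s in at t. ?p s \<in> H01 \<Omega>" using \<phi>(1) by eventually_elim (intro H01.add \<phi>(2))
  have c: "((\<lambda>s. H1.nrm (\<lambda>x. ?p s x - (\<phi> t x + \<phi> t x))) \<longlongrightarrow> 0) (at t)"
    using H01.difference_quotient_imp_continuous[OF \<phi> \<phi>'] lim by (simp add: H1.nrm_def H01.nrm_def)
  have L: "((\<lambda>s. L2.nrm \<Omega> (\<lambda>x. ?q s x * ?p s x - \<phi>' x * (\<phi> t x + \<phi> t x))) \<longlongrightarrow> 0) (at t)"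
    by (rule L2_tendsto_mult[OF q \<phi>' lim p _ c]) (intro H01.add \<phi>(2))
  have sq: "\<forall>\<^sub>F s in at t. (\<lambda>x. \<phi> s x * \<phi> s x) \<in> L2 \<Omega>"
    using \<phi>(1) by eventually_elim (intro mult_L2)
  have "((\<lambda>s. ip \<Omega> (\<lambda>x. \<phi> s x * \<phi> s x) (\<lambda>x. \<phi> s x * \<phi> s x)) has_real_derivative
      2 * ip \<Omega> (\<lambda>x. \<phi>' x * (\<phi> t x + \<phi> t x)) (\<lambda>x. \<phi> t x * \<phi> t x)) (at t)"
  proof (rule L2.has_derivative_form[OF sq])
    show "(\<lambda>x. \<phi> t x * \<phi> t x) \<in> L2 \<Omega>" by (intro mult_L2 \<phi>)
    show "(\<lambda>x. \<phi>' x * (\<phi> t x + \<phi> t x)) \<in> L2 \<Omega>" by (intro mult_L2 H01.add \<phi> \<phi>')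
    show "((\<lambda>s. L2.nrm \<Omega> (\<lambda>x. (\<phi> s x * \<phi> s x - \<phi> t x * \<phi> t x) / (s - t) - \<phi>' x * (\<phi> t x + \<phi> t x))) \<longlongrightarrow> 0) (at t)"
    proof -
      have "?q s x * ?p s x = (\<phi> s x * \<phi> s x - \<phi> t x * \<phi> t x) / (s - t)" for s x
        by (simp add: square_diff_square_factored mult.commute)
      then show ?thesis using L by (simp only:)
    qed
  qed
  moreover have "ip \<Omega> (\<lambda>x. \<phi>' x * (\<phi> t x + \<phi> t x)) (\<lambda>x. \<phi> t x * \<phi> t x) = 2 * quad (\<phi> t) (\<phi> t) (\<phi> t) \<phi>'"
    by (simp add: ip_def quad_def algebra_simps flip: Bochner_Integration.integral_mult_right_zero)
  ultimately show ?thesis by (simp add: quad_def)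
qed

end

section \<open>Energy, \<open>mu\<close> and the eigenvalue problem in terms of forms\<close>

locale gp_problem = open_domain3 \<Omega> for \<Omega> :: "(real^3) set" +
  fixes V :: "real^3 \<Rightarrow> real" and \<beta> :: real
  assumes V_Linfty: "V \<in> Linfty \<Omega>" and V_nonneg: "AE x in lebesgue_on \<Omega>. V x \<ge> 0" and \<beta>_nonneg: "\<beta> \<ge> 0"
begin

definition V_bound :: real where
  "V_bound = (SOME M. 0 \<le> M \<and> (AE x in lebesgue_on \<Omega>. \<bar>V x\<bar> \<le> M))"

lemma V_bound: "0 \<le> V_bound" "AE x in lebesgue_on \<Omega>. \<bar>V x\<bar> \<le> V_bound"
proof -
  obtain M where "AE x in lebesgue_on \<Omega>. \<bar>V x\<bar> \<le> M" using V_Linfty by (auto simp: Linfty_def)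
  then have "0 \<le> max 0 M \<and> (AE x in lebesgue_on \<Omega>. \<bar>V x\<bar> \<le> max 0 M)"
    by (auto elim!: eventually_mono)
  then have "0 \<le> V_bound \<and> (AE x in lebesgue_on \<Omega>. \<bar>V x\<bar> \<le> V_bound)"
    unfolding V_bound_def by (rule someI)
  then show "0 \<le> V_bound" "AE x in lebesgue_on \<Omega>. \<bar>V x\<bar> \<le> V_bound" by auto
qed

lemma V_measurable[measurable]: "V \<in> borel_measurable (lebesgue_on \<Omega>)"
  using V_Linfty by (simp add: Linfty_def)

lemma V_mult_L2: assumes u: "u \<in> L2 \<Omega>" shows "(\<lambda>x. V x * u x) \<in> L2 \<Omega>"
proof -
  have [measurable]: "u \<in> borel_measurable (lebesgue_on \<Omega>)" by (rule L2_measurable[OF u])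
  have "integrable (lebesgue_on \<Omega>) (\<lambda>x. (V x * u x)\<^sup>2)"
  proof (rule Bochner_Integration.integrable_bound)
    show "integrable (lebesgue_on \<Omega>) (\<lambda>x. V_bound\<^sup>2 * (u x)\<^sup>2)" using u by (simp add: L2_def)
    show "AE x in lebesgue_on \<Omega>. norm ((V x * u x)\<^sup>2) \<le> norm (V_bound\<^sup>2 * (u x)\<^sup>2)"
      using V_bound(2)
    proof eventually_elim
      case (elim x)
      then have "(V x)\<^sup>2 \<le> V_bound\<^sup>2" by (simp add: abs_le_square_iff[symmetric] V_bound(1))
      then show ?case by (simp add: power_mult_distrib mult_right_mono)
    qed
  qed measurable
  then show ?thesis by (simp add: L2_def)
qed

definition pot :: "(real^3 \<Rightarrow> real) \<Rightarrow> (real^3 \<Rightarrow> real) \<Rightarrow> real" where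
  "pot u v = ip \<Omega> (\<lambda>x. V x * u x) v"

text \<open>The form of the Schroedinger operator -Laplacian + V, that is, the part of the energy
  that is quadratic.\<close>

definition A :: "(real^3 \<Rightarrow> real) \<Rightarrow> (real^3 \<Rightarrow> real) \<Rightarrow> real" where
  "A u v = dir u v + pot u v"

lemma pot_nonneg: "0 \<le> pot u u"
  unfolding pot_def ip_def
  by (rule integral_nonneg_AE) (use V_nonneg in \<open>auto elim!: eventually_mono simp: mult.assoc\<close>)

lemma pot_le: assumes u: "u \<in> L2 \<Omega>" shows "pot u u \<le> V_bound * ip \<Omega> u u"
proof -
  have "pot u u \<le> (LINT x|lebesgue_on \<Omega>. V_bound * (u x * u x))"
    unfolding pot_def ip_def
  proof (rule integral_mono_AE)
    show "integrable (lebesgue_on \<Omega>) (\<lambda>x. V x * u x * u x)"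
      by (rule L2_integrable_mult[OF V_mult_L2[OF u] u])
    show "integrable (lebesgue_on \<Omega>) (\<lambda>x. V_bound * (u x * u x))"
      by (intro integrable_mult_right L2_integrable_mult u)
    show "AE x in lebesgue_on \<Omega>. V x * u x * u x \<le> V_bound * (u x * u x)"
      using V_bound(2) by eventually_elim (auto simp: mult.assoc intro!: mult_right_mono)
  qed
  then show ?thesis by (simp add: ip_def)
qed

lemma pot_commute: "pot u v = pot v u" by (simp add: pot_def ip_def mult_ac)

lemma pot_lin: "u \<in> L2 \<Omega> \<Longrightarrow> v \<in> L2 \<Omega> \<Longrightarrow> w \<in> L2 \<Omega> \<Longrightarrow> pot (\<lambda>x. u x + c * v x) w = pot u w + c * pot v w"
  using L2.lin_left[OF V_mult_L2 V_mult_L2, of u v w c] by (simp add: pot_def algebra_simps)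

sublocale A: pre_inner "H01 \<Omega>" A
proof unfold_locales
  show "(\<lambda>x. 0) \<in> H01 \<Omega>" by (rule H01.zero)
  fix u v w :: "real^3 \<Rightarrow> real" and c :: real
  assume u: "u \<in> H01 \<Omega>"
  show "0 \<le> A u u" unfolding A_def by (intro add_nonneg_nonneg pot_nonneg dir.nonneg H01_H1 u)
  assume v: "v \<in> H01 \<Omega>"
  show "(\<lambda>x. u x + c * v x) \<in> H01 \<Omega>" by (rule H01.lin[OF u v])
  show "A u v = A v u" unfolding A_def using pot_commute dir.sym[OF u[THEN H01_H1] v[THEN H01_H1]] by simp
  assume w: "w \<in> H01 \<Omega>"
  show "A (\<lambda>x. u x + c * v x) w = A u w + c * A v w"
    unfolding A_def using u v w by (simp add: dir.lin_left H01_H1 pot_lin H01_L2 algebra_simps)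
qed

lemma A_bounds:
  assumes u: "u \<in> H01 \<Omega>"
  shows "dir u u \<le> A u u" "A u u \<le> (1 + V_bound) * h1 u u"
proof -
  show "dir u u \<le> A u u" by (simp add: A_def pot_nonneg)
  have "0 \<le> V_bound * dir u u" by (intro mult_nonneg_nonneg V_bound dir.nonneg H01_H1 u)
  then show "A u u \<le> (1 + V_bound) * h1 u u"
    using pot_le[OF H01_L2[OF u]] L2.nonneg[OF H01_L2[OF u]] by (simp add: A_def h1_def algebra_simps)
qed

lemma A_nrm_le: assumes "u \<in> H01 \<Omega>" shows "A.nrm u \<le> sqrt (1 + V_bound) * H1.nrm u"
  unfolding A.nrm_def H1.nrm_def real_sqrt_mult[symmetric] by (intro real_sqrt_le_mono A_bounds assms)

lemma integral_weak_grad: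
  assumes "u \<in> H1 \<Omega>" "v \<in> H1 \<Omega>"
  shows "integrable (lebesgue_on \<Omega>) (\<lambda>x. weak_grad \<Omega> u x \<bullet> weak_grad \<Omega> v x)"
    and "(LINT x|lebesgue_on \<Omega>. weak_grad \<Omega> u x \<bullet> weak_grad \<Omega> v x) = dir u v"
proof -
  have eq: "weak_grad \<Omega> u x \<bullet> weak_grad \<Omega> v x = (\<Sum>b\<in>Basis. weak_deriv \<Omega> b u x * weak_deriv \<Omega> b v x)" for x
    by (subst euclidean_inner) (simp add: weak_grad_def)
  have i: "integrable (lebesgue_on \<Omega>) (\<lambda>x. weak_deriv \<Omega> b u x * weak_deriv \<Omega> b v x)" if "b \<in> Basis" for b
    by (intro L2_integrable_mult weak_deriv assms that)
  show "integrable (lebesgue_on \<Omega>) (\<lambda>x. weak_grad \<Omega> u x \<bullet> weak_grad \<Omega> v x)"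
    unfolding eq by (intro Bochner_Integration.integrable_sum i)
  show "(LINT x|lebesgue_on \<Omega>. weak_grad \<Omega> u x \<bullet> weak_grad \<Omega> v x) = dir u v"
    unfolding eq dir_def ip_def by (intro Bochner_Integration.integral_sum i)
qed

lemma pot_integrable: "u \<in> L2 \<Omega> \<Longrightarrow> v \<in> L2 \<Omega> \<Longrightarrow> integrable (lebesgue_on \<Omega>) (\<lambda>x. V x * u x * v x)"
  by (intro L2_integrable_mult V_mult_L2)

text \<open>Common source of two functionals: \<open>c = 1/2\<close>, \<open>d = \<beta>/4\<close>
  gives the energy, \<open>c = 1\<close>, \<open>d = \<beta>\<close> the numerator of
  \<open>mu\<close>.\<close>

lemma weighted_energy:
  assumes v: "v \<in> H01 \<Omega>"
  shows "(LINT x|lebesgue_on \<Omega>. c * (norm (weak_grad \<Omega> v x))\<^sup>2 + c * V x * \<bar>v x\<bar>\<^sup>2 + d * \<bar>v x\<bar>^4) =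
    c * A v v + d * quad v v v v"
proof -
  have i: "integrable (lebesgue_on \<Omega>) (\<lambda>x. weak_grad \<Omega> v x \<bullet> weak_grad \<Omega> v x)"
    "integrable (lebesgue_on \<Omega>) (\<lambda>x. V x * v x * v x)"
    "integrable (lebesgue_on \<Omega>) (\<lambda>x. (v x * v x) * (v x * v x))"
    by (intro integral_weak_grad pot_integrable quad_integrable H01_H1 H01_L2 v)+
  have "(LINT x|lebesgue_on \<Omega>. c * (norm (weak_grad \<Omega> v x))\<^sup>2 + c * V x * \<bar>v x\<bar>\<^sup>2 + d * \<bar>v x\<bar>^4) =
    (LINT x|lebesgue_on \<Omega>. c * (weak_grad \<Omega> v x \<bullet> weak_grad \<Omega> v x) + c * (V x * v x * v x) + d * ((v x * v x) * (v x * v x)))"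
    by (intro Bochner_Integration.integral_cong refl) (simp add: dot_square_norm power2_eq_square power4_eq_xxxx mult_ac)
  also have "\<dots> = c * dir v v + c * pot v v + d * quad v v v v"
    using i by (simp add: integral_weak_grad(2)[OF H01_H1[OF v] H01_H1[OF v]] pot_def quad_def ip_def)
  finally show ?thesis by (simp add: A_def algebra_simps)
qed

lemma energy_eq: "v \<in> H01 \<Omega> \<Longrightarrow> energy \<Omega> V \<beta> v = A v v / 2 + \<beta> / 4 * quad v v v v"
  unfolding energy_def by (subst weighted_energy) auto

lemma mu_eq: "v \<in> H01 \<Omega> \<Longrightarrow> mu \<Omega> V \<beta> v = (A v v + \<beta> * quad v v v v) / (L2_norm \<Omega> v)\<^sup>2"
  unfolding mu_def using weighted_energy[of v 1 \<beta>] by simp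

lemma solves_eigenproblem_iff:
  assumes g: "g \<in> H01 \<Omega>"
  shows "solves_eigenproblem \<Omega> (\<lambda>x. V x + \<beta> * \<bar>g x\<bar>\<^sup>2) u \<nu> \<longleftrightarrow>
    u \<in> H01 \<Omega> \<and> (\<forall>v\<in>H01 \<Omega>. A u v + \<beta> * quad g g u v = \<nu> * ip \<Omega> u v)"
proof -
  have "(LINT x|lebesgue_on \<Omega>. weak_grad \<Omega> u x \<bullet> weak_grad \<Omega> v x + (V x + \<beta> * \<bar>g x\<bar>\<^sup>2) * u x * v x) =
      A u v + \<beta> * quad g g u v" if u: "u \<in> H01 \<Omega>" and v: "v \<in> H01 \<Omega>" for v
  proof -
    have i: "integrable (lebesgue_on \<Omega>) (\<lambda>x. weak_grad \<Omega> u x \<bullet> weak_grad \<Omega> v x)"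
      "integrable (lebesgue_on \<Omega>) (\<lambda>x. V x * u x * v x)"
      "integrable (lebesgue_on \<Omega>) (\<lambda>x. (g x * g x) * (u x * v x))"
      by (intro integral_weak_grad pot_integrable quad_integrable H01_H1 H01_L2 u v g)+
    have "(LINT x|lebesgue_on \<Omega>. weak_grad \<Omega> u x \<bullet> weak_grad \<Omega> v x + (V x + \<beta> * \<bar>g x\<bar>\<^sup>2) * u x * v x) =
      (LINT x|lebesgue_on \<Omega>. weak_grad \<Omega> u x \<bullet> weak_grad \<Omega> v x + V x * u x * v x + \<beta> * ((g x * g x) * (u x * v x)))"
      by (intro Bochner_Integration.integral_cong refl) (simp add: power2_eq_square algebra_simps)
    also have "\<dots> = dir u v + pot u v + \<beta> * quad g g u v"
      using i by (simp add: integral_weak_grad(2)[OF H01_H1[OF u] H01_H1[OF v]] pot_def quad_def ip_def)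
    finally show ?thesis by (simp add: A_def)
  qed
  then show ?thesis unfolding solves_eigenproblem_def ip_def by auto
qed

end

section \<open>Compactness\<close>

text \<open>Integer index vector of the half-open cube of side \<open>h\<close> that contains
  \<open>x\<close>. The cubes of the grid are the level sets of this map, so that lying in the same
  cube is an equation.\<close>

definition cell :: "real \<Rightarrow> 'a::euclidean_space \<Rightarrow> 'a" where
  "cell h x = (\<Sum>b\<in>Basis. real_of_int \<lfloor>x \<bullet> b / h\<rfloor> *\<^sub>R b)"

lemma cell_inner: "b \<in> Basis \<Longrightarrow> cell h x \<bullet> b = real_of_int \<lfloor>x \<bullet> b / h\<rfloor>"
  by (simp add: cell_def)

lemma cell_measurable[measurable]: "cell h \<in> borel_measurable borel"
  unfolding cell_def[abs_def] by measurable

lemma cell_bounds: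
  assumes "0 < h" "b \<in> Basis"
  shows "h * (cell h x \<bullet> b) \<le> x \<bullet> b" "x \<bullet> b < h * (cell h x \<bullet> b + 1)"
proof -
  have "real_of_int \<lfloor>x \<bullet> b / h\<rfloor> \<le> x \<bullet> b / h" by linarith
  then show "h * (cell h x \<bullet> b) \<le> x \<bullet> b"
    unfolding pos_le_divide_eq[OF assms(1)] cell_inner[OF assms(2)] by (simp only: mult.commute)
  have "x \<bullet> b / h < real_of_int \<lfloor>x \<bullet> b / h\<rfloor> + 1" by linarith
  then show "x \<bullet> b < h * (cell h x \<bullet> b + 1)"
    unfolding pos_divide_less_eq[OF assms(1)] cell_inner[OF assms(2)] by (simp only: mult.commute)
qed

lemma cell_eqD:
  assumes "0 < h" "b \<in> Basis" "cell h x = cell h y" shows "\<bar>(y - x) \<bullet> b\<bar> \<le> h"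
  using cell_bounds[OF assms(1,2), of x] cell_bounds[OF assms(1,2), of y] assms(3)
  by (simp add: inner_diff_left algebra_simps)

lemma finite_cells:
  fixes \<Omega> :: "'a::euclidean_space set"
  assumes "bounded \<Omega>" shows "finite (cell h ` \<Omega>)"
proof -
  obtain R where R: "\<And>x. x \<in> \<Omega> \<Longrightarrow> norm x \<le> R" using assms by (auto simp: bounded_iff)
  define N where "N = \<lceil>R / \<bar>h\<bar>\<rceil> + 1"
  have "cell h ` \<Omega> \<subseteq> (\<lambda>f. \<Sum>b\<in>Basis. real_of_int (f b) *\<^sub>R b) ` (Basis \<rightarrow>\<^sub>E {-N..N})"
  proof
    fix z assume "z \<in> cell h ` \<Omega>"
    then obtain x where x: "x \<in> \<Omega>" "z = cell h x" by auto
    have "\<lfloor>x \<bullet> b / h\<rfloor> \<in> {-N..N}" if "b \<in> Basis" for b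
    proof -
      have "\<bar>x \<bullet> b\<bar> \<le> R" using Basis_le_norm[OF that, of x] R[OF x(1)] by linarith
      then have "\<bar>x \<bullet> b / h\<bar> \<le> R / \<bar>h\<bar>" by (simp add: divide_right_mono)
      then have "- (R / \<bar>h\<bar>) \<le> x \<bullet> b / h" "x \<bullet> b / h \<le> R / \<bar>h\<bar>" by linarith+
      then have "- N \<le> \<lfloor>x \<bullet> b / h\<rfloor>" "\<lfloor>x \<bullet> b / h\<rfloor> \<le> N" unfolding N_def by linarith+
      then show ?thesis by simp
    qed
    then have "(\<lambda>b\<in>Basis. \<lfloor>x \<bullet> b / h\<rfloor>) \<in> Basis \<rightarrow>\<^sub>E {-N..N}" by auto
    moreover have "z = (\<Sum>b\<in>Basis. real_of_int ((\<lambda>b\<in>Basis. \<lfloor>x \<bullet> b / h\<rfloor>) b) *\<^sub>R b)"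
      by (simp add: x(2) cell_def)
    ultimately show "z \<in> (\<lambda>f. \<Sum>b\<in>Basis. real_of_int (f b) *\<^sub>R b) ` (Basis \<rightarrow>\<^sub>E {-N..N})" by blast
  qed
  then show ?thesis by (rule finite_subset) (intro finite_imageI finite_PiE, auto)
qed

text \<open>The half-open cube is squeezed between an open and a closed box of equal volume.\<close>

lemma emeasure_cell:
  fixes x0 :: "'a::euclidean_space"
  assumes h: "0 < h"
  shows "emeasure lborel {x. cell h x = cell h x0} = ennreal (h ^ DIM('a))"
proof (rule antisym)
  let ?a = "h *\<^sub>R cell h x0" and ?b = "h *\<^sub>R (cell h x0 + One)"
  have m: "{x. cell h x = cell h x0} \<in> sets lborel" by measurable
  have p: "(\<Prod>b\<in>Basis. (?b - ?a) \<bullet> b) = h ^ DIM('a)"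
    by (simp add: algebra_simps)
  have le: "?a \<bullet> b \<le> ?b \<bullet> b" if "b \<in> Basis" for b
    using h that by (simp add: inner_add_left)
  have "{x. cell h x = cell h x0} \<subseteq> cbox ?a ?b"
  proof
    fix x assume "x \<in> {x. cell h x = cell h x0}"
    then show "x \<in> cbox ?a ?b"
      using cell_bounds[OF h, of _ x] by (auto simp: mem_box inner_add_left intro: less_imp_le)
  qed
  then have "emeasure lborel {x. cell h x = cell h x0} \<le> emeasure lborel (cbox ?a ?b)"
    by (rule emeasure_mono) simp
  then show "emeasure lborel {x. cell h x = cell h x0} \<le> ennreal (h ^ DIM('a))"
    using emeasure_lborel_cbox[OF le] p by simp
  have "box ?a ?b \<subseteq> {x. cell h x = cell h x0}"
  proof
    fix x assume x: "x \<in> box ?a ?b"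
    have "\<lfloor>x \<bullet> b / h\<rfloor> = \<lfloor>x0 \<bullet> b / h\<rfloor>" if b: "b \<in> Basis" for b
    proof -
      have "h * (cell h x0 \<bullet> b) < x \<bullet> b" "x \<bullet> b < h * (cell h x0 \<bullet> b + 1)"
        using x b by (auto simp: mem_box inner_add_left)
      then have "real_of_int \<lfloor>x0 \<bullet> b / h\<rfloor> < x \<bullet> b / h" "x \<bullet> b / h < real_of_int \<lfloor>x0 \<bullet> b / h\<rfloor> + 1"
        using h by (auto simp: cell_inner[OF b] field_simps)
      then show ?thesis by (intro floor_unique) auto
    qed
    then show "x \<in> {x. cell h x = cell h x0}" by (simp add: cell_def)
  qed
  then have "emeasure lborel (box ?a ?b) \<le> emeasure lborel {x. cell h x = cell h x0}"
    by (rule emeasure_mono) (rule m)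
  then show "ennreal (h ^ DIM('a)) \<le> emeasure lborel {x. cell h x = cell h x0}"
    using emeasure_lborel_box[OF le] p by simp
qed

lemma mult_indicator_square: "(c * indicator S x)\<^sup>2 = c\<^sup>2 * indicator S x" for c :: real
  by (auto simp: indicator_def)

lemma difference_square_integrable:
  fixes \<psi> :: "'a::euclidean_space \<Rightarrow> real"
  assumes \<psi>: "\<psi> \<in> test_functions \<Omega>"
  shows "integrable lborel (\<lambda>x. (\<psi> (x + y) - \<psi> x)\<^sup>2)"
proof -
  obtain B R where B: "0 \<le> B" "\<And>s x. 0 < s \<Longrightarrow> s \<le> 1 \<Longrightarrow>
    \<bar>(\<psi> (x + s *\<^sub>R y) - \<psi> x) / s\<bar> \<le> B * indicator (cball 0 R) x"
    by (rule difference_quotient_test_function[OF \<psi>, of y]) (rule that)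
  have [measurable]: "\<psi> \<in> borel_measurable borel" by (rule integrable_test_function[OF \<psi>])
  show ?thesis
  proof (rule Bochner_Integration.integrable_bound)
    show "integrable lborel (\<lambda>x. B\<^sup>2 * indicator (cball 0 R) x :: real)"
      by (intro integrable_mult_right integrable_real_indicator[OF _ emeasure_lborel_cball_finite]) simp
    have "(\<psi> (x + y) - \<psi> x)\<^sup>2 \<le> B\<^sup>2 * indicator (cball 0 R) x" for x
    proof -
      have "\<bar>\<psi> (x + y) - \<psi> x\<bar>\<^sup>2 \<le> (B * indicator (cball 0 R) x)\<^sup>2"
        using B(2)[of 1 x] by (intro power_mono) auto
      then show ?thesis unfolding mult_indicator_square power2_abs .
    qed
    then show "AE x in lborel. norm ((\<psi> (x + y) - \<psi> x)\<^sup>2) \<le> norm (B\<^sup>2 * indicator (cball 0 R) x :: real)"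
      by (simp add: abs_mult)
  qed measurable
qed

text \<open>
  Writing the difference over \<open>y\<close> as \<open>n\<close> differences over \<open>y/n\<close> bounds its norm by the norm of
  the difference quotient with step \<open>y/n\<close>.
\<close>

lemma translation_estimate:
  fixes \<psi> :: "'a::euclidean_space \<Rightarrow> real"
  assumes \<psi>: "\<psi> \<in> test_functions \<Omega>"
  shows "(LINT x|lborel. (\<psi> (x + y) - \<psi> x)\<^sup>2) \<le> (LINT x|lborel. (frechet_derivative \<psi> (at x) y)\<^sup>2)"
proof -
  obtain B R where B: "0 \<le> B" "\<And>s x. 0 < s \<Longrightarrow> s \<le> 1 \<Longrightarrow>
    \<bar>(\<psi> (x + s *\<^sub>R y) - \<psi> x) / s\<bar> \<le> B * indicator (cball 0 R) x"
    "\<And>x. (\<lambda>n. (\<psi> (x + inverse (real (Suc n)) *\<^sub>R y) - \<psi> x) / inverse (real (Suc n)))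
      \<longlonglongrightarrow> frechet_derivative \<psi> (at x) y"
    by (rule difference_quotient_test_function[OF \<psi>, of y]) (rule that)
  have [measurable]: "\<psi> \<in> borel_measurable borel" by (rule integrable_test_function[OF \<psi>])
  have [measurable]: "(\<lambda>x. frechet_derivative \<psi> (at x) y) \<in> borel_measurable borel"
    by (rule integrable_test_function[OF test_functions_frechet_derivative[OF \<psi>]])
  let ?q = "\<lambda>n x. (\<psi> (x + inverse (real (Suc n)) *\<^sub>R y) - \<psi> x) / inverse (real (Suc n))"
  have lim: "(\<lambda>n. LINT x|lborel. (?q n x)\<^sup>2) \<longlonglongrightarrow> (LINT x|lborel. (frechet_derivative \<psi> (at x) y)\<^sup>2)"
  proof (rule integral_dominated_convergence)
    show "integrable lborel (\<lambda>x. B\<^sup>2 * indicator (cball 0 R) x :: real)"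
      by (intro integrable_mult_right integrable_real_indicator[OF _ emeasure_lborel_cball_finite]) simp
    show "AE x in lborel. (\<lambda>n. (?q n x)\<^sup>2) \<longlonglongrightarrow> (frechet_derivative \<psi> (at x) y)\<^sup>2"
      by (intro AE_I2 tendsto_power B(3))
    have "(?q n x)\<^sup>2 \<le> B\<^sup>2 * indicator (cball 0 R) x" for n x
    proof -
      have "0 < inverse (real (Suc n))" "inverse (real (Suc n)) \<le> 1" by (auto simp: inverse_le_1_iff)
      from B(2)[OF this, of x] have "\<bar>?q n x\<bar>\<^sup>2 \<le> (B * indicator (cball 0 R) x)\<^sup>2"
        by (intro power_mono) auto
      then show ?thesis unfolding mult_indicator_square power2_abs .
    qed
    then show "AE x in lborel. norm ((?q n x)\<^sup>2) \<le> B\<^sup>2 * indicator (cball 0 R) x" for n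
      by (intro AE_I2) (simp only: real_norm_def abs_power2)
  qed measurable
  show ?thesis
  proof (rule LIMSEQ_le_const[OF lim], intro exI allI impI)
    fix n :: nat
    define c where "c = inverse (real (Suc n)) *\<^sub>R y"
    have i: "integrable lborel (\<lambda>x. (\<psi> (x + real k *\<^sub>R c + c) - \<psi> (x + real k *\<^sub>R c))\<^sup>2)" for k
      by (rule lborel_integrable_translate[OF difference_square_integrable[OF \<psi>, of c], of "real k *\<^sub>R c"])
    have tr: "(LINT x|lborel. (\<psi> (x + real k *\<^sub>R c + c) - \<psi> (x + real k *\<^sub>R c))\<^sup>2) =
        (LINT x|lborel. (\<psi> (x + c) - \<psi> x)\<^sup>2)" for k
      by (rule lborel_integral_translate[of "\<lambda>x. (\<psi> (x + c) - \<psi> x)\<^sup>2"]) measurable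
    have "(\<psi> (x + y) - \<psi> x)\<^sup>2 \<le> real (Suc n) * (\<Sum>k<Suc n. (\<psi> (x + real k *\<^sub>R c + c) - \<psi> (x + real k *\<^sub>R c))\<^sup>2)" for x
    proof -
      have "(\<Sum>k<Suc n. \<psi> (x + real (Suc k) *\<^sub>R c) - \<psi> (x + real k *\<^sub>R c)) = \<psi> (x + real (Suc n) *\<^sub>R c) - \<psi> (x + real 0 *\<^sub>R c)"
        by (rule sum_lessThan_telescope)
      also have "\<dots> = \<psi> (x + y) - \<psi> x" by (simp add: c_def del: of_nat_Suc)
      finally have "\<psi> (x + y) - \<psi> x = (\<Sum>k<Suc n. \<psi> (x + real k *\<^sub>R c + c) - \<psi> (x + real k *\<^sub>R c))"
        by (simp add: scaleR_add_left add_ac del: sum.lessThan_Suc)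
      then show ?thesis
        using sum_squared_le_sum_of_squares[of "\<lambda>k. \<psi> (x + real k *\<^sub>R c + c) - \<psi> (x + real k *\<^sub>R c)" "{..<Suc n}"]
        by (simp add: mult.commute del: sum.lessThan_Suc)
    qed
    then have "(LINT x|lborel. (\<psi> (x + y) - \<psi> x)\<^sup>2) \<le>
        (LINT x|lborel. real (Suc n) * (\<Sum>k<Suc n. (\<psi> (x + real k *\<^sub>R c + c) - \<psi> (x + real k *\<^sub>R c))\<^sup>2))"
      by (intro integral_mono integrable_mult_right Bochner_Integration.integrable_sum i
          difference_square_integrable[OF \<psi>])
    also have "\<dots> = real (Suc n) * (\<Sum>k<Suc n. LINT x|lborel. (\<psi> (x + real k *\<^sub>R c + c) - \<psi> (x + real k *\<^sub>R c))\<^sup>2)"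
      using i by (simp add: Bochner_Integration.integral_sum del: sum.lessThan_Suc of_nat_Suc)
    \<comment> \<open>One factor \<open>Suc n\<close> is due to Cauchy-Schwarz for the telescoping
      sum, the other to adding \<open>Suc n\<close> equal integrals. Their product is the squared
      denominator of the difference quotient.\<close>
    also have "\<dots> = (real (Suc n))\<^sup>2 * (LINT x|lborel. (\<psi> (x + c) - \<psi> x)\<^sup>2)"
      unfolding tr by (simp only: sum_constant card_lessThan power2_eq_square mult.assoc)
    also have "\<dots> = (LINT x|lborel. (?q n x)\<^sup>2)"
      by (simp add: c_def power_divide divide_inverse power_mult_distrib mult.commute del: of_nat_Suc
          flip: power_inverse)
    finally show "(LINT x|lborel. (\<psi> (x + y) - \<psi> x)\<^sup>2) \<le> (LINT x|lborel. (?q n x)\<^sup>2)" .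
  qed
qed

lemma frechet_derivative_square_le:
  fixes \<psi> :: "'a::euclidean_space \<Rightarrow> real"
  assumes \<psi>: "\<psi> \<in> test_functions \<Omega>"
  shows "(frechet_derivative \<psi> (at x) y)\<^sup>2 \<le> (norm y)\<^sup>2 * (\<Sum>b\<in>Basis. (frechet_derivative \<psi> (at x) b)\<^sup>2)"
proof -
  let ?f = "frechet_derivative \<psi> (at x)"
  have lin: "linear ?f"
    using has_derivative_linear[OF smooth_on_differentiable[OF test_functions_smooth[OF \<psi>]]] .
  have "?f y = ?f (\<Sum>b\<in>Basis. (y \<bullet> b) *\<^sub>R b)" by (simp add: euclidean_representation)
  also have "\<dots> = (\<Sum>b\<in>Basis. (y \<bullet> b) * ?f b)"
    by (simp add: linear_sum[OF lin] linear_scale[OF lin])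
  finally have "(?f y)\<^sup>2 \<le> (\<Sum>b\<in>Basis. (y \<bullet> b)\<^sup>2) * (\<Sum>b\<in>Basis. (?f b)\<^sup>2)"
    by (simp only: Cauchy_Schwarz_ineq_sum)
  also have "(\<Sum>b\<in>Basis. (y \<bullet> b)\<^sup>2) = (norm y)\<^sup>2"
    unfolding dot_square_norm[symmetric] by (subst euclidean_inner) (simp add: power2_eq_square)
  finally show ?thesis .
qed

context open_domain
begin

lemma dir_test:
  assumes \<psi>: "\<psi> \<in> test_functions \<Omega>"
  shows "dir \<psi> \<psi> = (LINT x|lborel. (\<Sum>b\<in>Basis. (fd b \<psi> x)\<^sup>2))" "integrable lborel (\<lambda>x. (\<Sum>b\<in>Basis. (fd b \<psi> x)\<^sup>2))"
proof -
  have i: "integrable lborel (\<lambda>x. (\<psi> x)\<^sup>2)"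
    unfolding power2_eq_square by (rule integrable_test_function(1)[OF test_functions_mult[OF \<psi> \<psi>]])
  then show i': "integrable lborel (\<lambda>x. (\<Sum>b\<in>Basis. (fd b \<psi> x)\<^sup>2))"
    using Bochner_Integration.integrable_diff[OF h1_test(2)[OF \<psi>] i] by simp
  have "h1 \<psi> \<psi> = (LINT x|lborel. (\<psi> x)\<^sup>2) + (LINT x|lborel. (\<Sum>b\<in>Basis. (fd b \<psi> x)\<^sup>2))"
    unfolding h1_test(1)[OF \<psi>] by (rule Bochner_Integration.integral_add[OF i i'])
  then show "dir \<psi> \<psi> = (LINT x|lborel. (\<Sum>b\<in>Basis. (fd b \<psi> x)\<^sup>2))"
    by (simp add: h1_def ip_test_eq_lborel[OF \<psi> \<psi>] power2_eq_square)
qed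

lemma translation_estimate_dir:
  assumes \<psi>: "\<psi> \<in> test_functions \<Omega>"
  shows "(LINT x|lborel. (\<psi> (x + y) - \<psi> x)\<^sup>2) \<le> (norm y)\<^sup>2 * dir \<psi> \<psi>"
proof -
  have "(LINT x|lborel. (\<psi> (x + y) - \<psi> x)\<^sup>2) \<le> (LINT x|lborel. (fd y \<psi> x)\<^sup>2)"
    by (rule translation_estimate[OF \<psi>])
  also have "\<dots> \<le> (LINT x|lborel. (norm y)\<^sup>2 * (\<Sum>b\<in>Basis. (fd b \<psi> x)\<^sup>2))"
  proof (rule integral_mono)
    show "integrable lborel (\<lambda>x. (fd y \<psi> x)\<^sup>2)"
      unfolding power2_eq_square
      by (rule integrable_test_function(1)[OF test_functions_mult]) (rule test_functions_frechet_derivative[OF \<psi>])+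
  qed (auto intro!: dir_test \<psi> frechet_derivative_square_le[OF \<psi>])
  finally show ?thesis by (simp add: dir_test(1)[OF \<psi>])
qed

end

section \<open>A Poincare inequality on a grid and Rellich's theorem\<close>

context open_domain
begin

text \<open>
  Summing \<open>\<integral>\<integral>\<^sub>Q\<^sub>\<times>\<^sub>Q (\<psi>(x) - \<psi>(y))\<^sup>2 = 2 \<bar>Q\<bar> \<integral>\<^sub>Q \<psi>\<^sup>2 - 2 (\<integral>\<^sub>Q \<psi>)\<^sup>2\<close> over the cells \<open>Q\<close>
  and substituting \<open>y = x + z\<close> reduces the Poincare inequality to the translation estimate.
\<close>

lemma cell_Poincare_test_function:
  assumes \<psi>: "\<psi> \<in> test_functions \<Omega>" and h: "0 < h" and bdd: "bounded \<Omega>"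
  shows "ip \<Omega> \<psi> \<psi> \<le> real DIM('a) * 2 ^ DIM('a) * h\<^sup>2 * dir \<psi> \<psi> +
    (\<Sum>\<kappa>\<in>cell h ` \<Omega>. (LINT x|lborel. \<psi> x * indicator {x. cell h x = \<kappa>} x)\<^sup>2 / h ^ DIM('a))"
proof -
  let ?J = "cell h ` \<Omega>" and ?m = "h ^ DIM('a)"
  define Q where "Q \<kappa> = {x :: 'a. cell h x = \<kappa>}" for \<kappa>
  have J: "finite ?J" by (rule finite_cells[OF bdd])
  have m: "0 < ?m" using h by simp
  have [measurable]: "\<psi> \<in> borel_measurable borel" by (rule integrable_test_function[OF \<psi>])
  have Qm[measurable]: "Q \<kappa> \<in> sets borel" for \<kappa> unfolding Q_def by measurable
  have emQ: "emeasure lborel (Q \<kappa>) = ennreal ?m" if "\<kappa> \<in> ?J" for \<kappa>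
    using that emeasure_cell[OF h] by (auto simp: Q_def)
  have i1: "integrable lborel \<psi>" by (rule integrable_test_function[OF \<psi>])
  have i2: "integrable lborel (\<lambda>x. (\<psi> x)\<^sup>2)"
    unfolding power2_eq_square by (rule integrable_test_function(1)[OF test_functions_mult[OF \<psi> \<psi>]])
  have iQ: "integrable lborel (\<lambda>x. f x * indicator (Q \<kappa>) x)" if "integrable lborel f" for f :: "'a \<Rightarrow> real" and \<kappa>
    by (rule Bochner_Integration.integrable_bound[OF that]) (use that in \<open>auto simp: indicator_def\<close>)
  define I where "I \<kappa> = (LINT x|lborel. \<psi> x * indicator (Q \<kappa>) x)" for \<kappa>
  define S where "S \<kappa> = (LINT x|lborel. (\<psi> x)\<^sup>2 * indicator (Q \<kappa>) x)" for \<kappa>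
  have iI: "integrable lborel (\<lambda>x. \<psi> x * indicator (Q \<kappa>) x)" for \<kappa> by (rule iQ[OF i1])
  have iS: "integrable lborel (\<lambda>x. (\<psi> x)\<^sup>2 * indicator (Q \<kappa>) x)" for \<kappa> by (rule iQ[OF i2])
  have i0: "integrable lborel (\<lambda>x. indicator (Q \<kappa>) x :: real)" "(LINT x|lborel. indicator (Q \<kappa>) x) = ?m"
    if "\<kappa> \<in> ?J" for \<kappa>
    using emQ[OF that] m by (auto simp: measure_def)
  define F where "F x y = ennreal (if cell h x = cell h y \<and> cell h x \<in> ?J then (\<psi> x - \<psi> y)\<^sup>2 else 0)" for x y
  have Jm[measurable]: "?J \<in> sets borel" using J by (intro finite_imp_closed borel_closed)
  have Fm: "(\<lambda>(x, y). F x y) \<in> borel_measurable (lborel \<Otimes>\<^sub>M lborel)"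
    unfolding F_def by measurable
  have cell_term: "(\<integral>\<^sup>+x. \<integral>\<^sup>+y. ennreal ((\<psi> x - \<psi> y)\<^sup>2 * indicator (Q \<kappa>) x * indicator (Q \<kappa>) y) \<partial>lborel \<partial>lborel) =
      ennreal (2 * ?m * S \<kappa> - 2 * (I \<kappa>)\<^sup>2)" if \<kappa>: "\<kappa> \<in> ?J" for \<kappa>
  proof -
    have inner: "(\<integral>\<^sup>+y. ennreal ((\<psi> x - \<psi> y)\<^sup>2 * indicator (Q \<kappa>) x * indicator (Q \<kappa>) y) \<partial>lborel) =
        ennreal (?m * ((\<psi> x)\<^sup>2 * indicator (Q \<kappa>) x) - 2 * I \<kappa> * (\<psi> x * indicator (Q \<kappa>) x) + S \<kappa> * indicator (Q \<kappa>) x)"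
      (is "_ = ennreal ?r") for x
    proof -
      have eq: "(\<lambda>y. (\<psi> x - \<psi> y)\<^sup>2 * indicator (Q \<kappa>) x * indicator (Q \<kappa>) y) =
          (\<lambda>y. (\<psi> x)\<^sup>2 * indicator (Q \<kappa>) x * indicator (Q \<kappa>) y - 2 * \<psi> x * indicator (Q \<kappa>) x * (\<psi> y * indicator (Q \<kappa>) y)
             + indicator (Q \<kappa>) x * ((\<psi> y)\<^sup>2 * indicator (Q \<kappa>) y))"
        by (auto simp: power2_eq_square algebra_simps)
      have i: "integrable lborel (\<lambda>y. (\<psi> x - \<psi> y)\<^sup>2 * indicator (Q \<kappa>) x * indicator (Q \<kappa>) y)"
        unfolding eq using i0[OF \<kappa>] iI iS
        by (intro Bochner_Integration.integrable_add Bochner_Integration.integrable_diff integrable_mult_right)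
      have "(LINT y|lborel. (\<psi> x - \<psi> y)\<^sup>2 * indicator (Q \<kappa>) x * indicator (Q \<kappa>) y) =
          (\<psi> x)\<^sup>2 * indicator (Q \<kappa>) x * ?m - 2 * \<psi> x * indicator (Q \<kappa>) x * I \<kappa> + indicator (Q \<kappa>) x * S \<kappa>"
        unfolding eq I_def S_def
        using i0[OF \<kappa>] iI iS by (subst Bochner_Integration.integral_add;
            (intro Bochner_Integration.integrable_diff integrable_mult_right)?; simp)
      also have "\<dots> = ?r" by (simp add: algebra_simps)
      finally show ?thesis by (subst nn_integral_eq_integral[OF i]) auto
    qed
    \<comment> \<open>Turning the outer \<open>nn_integral\<close> into a Bochner integral requires
      the sign of its integrand. On the cell it is the integral of (\<psi>(x) - \<psi>(y))^2 over y,
      expanded.\<close>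
    have nn: "0 \<le> ?m * ((\<psi> x)\<^sup>2 * indicator (Q \<kappa>) x) - 2 * I \<kappa> * (\<psi> x * indicator (Q \<kappa>) x) + S \<kappa> * indicator (Q \<kappa>) x" for x
    proof -
      have "(\<psi> x * I \<kappa>) * 2 \<le> ?m * (\<psi> x)\<^sup>2 + S \<kappa>"
      proof -
        have "0 \<le> (LINT y|lborel. (\<psi> x - \<psi> y)\<^sup>2 * indicator (Q \<kappa>) y)" by (intro integral_nonneg_AE) auto
        also have "(\<lambda>y. (\<psi> x - \<psi> y)\<^sup>2 * indicator (Q \<kappa>) y) =
          (\<lambda>y. (\<psi> x)\<^sup>2 * indicator (Q \<kappa>) y - 2 * \<psi> x * (\<psi> y * indicator (Q \<kappa>) y) + (\<psi> y)\<^sup>2 * indicator (Q \<kappa>) y)"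
          by (auto simp: power2_eq_square algebra_simps)
        also have "(LINT y|lborel. (\<psi> x)\<^sup>2 * indicator (Q \<kappa>) y - 2 * \<psi> x * (\<psi> y * indicator (Q \<kappa>) y) + (\<psi> y)\<^sup>2 * indicator (Q \<kappa>) y) =
            (\<psi> x)\<^sup>2 * ?m - 2 * \<psi> x * I \<kappa> + S \<kappa>"
          unfolding I_def S_def
          using i0[OF \<kappa>] iI iS by (subst Bochner_Integration.integral_add;
              (intro Bochner_Integration.integrable_diff integrable_mult_right)?; simp)
        finally show ?thesis by (simp add: algebra_simps)
      qed
      then show ?thesis by (simp add: indicator_def algebra_simps)
    qed
    have i: "integrable lborel (\<lambda>x. ?m * ((\<psi> x)\<^sup>2 * indicator (Q \<kappa>) x) - 2 * I \<kappa> * (\<psi> x * indicator (Q \<kappa>) x) + S \<kappa> * indicator (Q \<kappa>) x)"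
      using i0[OF \<kappa>] iI iS
      by (intro Bochner_Integration.integrable_add Bochner_Integration.integrable_diff integrable_mult_right)
    have "(LINT x|lborel. ?m * ((\<psi> x)\<^sup>2 * indicator (Q \<kappa>) x) - 2 * I \<kappa> * (\<psi> x * indicator (Q \<kappa>) x) + S \<kappa> * indicator (Q \<kappa>) x)
        = ?m * S \<kappa> - 2 * I \<kappa> * I \<kappa> + S \<kappa> * ?m"
      using i0[OF \<kappa>] iI iS unfolding I_def[of \<kappa>] S_def[of \<kappa>]
      by (subst Bochner_Integration.integral_add;
            (intro Bochner_Integration.integrable_diff integrable_mult_right)?; simp)
    also have "\<dots> = 2 * ?m * S \<kappa> - 2 * (I \<kappa>)\<^sup>2" by (simp add: power2_eq_square)
    finally show ?thesis
      unfolding inner nn_integral_eq_integral[OF i AE_I2[OF nn]] by (rule arg_cong)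
  qed
  have "(\<Sum>\<kappa>\<in>?J. ennreal (2 * ?m * S \<kappa> - 2 * (I \<kappa>)\<^sup>2)) =
      (\<Sum>\<kappa>\<in>?J. \<integral>\<^sup>+x. \<integral>\<^sup>+y. ennreal ((\<psi> x - \<psi> y)\<^sup>2 * indicator (Q \<kappa>) x * indicator (Q \<kappa>) y) \<partial>lborel \<partial>lborel)"
    by (intro sum.cong refl cell_term[symmetric])
  also have "\<dots> = (\<integral>\<^sup>+x. \<integral>\<^sup>+y. F x y \<partial>lborel \<partial>lborel)"
  proof -
    have "(\<Sum>\<kappa>\<in>?J. ennreal ((\<psi> x - \<psi> y)\<^sup>2 * indicator (Q \<kappa>) x * indicator (Q \<kappa>) y)) = F x y" for x y
    proof -
      have "(\<Sum>\<kappa>\<in>?J. ennreal ((\<psi> x - \<psi> y)\<^sup>2 * indicator (Q \<kappa>) x * indicator (Q \<kappa>) y)) =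
          (\<Sum>\<kappa>\<in>?J. if \<kappa> = cell h x then (if cell h x = cell h y then ennreal ((\<psi> x - \<psi> y)\<^sup>2) else 0) else 0)"
        by (intro sum.cong refl) (auto simp: Q_def indicator_def)
      also have "\<dots> = F x y" by (subst sum.delta[OF J]) (auto simp: F_def)
      finally show ?thesis .
    qed
    then show ?thesis
      by (simp add: nn_integral_sum[symmetric])
  qed
  \<comment> \<open>Points of one cell differ by at most \<open>h\<close> in each coordinate.
    Letting z range over the whole cube of side 2h gives the factor \<open>2 ^ DIM('a)\<close> of
    the statement, and its largest squared norm is \<open>DIM('a) * h\<^sup>2\<close>.\<close>
  also have "\<dots> \<le> (\<integral>\<^sup>+x. \<integral>\<^sup>+z. indicator (cbox (- (h *\<^sub>R One)) (h *\<^sub>R One)) z * ennreal ((\<psi> (x + z) - \<psi> x)\<^sup>2) \<partial>lborel \<partial>lborel)"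
  proof (rule nn_integral_mono)
    fix x :: 'a
    let ?g = "\<lambda>y. indicator (cbox (- (h *\<^sub>R One)) (h *\<^sub>R One)) (y - x) * ennreal ((\<psi> y - \<psi> x)\<^sup>2)"
    have "F x y \<le> ?g y" for y
    proof (cases "cell h x = cell h y \<and> cell h x \<in> ?J")
      case True
      then have "y - x \<in> cbox (- (h *\<^sub>R One)) (h *\<^sub>R One)"
        using cell_eqD[OF h, of _ x y] by (fastforce simp: mem_box abs_le_iff)
      then show ?thesis using True by (simp add: F_def power2_commute)
    next
      case False
      then show ?thesis by (simp only: F_def if_False ennreal_0 zero_le)
    qed
    then have "(\<integral>\<^sup>+y. F x y \<partial>lborel) \<le> (\<integral>\<^sup>+y. ?g y \<partial>lborel)" by (intro nn_integral_mono)
    also have "\<dots> = (\<integral>\<^sup>+y. ?g y \<partial>distr lborel borel ((+) x))" by (simp add: lborel_distr_plus)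
    also have "\<dots> = (\<integral>\<^sup>+z. ?g (x + z) \<partial>lborel)" by (rule nn_integral_distr) measurable
    finally show "(\<integral>\<^sup>+y. F x y \<partial>lborel) \<le>
      (\<integral>\<^sup>+z. indicator (cbox (- (h *\<^sub>R One)) (h *\<^sub>R One)) z * ennreal ((\<psi> (x + z) - \<psi> x)\<^sup>2) \<partial>lborel)" by simp
  qed
  also have "\<dots> = (\<integral>\<^sup>+z. \<integral>\<^sup>+x. indicator (cbox (- (h *\<^sub>R One)) (h *\<^sub>R One)) z * ennreal ((\<psi> (x + z) - \<psi> x)\<^sup>2) \<partial>lborel \<partial>lborel)"
    by (rule lborel_pair.Fubini'[symmetric]) measurable
  also have "\<dots> \<le> (\<integral>\<^sup>+z. indicator (cbox (- (h *\<^sub>R One)) (h *\<^sub>R (One::'a))) z * ennreal (real DIM('a) * h\<^sup>2 * dir \<psi> \<psi>) \<partial>lborel)"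
  proof (rule nn_integral_mono)
    fix z :: 'a
    show "(\<integral>\<^sup>+x. indicator (cbox (- (h *\<^sub>R One)) (h *\<^sub>R One)) z * ennreal ((\<psi> (x + z) - \<psi> x)\<^sup>2) \<partial>lborel) \<le>
        indicator (cbox (- (h *\<^sub>R One)) (h *\<^sub>R One)) z * ennreal (real DIM('a) * h\<^sup>2 * dir \<psi> \<psi>)"
    proof (cases "z \<in> cbox (- (h *\<^sub>R One)) (h *\<^sub>R One)")
      case True
      have "(norm z)\<^sup>2 = (\<Sum>b\<in>Basis. (z \<bullet> b)\<^sup>2)"
        unfolding dot_square_norm[symmetric] by (subst euclidean_inner) (simp add: power2_eq_square)
      also have "\<dots> \<le> (\<Sum>b\<in>(Basis::'a set). h\<^sup>2)"
      proof (intro sum_mono)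
        fix b :: 'a assume b: "b \<in> Basis"
        then have "\<bar>z \<bullet> b\<bar> \<le> h" using True by (auto simp: mem_box abs_le_iff)
        then have "\<bar>z \<bullet> b\<bar>\<^sup>2 \<le> h\<^sup>2" by (intro power_mono) auto
        then show "(z \<bullet> b)\<^sup>2 \<le> h\<^sup>2" by simp
      qed
      finally have z: "(norm z)\<^sup>2 \<le> real DIM('a) * h\<^sup>2" by simp
      have "(\<integral>\<^sup>+x. ennreal ((\<psi> (x + z) - \<psi> x)\<^sup>2) \<partial>lborel) = ennreal (LINT x|lborel. (\<psi> (x + z) - \<psi> x)\<^sup>2)"
        by (rule nn_integral_eq_integral[OF difference_square_integrable[OF \<psi>]]) simp
      also have "\<dots> \<le> ennreal (real DIM('a) * h\<^sup>2 * dir \<psi> \<psi>)"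
        using translation_estimate_dir[OF \<psi>, of z] mult_right_mono[OF z dir.nonneg[OF test_functions_H1[OF \<psi>]]]
        by (intro ennreal_leI) linarith
      finally show ?thesis using True by simp
    qed simp
  qed
  also have "\<dots> = ennreal (real DIM('a) * h\<^sup>2 * dir \<psi> \<psi>) * emeasure lborel (cbox (- (h *\<^sub>R One)) (h *\<^sub>R (One::'a)))"
    by (subst mult.commute) (rule nn_integral_cmult_indicator, simp)
  also have "emeasure lborel (cbox (- (h *\<^sub>R One)) (h *\<^sub>R (One::'a))) = ennreal ((2 * h) ^ DIM('a))"
    using h by (subst emeasure_lborel_cbox) (auto simp: inner_add_left)
  also have "ennreal (real DIM('a) * h\<^sup>2 * dir \<psi> \<psi>) * ennreal ((2 * h) ^ DIM('a)) =
      ennreal (real DIM('a) * h\<^sup>2 * dir \<psi> \<psi> * (2 * h) ^ DIM('a))"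
    using h dir.nonneg[OF test_functions_H1[OF \<psi>]] by (intro ennreal_mult[symmetric]) auto
  finally have le: "(\<Sum>\<kappa>\<in>?J. ennreal (2 * ?m * S \<kappa> - 2 * (I \<kappa>)\<^sup>2)) \<le> ennreal (real DIM('a) * h\<^sup>2 * dir \<psi> \<psi> * (2 * h) ^ DIM('a))" .
  \<comment> \<open>\<open>ennreal\<close> sends negative numbers to 0, so it is exchanged with the
    sum as an inequality, through \<open>max 0\<close>.\<close>
  have "ennreal (\<Sum>\<kappa>\<in>?J. 2 * ?m * S \<kappa> - 2 * (I \<kappa>)\<^sup>2) \<le> (\<Sum>\<kappa>\<in>?J. ennreal (2 * ?m * S \<kappa> - 2 * (I \<kappa>)\<^sup>2))"
  proof -
    have "ennreal (\<Sum>\<kappa>\<in>?J. 2 * ?m * S \<kappa> - 2 * (I \<kappa>)\<^sup>2) \<le> ennreal (\<Sum>\<kappa>\<in>?J. max 0 (2 * ?m * S \<kappa> - 2 * (I \<kappa>)\<^sup>2))"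
      by (intro ennreal_leI sum_mono) simp
    also have "\<dots> = (\<Sum>\<kappa>\<in>?J. ennreal (max 0 (2 * ?m * S \<kappa> - 2 * (I \<kappa>)\<^sup>2)))" by (intro sum_ennreal[symmetric]) simp
    also have "\<dots> = (\<Sum>\<kappa>\<in>?J. ennreal (2 * ?m * S \<kappa> - 2 * (I \<kappa>)\<^sup>2))"
      by (intro sum.cong refl) (metis ennreal_eq_0_iff linorder_linear max.absorb1 max.absorb2 max.cobounded1)
    finally show ?thesis .
  qed
  also note le
  finally have "(\<Sum>\<kappa>\<in>?J. 2 * ?m * S \<kappa> - 2 * (I \<kappa>)\<^sup>2) \<le> real DIM('a) * h\<^sup>2 * dir \<psi> \<psi> * (2 * h) ^ DIM('a)"
    using h dir.nonneg[OF test_functions_H1[OF \<psi>]] by (subst (asm) ennreal_le_iff) auto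
  then have "2 * ?m * (\<Sum>\<kappa>\<in>?J. S \<kappa>) \<le> 2 * (\<Sum>\<kappa>\<in>?J. (I \<kappa>)\<^sup>2) + real DIM('a) * h\<^sup>2 * dir \<psi> \<psi> * 2 ^ DIM('a) * ?m"
  proof -
    have "(\<Sum>\<kappa>\<in>?J. 2 * ?m * S \<kappa> - 2 * (I \<kappa>)\<^sup>2) = 2 * ?m * (\<Sum>\<kappa>\<in>?J. S \<kappa>) - 2 * (\<Sum>\<kappa>\<in>?J. (I \<kappa>)\<^sup>2)"
      by (simp only: sum_subtractf sum_distrib_left)
    moreover assume "(\<Sum>\<kappa>\<in>?J. 2 * ?m * S \<kappa> - 2 * (I \<kappa>)\<^sup>2) \<le> real DIM('a) * h\<^sup>2 * dir \<psi> \<psi> * (2 * h) ^ DIM('a)"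
    ultimately show ?thesis by (simp add: power_mult_distrib mult_ac)
  qed
  moreover have "P \<le> Z / m + K / 2" if "2 * m * P \<le> 2 * Z + K * m" "0 < m" for P Z K m :: real
    using that by (simp add: field_simps)
  ultimately have "(\<Sum>\<kappa>\<in>?J. S \<kappa>) \<le> (\<Sum>\<kappa>\<in>?J. (I \<kappa>)\<^sup>2) / ?m + real DIM('a) * h\<^sup>2 * dir \<psi> \<psi> * 2 ^ DIM('a) / 2"
    using m by blast
  moreover have "0 \<le> real DIM('a) * h\<^sup>2 * dir \<psi> \<psi> * 2 ^ DIM('a)"
    using dir.nonneg[OF test_functions_H1[OF \<psi>]] by simp
  moreover have "(\<Sum>\<kappa>\<in>?J. S \<kappa>) = ip \<Omega> \<psi> \<psi>"
  proof -
    have "(\<Sum>\<kappa>\<in>?J. S \<kappa>) = (LINT x|lborel. (\<Sum>\<kappa>\<in>?J. (\<psi> x)\<^sup>2 * indicator (Q \<kappa>) x))"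
      unfolding S_def by (rule Bochner_Integration.integral_sum[symmetric]) (rule iS)
    also have "(\<lambda>x. \<Sum>\<kappa>\<in>?J. (\<psi> x)\<^sup>2 * indicator (Q \<kappa>) x) = (\<lambda>x. \<psi> x * \<psi> x)"
    proof
      fix x
      have "(\<Sum>\<kappa>\<in>?J. (\<psi> x)\<^sup>2 * indicator (Q \<kappa>) x) = (\<Sum>\<kappa>\<in>?J. if \<kappa> = cell h x then (\<psi> x)\<^sup>2 else 0)"
        by (intro sum.cong refl) (auto simp: Q_def indicator_def)
      also have "\<dots> = \<psi> x * \<psi> x"
        using test_function_outside[OF \<psi>, of x] by (subst sum.delta[OF J]) (auto simp: power2_eq_square)
      finally show "(\<Sum>\<kappa>\<in>?J. (\<psi> x)\<^sup>2 * indicator (Q \<kappa>) x) = \<psi> x * \<psi> x" .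
    qed
    finally show ?thesis by (simp add: ip_test_eq_lborel[OF \<psi> \<psi>])
  qed
  ultimately show ?thesis
    by (simp add: I_def Q_def sum_divide_distrib mult_ac)
qed

lemma indicator_cell_L2:
  fixes h :: real and \<kappa> :: 'a
  assumes "bounded \<Omega>"
  shows "indicator {x. cell h x = \<kappa>} \<in> L2 \<Omega>"
proof -
  have "finite_measure (lebesgue_on \<Omega>)"
    using assms dom_sets by (intro finite_measure_lebesgue_on bounded_set_imp_lmeasurable) auto
  then interpret finite_measure "lebesgue_on \<Omega>" .
  have m: "(indicator {x. cell h x = \<kappa>} :: 'a \<Rightarrow> real) \<in> borel_measurable (lebesgue_on \<Omega>)"
    by (rule measurable_on_domI) measurable
  have "integrable (lebesgue_on \<Omega>) (indicat_real {x. cell h x = \<kappa>})"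
    by (rule integrable_const_bound[of _ 1]) (use m in auto)
  moreover have "(indicat_real {x. cell h x = \<kappa>} x)\<^sup>2 = indicator {x. cell h x = \<kappa>} x" for x
    by (simp add: indicator_def)
  ultimately have "integrable (lebesgue_on \<Omega>) (\<lambda>x. (indicat_real {x. cell h x = \<kappa>} x)\<^sup>2)" by simp
  with m show ?thesis by (simp add: L2_def)
qed

text \<open>Both sides are continuous in the \<open>H1\<close> norm: the bounded domain meets
  finitely many cells, and each indicator lies in \<open>L2\<close>.\<close>

lemma cell_Poincare:
  assumes u: "u \<in> H01 \<Omega>" and h: "0 < h" and bdd: "bounded \<Omega>"
  shows "ip \<Omega> u u \<le> real DIM('a) * 2 ^ DIM('a) * h\<^sup>2 * dir u u +
    (\<Sum>\<kappa>\<in>cell h ` \<Omega>. (ip \<Omega> u (indicator {x. cell h x = \<kappa>}))\<^sup>2 / h ^ DIM('a))"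
proof -
  obtain \<psi> where \<psi>: "\<And>n. \<psi> n \<in> test_functions \<Omega>" "(\<lambda>n. H1.nrm (\<lambda>x. \<psi> n x - u x)) \<longlonglongrightarrow> 0"
    by (rule H01_approx[OF u]) (rule that)
  note uH = H01_H1[OF u] and \<psi>H = test_functions_H1[OF \<psi>(1)]
  have L: "(\<lambda>n. L2.nrm \<Omega> (\<lambda>x. \<psi> n x - u x)) \<longlonglongrightarrow> 0"
    and D: "(\<lambda>n. dir.nrm (\<lambda>x. \<psi> n x - u x)) \<longlonglongrightarrow> 0"
    using \<psi>H uH \<psi>(2) by (intro H1_limit_imp always_eventually allI; simp)+
  have z: "L2.nrm \<Omega> (\<lambda>x. v x - v x) = 0" for v by (simp add: nrm_L2 L2_norm_def)
  have "(\<lambda>n. ip \<Omega> (\<psi> n) (\<psi> n)) \<longlonglongrightarrow> ip \<Omega> u u"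
    using L test_functions_L2[OF \<psi>(1)] H01_L2[OF u] by (intro L2.tendsto_form always_eventually allI)
  moreover have "(\<lambda>n. real DIM('a) * 2 ^ DIM('a) * h\<^sup>2 * dir (\<psi> n) (\<psi> n) +
    (\<Sum>\<kappa>\<in>cell h ` \<Omega>. (ip \<Omega> (\<psi> n) (indicator {x. cell h x = \<kappa>}))\<^sup>2 / h ^ DIM('a))) \<longlonglongrightarrow>
    real DIM('a) * 2 ^ DIM('a) * h\<^sup>2 * dir u u +
    (\<Sum>\<kappa>\<in>cell h ` \<Omega>. (ip \<Omega> u (indicator {x. cell h x = \<kappa>}))\<^sup>2 / h ^ DIM('a))"
  proof (intro tendsto_intros)
    show "(\<lambda>n. dir (\<psi> n) (\<psi> n)) \<longlonglongrightarrow> dir u u"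
      using D \<psi>H uH by (intro dir.tendsto_form always_eventually allI)
    show "(\<lambda>n. ip \<Omega> (\<psi> n) (indicator {x. cell h x = \<kappa>})) \<longlonglongrightarrow> ip \<Omega> u (indicator {x. cell h x = \<kappa>})" for \<kappa>
    proof (rule L2.tendsto_form)
      show "(\<lambda>n. L2.nrm \<Omega> (\<lambda>x. indicator {x. cell h x = \<kappa>} x - indicator {x. cell h x = \<kappa>} x)) \<longlonglongrightarrow> 0"
        unfolding z by (rule tendsto_const)
    qed (use L test_functions_L2[OF \<psi>(1)] H01_L2[OF u] indicator_cell_L2[OF bdd] in auto)
  qed (use h in auto)
  moreover have "ip \<Omega> (\<psi> n) (\<psi> n) \<le> real DIM('a) * 2 ^ DIM('a) * h\<^sup>2 * dir (\<psi> n) (\<psi> n) +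
    (\<Sum>\<kappa>\<in>cell h ` \<Omega>. (ip \<Omega> (\<psi> n) (indicator {x. cell h x = \<kappa>}))\<^sup>2 / h ^ DIM('a))" for n
  proof -
    have "ip \<Omega> (\<psi> n) (indicator {x. cell h x = \<kappa>}) = (LINT x|lborel. \<psi> n x * indicator {x. cell h x = \<kappa>} x)" for \<kappa>
      unfolding ip_def
    proof (rule integral_dom_eq_lborel(1))
      have [measurable]: "\<psi> n \<in> borel_measurable borel" by (rule integrable_test_function[OF \<psi>(1)])
      show "(\<lambda>x. \<psi> n x * indicator {x. cell h x = \<kappa>} x) \<in> borel_measurable borel" by measurable
    qed (simp add: test_function_outside[OF \<psi>(1)])
    then show ?thesis using cell_Poincare_test_function[OF \<psi>(1) h bdd] by simp
  qed
  ultimately show ?thesis by (intro LIMSEQ_le) auto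
qed

text \<open>A diagonal argument makes the integrals over every cell of every grid of width 1/(k+1)
  converge. Applied to differences, \<open>cell_Poincare\<close> bounds the \<open>L2\<close> norm
  by a term small for a fine grid, since the gradients are bounded, and a finite sum small for large
  indices.\<close>

theorem Rellich:
  assumes bdd: "bounded \<Omega>" and u: "\<And>n. u n \<in> H01 \<Omega>" and M: "\<And>n. H1.nrm (u n) \<le> M"
  obtains r :: "nat \<Rightarrow> nat" where "strict_mono r"
    "\<And>e. 0 < e \<Longrightarrow> \<exists>N. \<forall>m\<ge>N. \<forall>n\<ge>N. L2_norm \<Omega> (\<lambda>x. u (r m) x - u (r n) x) < e"
proof -
  define \<Xi> where "\<Xi> = Sigma UNIV (\<lambda>k. cell (inverse (real (Suc k))) ` \<Omega>)"
  define ic where "ic p = (indicat_real {x. cell (inverse (real (Suc (fst p)))) x = snd p})" for p :: "nat \<times> 'a"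
  have icL: "ic p \<in> L2 \<Omega>" for p unfolding ic_def by (rule indicator_cell_L2[OF bdd])
  \<comment> \<open>Dividing by the norm of the indicator gives one bound for all \<open>n\<close>
    and \<open>p\<close>, as the diagonal argument requires; the summand 1 keeps the denominator
    positive.\<close>
  define f where "f n p = ip \<Omega> (u n) (ic p) / (1 + L2_norm \<Omega> (ic p))" for n p
  have pos: "0 < 1 + L2_norm \<Omega> v" for v by (simp add: L2_norm_def add_pos_nonneg)
  have "countable \<Xi>" unfolding \<Xi>_def
    using finite_cells[OF bdd] by (intro countable_SIGMA) (auto intro: countable_finite)
  moreover have "norm (f n p) \<le> M" for n p
  proof -
    have "\<bar>ip \<Omega> (u n) (ic p)\<bar> \<le> L2_norm \<Omega> (u n) * L2_norm \<Omega> (ic p)"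
      using L2.Cauchy_Schwarz[OF H01_L2[OF u] icL] by (simp add: nrm_L2)
    also have "\<dots> \<le> M * (1 + L2_norm \<Omega> (ic p))"
    proof (intro mult_mono)
      show "L2_norm \<Omega> (u n) \<le> M" by (rule order_trans[OF L2_norm_le_H1[OF H01_H1[OF u]] M])
      then show "0 \<le> M" by (rule order_trans[rotated]) (simp add: L2_norm_def)
    qed (auto simp: L2_norm_def)
    finally show ?thesis using pos[of "ic p"] by (simp add: f_def abs_divide pos_divide_le_eq)
  qed
  ultimately obtain r where r: "strict_mono r" "\<And>p. p \<in> \<Xi> \<Longrightarrow> \<exists>l. (\<lambda>n. f (r n) p) \<longlonglongrightarrow> l"
    by (rule function_convergent_subsequence[of \<Xi> f M]) (rule that)
  have conv: "Cauchy (\<lambda>n. ip \<Omega> (u (r n)) (ic p))" if p: "p \<in> \<Xi>" for p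
  proof -
    obtain l where "(\<lambda>n. f (r n) p) \<longlonglongrightarrow> l" using r(2)[OF p] by blast
    then have "(\<lambda>n. f (r n) p * (1 + L2_norm \<Omega> (ic p))) \<longlonglongrightarrow> l * (1 + L2_norm \<Omega> (ic p))"
      by (intro tendsto_intros)
    then have "(\<lambda>n. ip \<Omega> (u (r n)) (ic p)) \<longlonglongrightarrow> l * (1 + L2_norm \<Omega> (ic p))"
      using pos[of "ic p"] by (simp add: f_def)
    then show ?thesis by (rule LIMSEQ_imp_Cauchy)
  qed
  have "\<exists>N. \<forall>m\<ge>N. \<forall>n\<ge>N. L2_norm \<Omega> (\<lambda>x. u (r m) x - u (r n) x) < e" if e: "0 < e" for e
  proof -
    have M0: "0 \<le> M" using H1.nrm_nonneg[OF H01_H1[OF u]] M by (rule order_trans)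
    define C where "C = real DIM('a) * 2 ^ DIM('a) * (2 * M)\<^sup>2"
    have "(\<lambda>k. C * (inverse (real (Suc k)))\<^sup>2) \<longlonglongrightarrow> C * 0\<^sup>2"
      by (intro tendsto_intros LIMSEQ_inverse_real_of_nat)
    then have "\<forall>\<^sub>F k in sequentially. C * (inverse (real (Suc k)))\<^sup>2 < e\<^sup>2 / 2"
      by (rule order_tendstoD(2)) (use e in simp)
    then obtain k where k: "C * (inverse (real (Suc k)))\<^sup>2 < e\<^sup>2 / 2" by (auto simp: eventually_sequentially)
    define h where "h = inverse (real (Suc k))"
    have h: "0 < h" by (simp add: h_def)
    define J where "J = cell h ` \<Omega>"
    have J: "finite J" unfolding J_def by (rule finite_cells[OF bdd])
    \<comment> \<open>Chosen so that the \<open>card J\<close> squared cell integrals, each divided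
      by the cell volume, add up to at most \<open>e\<^sup>2 / 2\<close>. The summand 1 keeps the
      denominator positive when \<open>J\<close> is empty.\<close>
    define d where "d = sqrt (e\<^sup>2 * h ^ DIM('a) / (2 * (real (card J) + 1)))"
    have d: "0 < d" using e h by (simp add: d_def add_pos_nonneg)
    have d2: "d\<^sup>2 = e\<^sup>2 * h ^ DIM('a) / (2 * (real (card J) + 1))"
      unfolding d_def by (subst real_sqrt_pow2) (use e h in \<open>auto simp: less_imp_le\<close>)
    have "\<exists>N. \<forall>m\<ge>N. \<forall>n\<ge>N. \<bar>ip \<Omega> (u (r m)) (ic (k, \<kappa>)) - ip \<Omega> (u (r n)) (ic (k, \<kappa>))\<bar> < d" if "\<kappa> \<in> J" for \<kappa>
      using CauchyD[OF conv d, of "(k, \<kappa>)"] that by (auto simp: \<Xi>_def J_def h_def)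
    then obtain N where N: "\<And>\<kappa> m n. \<kappa> \<in> J \<Longrightarrow> N \<kappa> \<le> m \<Longrightarrow> N \<kappa> \<le> n \<Longrightarrow>
        \<bar>ip \<Omega> (u (r m)) (ic (k, \<kappa>)) - ip \<Omega> (u (r n)) (ic (k, \<kappa>))\<bar> < d" by metis
    show ?thesis
    proof (intro exI allI impI)
      fix m n assume mn: "(\<Sum>\<kappa>\<in>J. N \<kappa>) \<le> m" "(\<Sum>\<kappa>\<in>J. N \<kappa>) \<le> n"
      let ?v = "\<lambda>x. u (r m) x - u (r n) x"
      have v: "?v \<in> H01 \<Omega>" by (intro H01.diff u)
      have "H1.nrm ?v \<le> M + M"
      proof -
        have "H1.nrm ?v \<le> H1.nrm (u (r m)) + H1.nrm (\<lambda>x. (-1) * u (r n) x)"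
          using H1.nrm_triangle[OF H01_H1[OF u[of "r m"]] dir.scale[OF H01_H1[OF u[of "r n"]], of "-1"]] by simp
        then show ?thesis using H1.nrm_scale[OF H01_H1[OF u[of "r n"]], of "-1"] M[of "r m"] M[of "r n"] by simp
      qed
      then have "dir.nrm ?v \<le> 2 * M" using dir_le_H1[OF H01_H1[OF v]] by simp
      then have "(dir.nrm ?v)\<^sup>2 \<le> (2 * M)\<^sup>2" by (rule power_mono) (rule dir.nrm_nonneg[OF H01_H1[OF v]])
      then have dv: "dir ?v ?v \<le> (2 * M)\<^sup>2" by (simp add: dir.nrm_square[OF H01_H1[OF v]])
      have "(ip \<Omega> ?v (indicator {x. cell h x = \<kappa>}))\<^sup>2 / h ^ DIM('a) \<le> e\<^sup>2 / (2 * (real (card J) + 1))" if \<kappa>: "\<kappa> \<in> J" for \<kappa>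
      proof -
        have "N \<kappa> \<le> (\<Sum>\<kappa>\<in>J. N \<kappa>)" by (rule member_le_sum[OF \<kappa> _ J]) simp
        then have "\<bar>ip \<Omega> (u (r m)) (ic (k, \<kappa>)) - ip \<Omega> (u (r n)) (ic (k, \<kappa>))\<bar> < d" using N[OF \<kappa>] mn by simp
        then have "\<bar>ip \<Omega> ?v (ic (k, \<kappa>))\<bar> \<le> d"
          by (simp add: L2.diff_left[OF H01_L2[OF u] H01_L2[OF u] icL])
        then have "\<bar>ip \<Omega> ?v (ic (k, \<kappa>))\<bar>\<^sup>2 \<le> d\<^sup>2" by (rule power_mono) simp
        moreover have "ic (k, \<kappa>) = indicator {x. cell h x = \<kappa>}" by (simp add: ic_def h_def)
        ultimately show ?thesis using h unfolding d2 by (simp add: pos_divide_le_eq)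
      qed
      then have "(\<Sum>\<kappa>\<in>J. (ip \<Omega> ?v (indicator {x. cell h x = \<kappa>}))\<^sup>2 / h ^ DIM('a)) \<le> real (card J) * (e\<^sup>2 / (2 * (real (card J) + 1)))"
        by (rule sum_bounded_above)
      also have "\<dots> \<le> e\<^sup>2 / 2" by (simp add: field_simps)
      finally have "ip \<Omega> ?v ?v \<le> real DIM('a) * 2 ^ DIM('a) * h\<^sup>2 * dir ?v ?v + e\<^sup>2 / 2"
        using cell_Poincare[OF v h bdd] unfolding J_def by linarith
      also have "real DIM('a) * 2 ^ DIM('a) * h\<^sup>2 * dir ?v ?v \<le> real DIM('a) * 2 ^ DIM('a) * h\<^sup>2 * (2 * M)\<^sup>2"
        by (intro mult_left_mono dv) simp
      also have "\<dots> = C * h\<^sup>2" by (simp add: C_def)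
      finally have "ip \<Omega> ?v ?v < e\<^sup>2" using k unfolding h_def by linarith
      then have "sqrt (ip \<Omega> ?v ?v) < sqrt (e\<^sup>2)" by (rule real_sqrt_less_mono)
      then show "L2_norm \<Omega> ?v < e" using e by (simp add: L2.nrm_def flip: nrm_L2)
    qed
  qed
  with r(1) show thesis using that by blast
qed

end

section \<open>The ground state and the spectral gap\<close>

context open_domain3
begin

lemma quad_cube_lincomb:
  fixes c :: real
  assumes u: "u \<in> H01 \<Omega>" and v: "v \<in> H01 \<Omega>" and w: "w \<in> H01 \<Omega>"
  defines "z \<equiv> \<lambda>x. u x + c * v x"
  shows "quad z z z w = quad u u u w + 3 * c * quad u u v w + 3 * c\<^sup>2 * quad u v v w + c^3 * quad v v v w"
proof -
  have z: "z \<in> H01 \<Omega>" unfolding z_def by (rule H01.lin[OF u v])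
  have l: "quad z p q r = quad u p q r + c * quad v p q r" if "p \<in> H01 \<Omega>" "q \<in> H01 \<Omega>" "r \<in> H01 \<Omega>" for p q r
    unfolding z_def by (rule quad_lin[OF u v that])
  have sw: "quad p q r t = quad r q p t" "quad p q r t = quad q p r t" for p q r t
    by (simp_all add: quad_def ip_def mult_ac)
  have "quad z z z w = quad u z z w + c * quad v z z w" by (rule l[OF z z w])
  moreover have "quad u z z w = quad u u z w + c * quad v u z w" by (rule trans[OF sw(2)[of u z z w] l[OF u z w]])
  moreover have "quad v z z w = quad u v z w + c * quad v v z w" by (rule trans[OF sw(2)[of v z z w] l[OF v z w]])
  moreover have "quad u u z w = quad u u u w + c * quad v u u w" by (rule trans[OF sw(1)[of u u z w] l[OF u u w]])
  moreover have "quad v u z w = quad u u v w + c * quad v u v w" by (rule trans[OF sw(1)[of v u z w] l[OF u v w]])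
  moreover have "quad u v z w = quad u v u w + c * quad v v u w" by (rule trans[OF sw(1)[of u v z w] l[OF v u w]])
  moreover have "quad v v z w = quad u v v w + c * quad v v v w" by (rule trans[OF sw(1)[of v v z w] l[OF v v w]])
  moreover have "quad v u u w = quad u u v w" "quad u v u w = quad u u v w" "quad v u v w = quad u v v w" "quad v v u w = quad u v v w"
    by (simp_all add: quad_def ip_def mult_ac)
  ultimately show ?thesis by (simp add: algebra_simps power2_eq_square power3_eq_cube)
qed

lemma quad_power4_lincomb:
  fixes c :: real
  assumes u: "u \<in> H01 \<Omega>" and v: "v \<in> H01 \<Omega>"
  defines "z \<equiv> \<lambda>x. u x + c * v x"
  shows "quad z z z z = quad u u u u + 4 * c * quad u u u v + 6 * c\<^sup>2 * quad u u v v + 4 * c^3 * quad u v v v + c^4 * quad v v v v"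
proof -
  have z: "z \<in> H01 \<Omega>" unfolding z_def by (rule H01.lin[OF u v])
  have l: "quad p q r z = quad p q r u + c * quad p q r v" if "p \<in> H01 \<Omega>" "q \<in> H01 \<Omega>" "r \<in> H01 \<Omega>" for p q r
  proof -
    have "quad p q r s = quad s p q r" for s by (simp add: quad_def ip_def mult_ac)
    then show ?thesis unfolding z_def using quad_lin[OF u v that, of c] by simp
  qed
  have "quad z z z z = quad z z z u + c * quad z z z v" by (rule l[OF z z z])
  also have "quad z z z u = quad u u u u + 3 * c * quad u u v u + 3 * c\<^sup>2 * quad u v v u + c^3 * quad v v v u"
    unfolding z_def by (rule quad_cube_lincomb[OF u v u])
  also have "quad z z z v = quad u u u v + 3 * c * quad u u v v + 3 * c\<^sup>2 * quad u v v v + c^3 * quad v v v v"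
    unfolding z_def by (rule quad_cube_lincomb[OF u v v])
  finally have "quad z z z z = quad u u u u + 3 * c * quad u u v u + 3 * c\<^sup>2 * quad u v v u + c^3 * quad v v v u +
      c * (quad u u u v + 3 * c * quad u u v v + 3 * c\<^sup>2 * quad u v v v + c^3 * quad v v v v)" .
  moreover have "quad u u v u = quad u u u v" "quad u v v u = quad u u v v" "quad v v v u = quad u v v v"
    by (simp_all add: quad_def ip_def mult_ac)
  ultimately show ?thesis by (simp add: algebra_simps power2_eq_square power3_eq_cube power4_eq_xxxx)
qed

lemma quad_scale:
  "quad (\<lambda>x. c * u x) (\<lambda>x. c * u x) (\<lambda>x. c * u x) (\<lambda>x. c * u x) = c^4 * quad u u u u"
proof -
  have "quad (\<lambda>x. c * u x) (\<lambda>x. c * u x) (\<lambda>x. c * u x) (\<lambda>x. c * u x) =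
      (LINT x|lebesgue_on \<Omega>. c^4 * (u x * u x * (u x * u x)))"
    by (simp add: quad_def ip_def power4_eq_xxxx mult_ac)
  then show ?thesis by (simp add: quad_def ip_def)
qed

end

section \<open>Variational properties of the ground state\<close>

locale gp_ground_state = gp_problem \<Omega> V \<beta> for \<Omega> V \<beta> +
  fixes g :: "real^3 \<Rightarrow> real"
  assumes bounded_dom: "bounded \<Omega>" and ground_state: "is_ground_state \<Omega> V \<beta> g"
begin

lemma g: "g \<in> H01 \<Omega>" using ground_state by (simp add: is_ground_state_def)

lemma ip_g: "ip \<Omega> g g = 1"
  using ground_state L2.nrm_square[OF H01_L2[OF g]] by (simp add: is_ground_state_def nrm_L2)

definition lam :: real where "lam = A g g + \<beta> * quad g g g g"

lemma mu_g: "mu \<Omega> V \<beta> g = lam"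
  using ground_state by (simp add: mu_eq[OF g] lam_def is_ground_state_def)

lemma energy_minimal:
  assumes "v \<in> H01 \<Omega>" "ip \<Omega> v v = 1" shows "energy \<Omega> V \<beta> g \<le> energy \<Omega> V \<beta> v"
  using ground_state assms by (auto simp: is_ground_state_def L2.nrm_def simp flip: nrm_L2)

text \<open>The nonlinearity is frozen at \<open>g\<close>: the coefficient is
  \<open>\<beta>\<close> as in the eigenvalue problem for \<open>lambda_2\<close>, not
  \<open>3 * \<beta>\<close> as in the second variation of the energy. The missing
  \<open>2 * \<beta>\<close> reappears with a favourable sign in \<open>ip_deriv_w\<close>.\<close>

definition a :: "(real^3 \<Rightarrow> real) \<Rightarrow> (real^3 \<Rightarrow> real) \<Rightarrow> real" where
  "a u v = A u v + \<beta> * quad g g u v"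

text \<open>Rescaling to the unit sphere and multiplying by the fourth power of the
  \<open>L2\<close> norm removes both the constraint and the denominators. What remains is
  polynomial in \<open>z\<close>, so that unconstrained variations are possible.\<close>

lemma homogeneous_energy_nonneg:
  assumes z: "z \<in> H01 \<Omega>"
  shows "0 \<le> A z z * ip \<Omega> z z / 2 + \<beta> / 4 * quad z z z z - energy \<Omega> V \<beta> g * (ip \<Omega> z z)\<^sup>2"
proof (cases "ip \<Omega> z z = 0")
  case True
  then show ?thesis using \<beta>_nonneg quad_square_nonneg by simp
next
  case False
  define N where "N = ip \<Omega> z z"
  have N: "0 < N" using False L2.nonneg[OF H01_L2[OF z]] by (simp add: N_def)
  let ?c = "1 / sqrt N"
  let ?v = "\<lambda>x. ?c * z x"
  have c: "?c\<^sup>2 = 1 / N" "?c^4 = 1 / N\<^sup>2"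
    using N by (simp_all add: power_divide) (simp add: power4_eq_xxxx power2_eq_square)
  have v: "?v \<in> H01 \<Omega>" by (rule H01.scale[OF z])
  have "ip \<Omega> ?v ?v = ?c\<^sup>2 * N"
    unfolding N_def using L2.scale_left[OF H01_L2[OF z] H01_L2[OF v], of ?c] L2.scale_right[OF H01_L2[OF z] H01_L2[OF z], of ?c]
    by (simp add: N_def power2_eq_square)
  then have "ip \<Omega> ?v ?v = 1" using N c by simp
  then have "energy \<Omega> V \<beta> g \<le> energy \<Omega> V \<beta> ?v" by (rule energy_minimal[OF v])
  also have "\<dots> = ?c\<^sup>2 * A z z / 2 + \<beta> / 4 * (?c^4 * quad z z z z)"
    using A.scale_left[OF z v, of ?c] A.scale_right[OF z z, of ?c]
    by (simp only: energy_eq[OF v] quad_scale power2_eq_square mult.assoc)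
  also have "\<dots> = A z z / (2 * N) + \<beta> / 4 * quad z z z z / N\<^sup>2" unfolding c by simp
  finally have "energy \<Omega> V \<beta> g * N\<^sup>2 \<le> (A z z / (2 * N) + \<beta> / 4 * quad z z z z / N\<^sup>2) * N\<^sup>2"
    using N by (intro mult_right_mono) auto
  also have "\<dots> = A z z * N / 2 + \<beta> / 4 * quad z z z z"
    using N by (simp add: field_simps power2_eq_square)
  finally show ?thesis by (simp add: N_def)
qed

text \<open>
  The homogeneous form of the minimality of \<open>g\<close> is polynomial in \<open>s\<close> along \<open>g + s v\<close>,
  and vanishes at \<open>s = 0\<close>.
\<close>

lemma Euler_Lagrange:
  assumes v: "v \<in> H01 \<Omega>"
  shows "a g v = lam * ip \<Omega> g v"
proof -
  define E where "E = energy \<Omega> V \<beta> g"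
  have E: "4 * E = 2 * A g g + \<beta> * quad g g g g" by (simp add: E_def energy_eq[OF g])
  define P where "P s = (A g g + 2 * s * A g v + s\<^sup>2 * A v v) * (1 + 2 * s * ip \<Omega> g v + s\<^sup>2 * ip \<Omega> v v) / 2 +
    \<beta> / 4 * (quad g g g g + 4 * s * quad g g g v + 6 * s\<^sup>2 * quad g g v v + 4 * s^3 * quad g v v v + s^4 * quad v v v v)
    - E * (1 + 2 * s * ip \<Omega> g v + s\<^sup>2 * ip \<Omega> v v)\<^sup>2" for s
  have min: "P 0 \<le> P s" for s
  proof -
    have "P 0 = 0" using E by (simp add: P_def field_simps)
    moreover have "0 \<le> P s"
      using homogeneous_energy_nonneg[OF H01.lin[OF g v, of s]]
      unfolding A.square_lincomb[OF g v] L2.square_lincomb[OF H01_L2[OF g] H01_L2[OF v]] quad_power4_lincomb[OF g v] ip_g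
      by (simp add: P_def E_def)
    ultimately show ?thesis by simp
  qed
  have "(P has_real_derivative (A g v + A g g * ip \<Omega> g v + \<beta> * quad g g g v - 4 * E * ip \<Omega> g v)) (at 0)"
    unfolding P_def[abs_def] by (auto intro!: derivative_eq_intros simp: algebra_simps)
  then have "A g v + A g g * ip \<Omega> g v + \<beta> * quad g g g v - 4 * E * ip \<Omega> g v = 0"
    by (rule DERIV_local_min[of P _ 0 1]) (use min in auto)
  \<comment> \<open>The multiplier comes out as \<open>4 * E - A g g\<close>, which is
    \<open>lam\<close>.\<close>
  then show ?thesis unfolding E by (simp add: a_def lam_def algebra_simps)
qed

sublocale a: pre_inner "H01 \<Omega>" a
proof unfold_locales
  show "(\<lambda>x. 0) \<in> H01 \<Omega>" by (rule H01.zero)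
  fix u v w :: "real^3 \<Rightarrow> real" and c :: real
  assume u: "u \<in> H01 \<Omega>"
  show "0 \<le> a u u"
    unfolding a_def by (intro add_nonneg_nonneg mult_nonneg_nonneg A.nonneg u \<beta>_nonneg quad_square_nonneg)
  assume v: "v \<in> H01 \<Omega>"
  show "(\<lambda>x. u x + c * v x) \<in> H01 \<Omega>" by (rule H01.lin[OF u v])
  show "a u v = a v u" by (simp only: a_def A.sym[OF u v] quad_commute(3)[of g g u v])
  assume w: "w \<in> H01 \<Omega>"
  have "quad g g p w = quad p g g w" for p by (simp add: quad_def ip_def mult_ac)
  then have "quad g g (\<lambda>x. u x + c * v x) w = quad g g u w + c * quad g g v w"
    using quad_lin[OF u v g g w, of c] by simp
  then show "a (\<lambda>x. u x + c * v x) w = a u w + c * a v w"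
    by (simp add: a_def A.lin_left[OF u v w] algebra_simps)
qed

lemma a_bounds:
  assumes u: "u \<in> H01 \<Omega>"
  shows "dir u u \<le> a u u" "a u u \<le> (1 + V_bound + 4 * \<beta> * (H1.nrm g)\<^sup>2) * h1 u u"
proof -
  have q: "0 \<le> \<beta> * quad g g u u" by (intro mult_nonneg_nonneg \<beta>_nonneg quad_square_nonneg)
  then show "dir u u \<le> a u u" using A_bounds(1)[OF u] by (simp add: a_def)
  have "quad g g u u \<le> 4 * ((H1.nrm g)\<^sup>2 * h1 u u)"
    using quad_bound[OF g g u u] H1.nrm_square[OF H01_H1[OF u]] by (simp add: power2_eq_square mult.assoc)
  then have "\<beta> * quad g g u u \<le> \<beta> * (4 * ((H1.nrm g)\<^sup>2 * h1 u u))" by (intro mult_left_mono \<beta>_nonneg)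
  then show "a u u \<le> (1 + V_bound + 4 * \<beta> * (H1.nrm g)\<^sup>2) * h1 u u"
    using A_bounds(2)[OF u] by (simp add: a_def algebra_simps)
qed

lemma tendsto_nrm_if_H1:
  assumes "\<And>n. u n \<in> H01 \<Omega>" "v \<in> H01 \<Omega>" "(\<lambda>n. H1.nrm (\<lambda>x. u n x - v x)) \<longlonglongrightarrow> 0"
  shows "(\<lambda>n. L2.nrm \<Omega> (\<lambda>x. u n x - v x)) \<longlonglongrightarrow> 0" "(\<lambda>n. a.nrm (\<lambda>x. u n x - v x)) \<longlonglongrightarrow> 0"
proof -
  note d = H01.diff[OF assms(1,2)]
  show "(\<lambda>n. L2.nrm \<Omega> (\<lambda>x. u n x - v x)) \<longlonglongrightarrow> 0"
    using assms by (intro H1_limit_imp(1) always_eventually allI H01_H1)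
  define C where "C = 1 + V_bound + 4 * \<beta> * (H1.nrm g)\<^sup>2"
  let ?C = "sqrt C"
  have "(\<lambda>n. ?C * H1.nrm (\<lambda>x. u n x - v x)) \<longlonglongrightarrow> ?C * 0" by (intro tendsto_intros assms)
  then have l: "(\<lambda>n. ?C * H1.nrm (\<lambda>x. u n x - v x)) \<longlonglongrightarrow> 0" by simp
  show "(\<lambda>n. a.nrm (\<lambda>x. u n x - v x)) \<longlonglongrightarrow> 0"
  proof (rule Lim_null_comparison[OF _ l])
    have "a.nrm (\<lambda>x. u n x - v x) \<le> ?C * H1.nrm (\<lambda>x. u n x - v x)" for n
      using real_sqrt_le_mono[OF a_bounds(2)[OF d[of n]]]
      by (simp add: a.nrm_def H1.nrm_def real_sqrt_mult C_def)
    then show "\<forall>\<^sub>F n in sequentially. norm (a.nrm (\<lambda>x. u n x - v x)) \<le> ?C * H1.nrm (\<lambda>x. u n x - v x)"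
      using a.nrm_nonneg[OF d] by simp
  qed
qed

section \<open>The orthogonal complement of the ground state and the spectral gap\<close>

definition perp :: "(real^3 \<Rightarrow> real) set" where
  "perp = {w \<in> H01 \<Omega>. ip \<Omega> g w = 0}"

lemma perpD: "w \<in> perp \<Longrightarrow> w \<in> H01 \<Omega>" "w \<in> perp \<Longrightarrow> ip \<Omega> g w = 0"
  by (auto simp: perp_def)

lemma perp_lin: "u \<in> perp \<Longrightarrow> v \<in> perp \<Longrightarrow> (\<lambda>x. u x + c * v x) \<in> perp"
  using g by (auto simp: perp_def H01.lin L2.lin_right H01_L2)

lemma perp_zero: "(\<lambda>x. 0) \<in> perp"
  using H01.zero by (simp add: perp_def ip_def)

text \<open>
  Compactness makes a minimizing sequence of \<open>a\<close> on the unit sphere of \<open>perp\<close> converge in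
  \<open>L\<^sup>2\<close>, and the parallelogram law upgrades this to convergence in the energy norm.
\<close>

lemma minimizer_exists:
  assumes ne: "\<exists>w\<in>perp. ip \<Omega> w w = 1"
  obtains w where "w \<in> perp" "ip \<Omega> w w = 1" "\<And>v. v \<in> perp \<Longrightarrow> a w w * ip \<Omega> v v \<le> a v v"
proof -
  define X where "X = {a w w |w. w \<in> perp \<and> ip \<Omega> w w = 1}"
  define m where "m = Inf X"
  have X: "X \<noteq> {}" "bdd_below X"
    using ne by (auto simp: X_def intro!: bdd_belowI[of _ 0] a.nonneg perpD)
  have m0: "0 \<le> m" unfolding m_def by (rule cInf_greatest[OF X(1)]) (auto simp: X_def intro!: a.nonneg perpD)
  have le: "m * ip \<Omega> v v \<le> a v v" if v: "v \<in> perp" for v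
  proof (cases "ip \<Omega> v v = 0")
    case True
    then show ?thesis using a.nonneg[OF perpD(1)[OF v]] by simp
  next
    case False
    note vH = perpD(1)[OF v]
    define N where "N = ip \<Omega> v v"
    have N: "0 < N" using False L2.nonneg[OF H01_L2[OF vH]] by (simp add: N_def)
    let ?c = "1 / sqrt N"
    let ?z = "\<lambda>x. ?c * v x"
    have c: "?c * ?c = 1 / N" using N by simp
    have z: "?z \<in> perp" using perp_lin[OF perp_zero v, of ?c] by simp
    have "ip \<Omega> ?z ?z = ?c * ?c * N" "a ?z ?z = ?c * ?c * a v v"
      using L2.scale_left[OF H01_L2[OF vH] H01_L2[OF perpD(1)[OF z]], of ?c] L2.scale_right[OF H01_L2[OF vH] H01_L2[OF vH], of ?c]
        a.scale_left[OF vH perpD(1)[OF z], of ?c] a.scale_right[OF vH vH, of ?c]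
      by (simp_all only: N_def mult.assoc)
    then have "a v v / N \<in> X" using z N c by (force simp: X_def)
    then have "m \<le> a v v / N" unfolding m_def by (rule cInf_lower[OF _ X(2)])
    then show ?thesis using N by (simp add: N_def pos_le_divide_eq)
  qed
  have "\<exists>w\<in>perp. ip \<Omega> w w = 1 \<and> a w w < m + inverse (real (Suc n))" for n
  proof -
    have "Inf X < m + inverse (real (Suc n))" by (simp add: m_def)
    then show ?thesis using cInf_lessD[OF X(1)] by (force simp: X_def)
  qed
  then obtain w where w: "\<And>n. w n \<in> perp" "\<And>n. ip \<Omega> (w n) (w n) = 1" "\<And>n. a (w n) (w n) < m + inverse (real (Suc n))"
    by metis
  note wH = perpD(1)[OF w(1)]
  have "H1.nrm (w n) \<le> sqrt (m + 2)" for n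
  proof -
    \<comment> \<open>The bound \<open>m + 2\<close> consists of 1 for the \<open>L2\<close> norm,
      \<open>m\<close> for the infimum and at most 1 for the excess over it.\<close>
    have "inverse (real (Suc n)) \<le> 1" by (simp add: inverse_le_1_iff)
    then have "h1 (w n) (w n) \<le> m + 2"
      using w(2,3)[of n] a_bounds(1)[OF wH[of n]] by (simp add: h1_def)
    then show ?thesis unfolding H1.nrm_def by (rule real_sqrt_le_mono)
  qed
  then obtain r :: "nat \<Rightarrow> nat" where r: "strict_mono r"
    "\<And>e. 0 < e \<Longrightarrow> \<exists>N. \<forall>i\<ge>N. \<forall>j\<ge>N. L2_norm \<Omega> (\<lambda>x. w (r i) x - w (r j) x) < e"
    by (rule Rellich[OF bounded_dom wH]) (rule that)
  have Cauchy: "\<exists>N. \<forall>i\<ge>N. \<forall>j\<ge>N. H1.nrm (\<lambda>x. w (r i) x - w (r j) x) < e" if e: "0 < e" for e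
  proof -
    \<comment> \<open>Solves \<open>(1 + m) * d\<^sup>2 = e\<^sup>2 / 2\<close>, the share of the
      \<open>L2\<close> distance in the final estimate.\<close>
    define d where "d = sqrt (e\<^sup>2 / (2 * (1 + m)))"
    have d: "0 < d" "d\<^sup>2 = e\<^sup>2 / (2 * (1 + m))" using e m0 by (auto simp: d_def add_pos_nonneg)
    obtain N1 where N1: "\<And>i j. N1 \<le> i \<Longrightarrow> N1 \<le> j \<Longrightarrow> L2_norm \<Omega> (\<lambda>x. w (r i) x - w (r j) x) < d"
      using r(2)[OF d(1)] by blast
    have "\<forall>\<^sub>F n in sequentially. inverse (real (Suc n)) < e\<^sup>2 / 8"
      by (rule order_tendstoD(2)[OF LIMSEQ_inverse_real_of_nat]) (use e in simp)
    then obtain N2 where N2: "\<And>n. N2 \<le> n \<Longrightarrow> inverse (real (Suc n)) < e\<^sup>2 / 8"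
      by (auto simp: eventually_sequentially)
    show ?thesis
    proof (intro exI allI impI)
      fix i j assume ij: "max N1 N2 \<le> i" "max N1 N2 \<le> j"
      let ?u = "w (r i)" and ?v = "w (r j)"
      let ?d = "\<lambda>x. ?u x - ?v x" and ?s = "\<lambda>x. ?u x + ?v x"
      note uv = wH[of "r i"] wH[of "r j"] and uvL = H01_L2[OF wH[of "r i"]] H01_L2[OF wH[of "r j"]]
      have dH: "?d \<in> H01 \<Omega>" by (rule H01.diff[OF uv])
      have s: "?s \<in> perp" using perp_lin[OF w(1)[of "r i"] w(1)[of "r j"], of 1] by simp
      \<comment> \<open>The parallelogram law in both forms: minimality applied to the sum gives
        \<open>a ?s ?s \<ge> m * (4 - ip \<Omega> ?d ?d)\<close>. The 4m cancels against the nearly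
        minimal values at \<open>?u\<close> and \<open>?v\<close>, leaving
        \<open>m * ip \<Omega> ?d ?d\<close> and a small excess.\<close>
      have ips: "ip \<Omega> ?s ?s = 4 - ip \<Omega> ?d ?d"
        using L2.square_lincomb[OF uvL, of 1] L2.square_diff[OF uvL] w(2) by simp
      have as: "a ?d ?d = 2 * a ?u ?u + 2 * a ?v ?v - a ?s ?s"
        using a.square_lincomb[OF uv, of 1] a.square_diff[OF uv] by simp
      have au: "a (w (r k)) (w (r k)) < m + e\<^sup>2 / 8" if "N2 \<le> k" for k
      proof -
        have "N2 \<le> r k" using that seq_suble[OF r(1), of k] by simp
        then show ?thesis using w(3)[of "r k"] N2[of "r k"] by simp
      qed
      have "(L2_norm \<Omega> ?d)\<^sup>2 \<le> d\<^sup>2"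
        using N1[of i j] ij by (intro power_mono) (auto simp: L2_norm_def)
      then have ipd: "ip \<Omega> ?d ?d \<le> e\<^sup>2 / (2 * (1 + m))"
        using L2.nrm_square[OF H01_L2[OF dH]] by (simp add: nrm_L2 d(2))
      have "a ?d ?d < e\<^sup>2 / 2 + m * ip \<Omega> ?d ?d"
        using au[of i] au[of j] ij le[OF s] unfolding as ips by (simp add: algebra_simps)
      then have "h1 ?d ?d < e\<^sup>2 / 2 + (1 + m) * ip \<Omega> ?d ?d"
        using a_bounds(1)[OF dH] by (simp add: h1_def algebra_simps)
      also have "(1 + m) * ip \<Omega> ?d ?d \<le> (1 + m) * (e\<^sup>2 / (2 * (1 + m)))"
        using m0 by (intro mult_left_mono ipd) auto
      also have "\<dots> = e\<^sup>2 / 2"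
      proof -
        have "x * (y / (2 * x)) = y / 2" if "x \<noteq> 0" for x y :: real using that by simp
        moreover have "1 + m \<noteq> 0" using m0 by simp
        ultimately show ?thesis by blast
      qed
      finally have "h1 ?d ?d < e\<^sup>2" by simp
      then have "sqrt (h1 ?d ?d) < sqrt (e\<^sup>2)" by (rule real_sqrt_less_mono)
      then show "H1.nrm ?d < e" using e by (simp add: H1.nrm_def)
    qed
  qed
  obtain z where z: "z \<in> H01 \<Omega>" "(\<lambda>n. H1.nrm (\<lambda>x. w (r n) x - z x)) \<longlonglongrightarrow> 0"
    by (rule H01_complete[OF wH Cauchy]) (assumption, rule that)
  note lim = tendsto_nrm_if_H1[OF wH z]
  have gg: "(\<lambda>n::nat. L2.nrm \<Omega> (\<lambda>x. g x - g x)) \<longlonglongrightarrow> 0" by (simp add: nrm_L2 L2_norm_def)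
  have "(\<lambda>n. ip \<Omega> g (w (r n))) \<longlonglongrightarrow> ip \<Omega> g z"
    by (intro L2.tendsto_form always_eventually allI H01_L2 g wH z(1) gg lim(1))
  then have ipgz: "ip \<Omega> g z = 0" using perpD(2)[OF w(1)] by (simp add: LIMSEQ_const_iff)
  have "(\<lambda>n. ip \<Omega> (w (r n)) (w (r n))) \<longlonglongrightarrow> ip \<Omega> z z"
    by (intro L2.tendsto_form always_eventually allI H01_L2 wH z(1) lim(1))
  then have ipzz: "ip \<Omega> z z = 1" using w(2) by (simp add: LIMSEQ_const_iff)
  have "(\<lambda>n. a (w (r n)) (w (r n))) \<longlonglongrightarrow> a z z"
    by (intro a.tendsto_form always_eventually allI wH z(1) lim(2))
  moreover have "(\<lambda>n. m + inverse (real (Suc (r n)))) \<longlonglongrightarrow> m + 0"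
    using LIMSEQ_subseq_LIMSEQ[OF LIMSEQ_inverse_real_of_nat r(1)]
    by (intro tendsto_intros) (simp add: o_def)
  ultimately have "a z z \<le> m + 0"
    by (rule LIMSEQ_le) (use less_imp_le[OF w(3)] in blast)
  then have "a z z * ip \<Omega> v v \<le> a v v" if "v \<in> perp" for v
    using mult_right_mono[of "a z z" m, OF _ L2.nonneg[OF H01_L2[OF perpD(1)[OF that]]]] le[OF that] by simp
  then show thesis using that[of z] z(1) ipgz ipzz by (simp add: perp_def)
qed

text \<open>On \<open>perp\<close> the form \<open>a\<close> minus \<open>m\<close> times
  \<open>ip\<close> is semidefinite and vanishes at \<open>w\<close>, so by Cauchy-Schwarz it
  vanishes between \<open>w\<close> and all of \<open>perp\<close>. In the remaining direction
  \<open>g\<close> both sides are zero by the Euler-Lagrange equation.\<close>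

lemma minimizer_solves_eigenproblem:
  assumes w: "w \<in> perp" "ip \<Omega> w w = 1" and min: "\<And>v. v \<in> perp \<Longrightarrow> a w w * ip \<Omega> v v \<le> a v v"
    and v: "v \<in> H01 \<Omega>"
  shows "a w v = a w w * ip \<Omega> w v"
proof -
  define m where "m = a w w"
  interpret b: pre_inner perp "\<lambda>u v. a u v - m * ip \<Omega> u v"
  proof unfold_locales
    fix u v z :: "real^3 \<Rightarrow> real" and c :: real
    assume u: "u \<in> perp"
    show "0 \<le> a u u - m * ip \<Omega> u u" using min[OF u] by (simp add: m_def)
    assume v: "v \<in> perp"
    show "a u v - m * ip \<Omega> u v = a v u - m * ip \<Omega> v u"
      using a.sym[OF perpD(1)[OF u] perpD(1)[OF v]] L2.sym[OF H01_L2[OF perpD(1)[OF u]] H01_L2[OF perpD(1)[OF v]]] by simp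
    assume z: "z \<in> perp"
    note H = perpD(1)[OF u] perpD(1)[OF v] perpD(1)[OF z]
    show "a (\<lambda>x. u x + c * v x) z - m * ip \<Omega> (\<lambda>x. u x + c * v x) z = a u z - m * ip \<Omega> u z + c * (a v z - m * ip \<Omega> v z)"
      by (simp add: a.lin_left[OF H] L2.lin_left[OF H[THEN H01_L2]] algebra_simps)
  qed (fact perp_zero perp_lin)+
  note wH = perpD(1)[OF w(1)]
  define c where "c = ip \<Omega> g v"
  \<comment> \<open>The orthogonal projection of \<open>v\<close> onto \<open>perp\<close>,
    \<open>g\<close> being normalized.\<close>
  let ?p = "\<lambda>x. v x + (- c) * g x"
  have pH: "?p \<in> H01 \<Omega>" by (rule H01.lin[OF v g])
  have p: "?p \<in> perp"
    using pH L2.lin_right[OF H01_L2[OF v] H01_L2[OF g] H01_L2[OF g], of "-c"] ip_g by (simp add: perp_def c_def)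
  have "(a w ?p - m * ip \<Omega> w ?p)\<^sup>2 \<le> (a w w - m * ip \<Omega> w w) * (a ?p ?p - m * ip \<Omega> ?p ?p)"
    by (rule b.Cauchy_Schwarz_square[OF w(1) p])
  then have "a w ?p = m * ip \<Omega> w ?p" by (simp add: m_def w(2))
  moreover have "a w g = 0"
    using Euler_Lagrange[OF wH] perpD(2)[OF w(1)] a.sym[OF g wH] by simp
  moreover have "ip \<Omega> w g = 0" using perpD(2)[OF w(1)] L2.sym[OF H01_L2[OF g] H01_L2[OF wH]] by simp
  ultimately show ?thesis
    using a.lin_right[OF v g wH, of "-c"] L2.lin_right[OF H01_L2[OF v] H01_L2[OF g] H01_L2[OF wH], of "-c"]
    by (simp add: m_def)
qed

definition gap_value :: real where
  "gap_value = nth_eigenvalue \<Omega> (\<lambda>x. V x + \<beta> * \<bar>g x\<bar>\<^sup>2) 2"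

text \<open>The orthonormal eigenfunctions \<open>g\<close> and \<open>w\<close> witness that
  \<open>max lam m\<close> belongs to the set whose infimum is the second eigenvalue. That set must
  also be shown bounded below, or its \<open>Inf\<close> would be unspecified.\<close>

lemma gap_value_le:
  assumes w: "w \<in> perp" "ip \<Omega> w w = 1" and eq: "\<And>v. v \<in> H01 \<Omega> \<Longrightarrow> a w v = m * ip \<Omega> w v"
  shows "gap_value \<le> max lam m"
  unfolding gap_value_def nth_eigenvalue_def
proof (rule cInf_lower)
  let ?W = "\<lambda>x. V x + \<beta> * \<bar>g x\<bar>\<^sup>2"
  let ?u = "\<lambda>i::nat. if i = 0 then g else w" and ?\<nu> = "\<lambda>i::nat. if i = 0 then lam else m"
  note wH = perpD(1)[OF w(1)] and ipgw = perpD(2)[OF w(1)]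
  have ind: "ae_independent \<Omega> 2 ?u"
    unfolding ae_independent_def
  proof (intro allI impI)
    fix c :: "nat \<Rightarrow> real" and i :: nat
    assume "AE x in lebesgue_on \<Omega>. (\<Sum>i<2. c i * ?u i x) = 0" and i: "i < 2"
    then have ae: "AE x in lebesgue_on \<Omega>. c 0 * g x + c 1 * w x = 0" by (simp add: numeral_2_eq_2)
    have zL: "(\<lambda>x. c 0 * g x + c 1 * w x) \<in> H01 \<Omega>" by (rule H01.lin[OF H01.scale[OF g] wH])
    have z: "ip \<Omega> (\<lambda>x. c 0 * g x + c 1 * w x) v = 0" if "v \<in> H01 \<Omega>" for v
    proof -
      have "ip \<Omega> (\<lambda>x. c 0 * g x + c 1 * w x) v = ip \<Omega> (\<lambda>x. 0) v"
        by (rule ip_cong_AE[OF ae _ L2_measurable[OF H01_L2[OF zL]]]) (auto intro: L2_measurable H01_L2 that)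
      then show ?thesis by (simp add: ip_def)
    qed
    have e: "ip \<Omega> (\<lambda>x. c 0 * g x + c 1 * w x) v = c 0 * ip \<Omega> g v + c 1 * ip \<Omega> w v" if "v \<in> H01 \<Omega>" for v
      using L2.lin_left[OF H01_L2[OF H01.scale[OF g]] H01_L2[OF wH] H01_L2[OF that], of "c 0" "c 1"]
        L2.scale_left[OF H01_L2[OF g] H01_L2[OF that], of "c 0"] by simp
    have "c 0 = 0" "c 1 = 0"
      using z[OF g] z[OF wH] e[OF g] e[OF wH] ip_g ipgw w(2) L2.sym[OF H01_L2[OF g] H01_L2[OF wH]] by auto
    then show "c i = 0" using i by (cases i) (auto simp: less_Suc_eq numeral_2_eq_2)
  qed
  have "solves_eigenproblem \<Omega> ?W g lam" "solves_eigenproblem \<Omega> ?W w m"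
    unfolding solves_eigenproblem_iff[OF g] using g wH Euler_Lagrange eq by (auto simp: a_def)
  then show "max lam m \<in> {\<Lambda>. \<exists>u \<nu>. ae_independent \<Omega> 2 u \<and> (\<forall>i<2. solves_eigenproblem \<Omega> ?W (u i) (\<nu> i) \<and> \<nu> i \<le> \<Lambda>)}"
    using ind by (intro CollectI exI[of _ ?u] exI[of _ ?\<nu>]) auto
  show "bdd_below {\<Lambda>. \<exists>u \<nu>. ae_independent \<Omega> 2 u \<and> (\<forall>i<2. solves_eigenproblem \<Omega> ?W (u i) (\<nu> i) \<and> \<nu> i \<le> \<Lambda>)}"
  proof (rule bdd_belowI[of _ 0])
    fix \<Lambda> assume "\<Lambda> \<in> {\<Lambda>. \<exists>u \<nu>. ae_independent \<Omega> 2 u \<and> (\<forall>i<2. solves_eigenproblem \<Omega> ?W (u i) (\<nu> i) \<and> \<nu> i \<le> \<Lambda>)}"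
    then obtain u \<nu> where ui: "ae_independent \<Omega> 2 u" "\<forall>i<2. solves_eigenproblem \<Omega> ?W (u i) (\<nu> i) \<and> \<nu> i \<le> \<Lambda>"
      by blast
    then have u: "ae_independent \<Omega> 2 u" "solves_eigenproblem \<Omega> ?W (u 0) (\<nu> 0)" "\<nu> 0 \<le> \<Lambda>" by simp_all
    then have u0: "u 0 \<in> H01 \<Omega>" "a (u 0) (u 0) = \<nu> 0 * ip \<Omega> (u 0) (u 0)"
      unfolding solves_eigenproblem_iff[OF g] a_def by auto
    \<comment> \<open>A first function of norm zero would contradict independence with the
      coefficients 1 and 0. Since \<open>a\<close> is nonnegative, its eigenvalue is then
      nonnegative, and so is \<open>\<Lambda>\<close>.\<close>
    have "ip \<Omega> (u 0) (u 0) \<noteq> 0"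
    proof
      assume "ip \<Omega> (u 0) (u 0) = 0"
      then have "AE x in lebesgue_on \<Omega>. u 0 x * u 0 x = 0"
        unfolding ip_def by (subst (asm) integral_nonneg_eq_0_iff_AE) (auto intro!: L2_integrable_mult H01_L2 u0)
      then have "AE x in lebesgue_on \<Omega>. (\<Sum>i<2. (if i = 0 then 1 else 0) * u i x) = 0"
        by eventually_elim (simp add: numeral_2_eq_2)
      then have "\<forall>i<2::nat. (if i = 0 then 1 else 0 :: real) = 0"
        by (rule mp[OF spec[OF u(1)[unfolded ae_independent_def], of "\<lambda>i. if i = 0 then 1 else 0"]])
      then show False by (auto dest: spec[of _ "0::nat"])
    qed
    then have "0 < ip \<Omega> (u 0) (u 0)" using L2.nonneg[OF H01_L2[OF u0(1)]] by simp
    moreover have "0 \<le> \<nu> 0 * ip \<Omega> (u 0) (u 0)" using a.nonneg[OF u0(1)] u0(2) by simp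
    ultimately have "0 \<le> \<nu> 0" by (simp add: zero_le_mult_iff)
    then show "0 \<le> \<Lambda>" using u(3) by simp
  qed
qed

text \<open>As \<open>lam\<close> lies below the second eigenvalue, the maximum in
  \<open>gap_value_le\<close> must be the minimum of \<open>a\<close> on the unit sphere of
  \<open>perp\<close>. If that sphere is empty, every element of \<open>perp\<close> has norm
  zero.\<close>

lemma spectral_gap_perp:
  assumes gap: "lam < gap_value" and v: "v \<in> perp"
  shows "gap_value * ip \<Omega> v v \<le> a v v"
proof (cases "\<exists>w\<in>perp. ip \<Omega> w w = 1")
  case True
  then obtain w where w: "w \<in> perp" "ip \<Omega> w w = 1" "\<And>v. v \<in> perp \<Longrightarrow> a w w * ip \<Omega> v v \<le> a v v"
    by (rule minimizer_exists) (rule that)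
  have "gap_value \<le> max lam (a w w)"
    by (rule gap_value_le[OF w(1,2) minimizer_solves_eigenproblem[OF w]])
  then have "gap_value * ip \<Omega> v v \<le> a w w * ip \<Omega> v v"
    using gap L2.nonneg[OF H01_L2[OF perpD(1)[OF v]]] by (intro mult_right_mono) auto
  then show ?thesis using w(3)[OF v] by simp
next
  case False
  have "ip \<Omega> v v = 0"
  proof (rule ccontr)
    assume ne: "ip \<Omega> v v \<noteq> 0"
    let ?c = "1 / sqrt (ip \<Omega> v v)"
    have pos: "0 < ip \<Omega> v v" using ne L2.nonneg[OF H01_L2[OF perpD(1)[OF v]]] by simp
    have z: "(\<lambda>x. ?c * v x) \<in> perp" using perp_lin[OF perp_zero v, of ?c] by simp
    have "ip \<Omega> (\<lambda>x. ?c * v x) (\<lambda>x. ?c * v x) = ?c * (?c * ip \<Omega> v v)"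
      using L2.scale_left[OF H01_L2[OF perpD(1)[OF v]] H01_L2[OF perpD(1)[OF z]], of ?c]
        L2.scale_right[OF H01_L2[OF perpD(1)[OF v]] H01_L2[OF perpD(1)[OF v]], of ?c] by (simp only:)
    also have "\<dots> = 1" using pos by (simp add: field_simps)
    finally show False using False z by blast
  qed
  then show ?thesis using a.nonneg[OF perpD(1)[OF v]] by simp
qed

text \<open>Since \<open>g\<close> is an eigenfunction, splitting \<open>w\<close> into its
  component along \<open>g\<close> and a rest in \<open>perp\<close> is orthogonal for
  \<open>ip\<close> and for \<open>a\<close>. The gap acts on the rest only, which is why
  \<open>(ip \<Omega> g w)\<^sup>2\<close> is subtracted.\<close>

lemma spectral_gap:
  assumes gap: "lam < gap_value" and w: "w \<in> H01 \<Omega>"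
  shows "(gap_value - lam) * (ip \<Omega> w w - (ip \<Omega> g w)\<^sup>2) \<le> a w w - lam * ip \<Omega> w w"
proof -
  define c where "c = ip \<Omega> g w"
  let ?p = "\<lambda>x. w x + (- c) * g x"
  have pH: "?p \<in> H01 \<Omega>" by (rule H01.lin[OF w g])
  have p: "?p \<in> perp"
    using pH L2.lin_right[OF H01_L2[OF w] H01_L2[OF g] H01_L2[OF g], of "-c"] ip_g by (simp add: perp_def c_def)
  have ipwg: "ip \<Omega> w g = c" using L2.sym[OF H01_L2[OF g] H01_L2[OF w]] by (simp add: c_def)
  have "ip \<Omega> ?p ?p = ip \<Omega> w w - c\<^sup>2"
    using L2.square_lincomb[OF H01_L2[OF w] H01_L2[OF g], of "-c"] ip_g ipwg by (simp add: power2_eq_square)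
  moreover have "a ?p ?p = a w w - lam * c\<^sup>2"
    using a.square_lincomb[OF w g, of "-c"] Euler_Lagrange[OF w] Euler_Lagrange[OF g] ip_g a.sym[OF w g]
    by (simp add: power2_eq_square c_def)
  ultimately have "gap_value * (ip \<Omega> w w - c\<^sup>2) \<le> a w w - lam * c\<^sup>2"
    using spectral_gap_perp[OF gap p] by (simp only:)
  then show ?thesis by (simp add: c_def algebra_simps)
qed

end

section \<open>The gradient flow\<close>

text \<open>Gronwall with an integrating factor. \<open>D\<close> contributes only by being
  nonincreasing: the decay of the whole sum is paid for by \<open>y'\<close>.\<close>

lemma Lyapunov_decay:
  fixes y D :: "real \<Rightarrow> real"
  assumes y: "\<And>t. T \<le> t \<Longrightarrow> (y has_real_derivative y' t) (at t)"
    and D: "\<And>t. T \<le> t \<Longrightarrow> (D has_real_derivative D' t) (at t)" "\<And>t. T \<le> t \<Longrightarrow> D' t \<le> 0"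
    and le: "\<And>t. T \<le> t \<Longrightarrow> y' t \<le> - 2 * \<gamma> * (y t + \<eta> * D t)" and \<eta>: "0 \<le> \<eta>" and t: "T \<le> t"
  shows "y t + \<eta> * D t \<le> exp (2 * \<gamma> * T) * (y T + \<eta> * D T) * exp (- 2 * \<gamma> * t)"
proof -
  let ?Z = "\<lambda>t. exp (2 * \<gamma> * t) * (y t + \<eta> * D t)"
  have "?Z T \<ge> ?Z t"
  proof (rule DERIV_nonpos_imp_nonincreasing[OF t])
    fix s assume "T \<le> s" "s \<le> t"
    have "(?Z has_real_derivative exp (2 * \<gamma> * s) * (2 * \<gamma> * (y s + \<eta> * D s) + y' s + \<eta> * D' s)) (at s)"
      by (auto intro!: derivative_eq_intros y[OF \<open>T \<le> s\<close>] D(1)[OF \<open>T \<le> s\<close>] simp: algebra_simps)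
    moreover have "\<eta> * D' s \<le> 0" using \<eta> D(2)[OF \<open>T \<le> s\<close>] by (simp add: mult_nonneg_nonpos)
    then have "exp (2 * \<gamma> * s) * (2 * \<gamma> * (y s + \<eta> * D s) + y' s + \<eta> * D' s) \<le> 0"
      using le[OF \<open>T \<le> s\<close>] by (intro mult_nonneg_nonpos) auto
    ultimately show "\<exists>z. (?Z has_real_derivative z) (at s) \<and> z \<le> 0" by blast
  qed
  then have "?Z t * exp (- 2 * \<gamma> * t) \<le> ?Z T * exp (- 2 * \<gamma> * t)" by (intro mult_right_mono) auto
  moreover have "?Z t * exp (- 2 * \<gamma> * t) = (y t + \<eta> * D t) * (exp (2 * \<gamma> * t) * exp (- 2 * \<gamma> * t))"
    by (simp only: mult_ac)
  moreover have "exp (2 * \<gamma> * t) * exp (- 2 * \<gamma> * t) = 1" by (simp flip: exp_add)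
  ultimately show ?thesis by (simp only: mult_1_right)
qed

lemma (in open_domain) weak_laplacian_L2:
  assumes "u \<in> H2 \<Omega>" shows "weak_laplacian \<Omega> u \<in> L2 \<Omega>"
proof -
  have "(\<lambda>x. \<Sum>b\<in>B. weak_deriv \<Omega> b (weak_deriv \<Omega> b u) x) \<in> L2 \<Omega>" if "finite B" "B \<subseteq> Basis" for B
    using that assms by (induction B) (auto intro!: L2.zero L2.add weak_deriv simp: H2_def)
  then show ?thesis unfolding weak_laplacian_def[abs_def] by simp
qed

text \<open>Against test functions this is the definition of the second weak derivatives, summed
  over the basis. Both sides are continuous in the \<open>H1\<close> norm, so it extends to
  \<open>H01\<close>, where no boundary term arises.\<close>

lemma (in open_domain) ip_weak_laplacian:
  assumes u: "u \<in> H2 \<Omega>" and v: "v \<in> H01 \<Omega>"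
  shows "ip \<Omega> (weak_laplacian \<Omega> u) v = - dir u v"
proof -
  have uH: "u \<in> H1 \<Omega>" "\<And>b. b \<in> Basis \<Longrightarrow> weak_deriv \<Omega> b u \<in> H1 \<Omega>" using u by (auto simp: H2_def)
  have test: "ip \<Omega> (weak_laplacian \<Omega> u) \<psi> = - dir u \<psi>" if \<psi>: "\<psi> \<in> test_functions \<Omega>" for \<psi>
  proof -
    have "ip \<Omega> (weak_laplacian \<Omega> u) \<psi> = (\<Sum>b\<in>Basis. ip \<Omega> (weak_deriv \<Omega> b (weak_deriv \<Omega> b u)) \<psi>)"
      unfolding ip_def weak_laplacian_def sum_distrib_right
      by (rule Bochner_Integration.integral_sum) (intro L2_integrable_mult weak_deriv uH test_functions_L2[OF \<psi>])
    also have "\<dots> = (\<Sum>b\<in>Basis. - ip \<Omega> (weak_deriv \<Omega> b u) (weak_deriv \<Omega> b \<psi>))"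
    proof (rule sum.cong[OF refl])
      fix b :: 'a assume b: "b \<in> Basis"
      have "ip \<Omega> (weak_deriv \<Omega> b u) (weak_deriv \<Omega> b \<psi>) = ip \<Omega> (weak_deriv \<Omega> b u) (fd b \<psi>)"
        using b uH test_functions_H1[OF \<psi>] test_functions_L2[OF test_functions_frechet_derivative[OF \<psi>]]
        by (intro ip_cong_AE weak_deriv_test \<psi>) (auto intro: L2_measurable weak_deriv)
      also have "\<dots> = - ip \<Omega> (weak_deriv \<Omega> b (weak_deriv \<Omega> b u)) \<psi>"
        using has_weak_deriv_weak_deriv[OF uH(2)[OF b] b] \<psi> by (simp add: has_weak_deriv_iff)
      finally show "ip \<Omega> (weak_deriv \<Omega> b (weak_deriv \<Omega> b u)) \<psi> = - ip \<Omega> (weak_deriv \<Omega> b u) (weak_deriv \<Omega> b \<psi>)" by simp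
    qed
    finally show ?thesis by (simp add: dir_def sum_negf)
  qed
  obtain \<psi> where \<psi>: "\<And>n. \<psi> n \<in> test_functions \<Omega>" "(\<lambda>n. H1.nrm (\<lambda>x. \<psi> n x - v x)) \<longlonglongrightarrow> 0"
    by (rule H01_approx[OF v]) (rule that)
  note vH = H01_H1[OF v] and \<psi>H = test_functions_H1[OF \<psi>(1)]
  have L: "(\<lambda>n. L2.nrm \<Omega> (\<lambda>x. \<psi> n x - v x)) \<longlonglongrightarrow> 0"
    and D: "(\<lambda>n. dir.nrm (\<lambda>x. \<psi> n x - v x)) \<longlonglongrightarrow> 0"
    using \<psi>H vH \<psi>(2) by (intro H1_limit_imp always_eventually allI; simp)+
  have z1: "(\<lambda>n::nat. L2.nrm \<Omega> (\<lambda>x. weak_laplacian \<Omega> u x - weak_laplacian \<Omega> u x)) \<longlonglongrightarrow> 0"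
    by (simp add: nrm_L2 L2_norm_def)
  have z2: "(\<lambda>n::nat. dir.nrm (\<lambda>x. u x - u x)) \<longlonglongrightarrow> 0"
    by (simp add: dir.nrm_def dir.zero_left dir.zero)
  have "(\<lambda>n. ip \<Omega> (weak_laplacian \<Omega> u) (\<psi> n)) \<longlonglongrightarrow> ip \<Omega> (weak_laplacian \<Omega> u) v"
    by (intro L2.tendsto_form always_eventually allI weak_laplacian_L2[OF u] z1 test_functions_L2[OF \<psi>(1)] H01_L2[OF v] L)
  moreover have "(\<lambda>n. - dir u (\<psi> n)) \<longlonglongrightarrow> - dir u v"
    by (intro tendsto_minus dir.tendsto_form always_eventually allI uH(1) z2 \<psi>H vH D)
  ultimately show ?thesis using LIMSEQ_unique by (simp add: test[OF \<psi>(1)])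
qed

section \<open>Conservation of the norm and dissipation of the energy\<close>

locale gp_flow = gp_ground_state \<Omega> V \<beta> g for \<Omega> V \<beta> g +
  fixes \<phi> \<phi>' :: "real \<Rightarrow> real^3 \<Rightarrow> real"
  assumes \<phi>_H: "0 \<le> t \<Longrightarrow> \<phi> t \<in> H01 \<Omega>" "0 \<le> t \<Longrightarrow> \<phi> t \<in> H2 \<Omega>"
    and \<phi>'_H: "0 \<le> t \<Longrightarrow> \<phi>' t \<in> H01 \<Omega>"
    and time_deriv: "has_time_deriv (H1_norm \<Omega>) \<phi> \<phi>'"
    and evolution: "0 < t \<Longrightarrow> AE x in lebesgue_on \<Omega>.
      \<phi>' t x = weak_laplacian \<Omega> (\<phi> t) x - V x * \<phi> t x - \<beta> * \<bar>\<phi> t x\<bar>\<^sup>2 * \<phi> t x + mu \<Omega> V \<beta> (\<phi> t) * \<phi> t x"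
    and convergence: "((\<lambda>t. H1_norm \<Omega> (\<lambda>x. \<phi> t x - g x)) \<longlongrightarrow> 0) at_top"
begin

lemma eventually_H01:
  assumes "0 < t" shows "\<forall>\<^sub>F s in at t. \<phi> s \<in> H01 \<Omega>"
proof -
  have "\<forall>\<^sub>F s in at t. s \<in> {0<..}" using assms by (intro eventually_at_in_open') auto
  then show ?thesis by eventually_elim (simp add: \<phi>_H)
qed

lemma difference_quotient_limit:
  assumes t: "0 < t"
  shows "((\<lambda>s. H1.nrm (\<lambda>x. (\<phi> s x - \<phi> t x) / (s - t) - \<phi>' t x)) \<longlongrightarrow> 0) (at t)"
proof -
  have "((\<lambda>s. H1_norm \<Omega> (\<lambda>x. (\<phi> s x - \<phi> t x) / (s - t) - \<phi>' t x)) \<longlongrightarrow> 0) (at t within {0..})"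
    using time_deriv t by (simp add: has_time_deriv_def)
  moreover have "at t within {0..} = at t" using t by (intro at_within_interior) simp
  ultimately have "((\<lambda>s. H1_norm \<Omega> (\<lambda>x. (\<phi> s x - \<phi> t x) / (s - t) - \<phi>' t x)) \<longlongrightarrow> 0) (at t)" by simp
  then show ?thesis
  proof (rule Lim_transform_eventually)
    show "\<forall>\<^sub>F s in at t. H1_norm \<Omega> (\<lambda>x. (\<phi> s x - \<phi> t x) / (s - t) - \<phi>' t x) = H1.nrm (\<lambda>x. (\<phi> s x - \<phi> t x) / (s - t) - \<phi>' t x)"
      using eventually_H01[OF t]
    proof eventually_elim
      case (elim s)
      have "(\<lambda>x. 1 / (s - t) * (\<phi> s x - \<phi> t x) - \<phi>' t x) \<in> H01 \<Omega>"
        using t by (intro H01.diff H01.scale elim \<phi>_H \<phi>'_H) auto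
      then show ?case by (intro nrm_H1[symmetric] H01_H1) simp
    qed
  qed
qed

lemma weak_form:
  assumes t: "0 < t" and v: "v \<in> H01 \<Omega>"
  shows "ip \<Omega> (\<phi>' t) v = - A (\<phi> t) v - \<beta> * quad (\<phi> t) (\<phi> t) (\<phi> t) v + mu \<Omega> V \<beta> (\<phi> t) * ip \<Omega> (\<phi> t) v"
proof -
  let ?u = "\<phi> t"
  have u: "?u \<in> H01 \<Omega>" and u2: "?u \<in> H2 \<Omega>" and u': "\<phi>' t \<in> H01 \<Omega>" using t by (auto intro: \<phi>_H \<phi>'_H)
  note uL = H01_L2[OF u] and vL = H01_L2[OF v]
  have [measurable]: "?u \<in> borel_measurable (lebesgue_on \<Omega>)" "v \<in> borel_measurable (lebesgue_on \<Omega>)"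
    "\<phi>' t \<in> borel_measurable (lebesgue_on \<Omega>)" "weak_laplacian \<Omega> ?u \<in> borel_measurable (lebesgue_on \<Omega>)"
    by (intro L2_measurable uL vL H01_L2[OF u'] weak_laplacian_L2[OF u2])+
  have i: "integrable (lebesgue_on \<Omega>) (\<lambda>x. weak_laplacian \<Omega> ?u x * v x)"
    "integrable (lebesgue_on \<Omega>) (\<lambda>x. V x * ?u x * v x)"
    "integrable (lebesgue_on \<Omega>) (\<lambda>x. (?u x * ?u x) * (?u x * v x))"
    "integrable (lebesgue_on \<Omega>) (\<lambda>x. ?u x * v x)"
    by (intro L2_integrable_mult weak_laplacian_L2[OF u2] V_mult_L2 mult_L2 uL vL u v)+
  have "ip \<Omega> (\<phi>' t) v = (LINT x|lebesgue_on \<Omega>. weak_laplacian \<Omega> ?u x * v x - V x * ?u x * v x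
      - \<beta> * ((?u x * ?u x) * (?u x * v x)) + mu \<Omega> V \<beta> ?u * (?u x * v x))"
    unfolding ip_def
  proof (rule integral_cong_AE)
    show "AE x in lebesgue_on \<Omega>. \<phi>' t x * v x = weak_laplacian \<Omega> ?u x * v x - V x * ?u x * v x
      - \<beta> * ((?u x * ?u x) * (?u x * v x)) + mu \<Omega> V \<beta> ?u * (?u x * v x)"
      using evolution[OF t]
    proof eventually_elim
      case (elim x)
      show ?case unfolding elim by (simp add: algebra_simps power2_eq_square)
    qed
  qed measurable
  also have "\<dots> = ip \<Omega> (weak_laplacian \<Omega> ?u) v - pot ?u v - \<beta> * quad ?u ?u ?u v + mu \<Omega> V \<beta> ?u * ip \<Omega> ?u v"
    using i by (simp add: ip_def pot_def quad_def)
  finally show ?thesis by (simp add: A_def ip_weak_laplacian[OF u2 v])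
qed

lemma L2_bound: "u \<in> H01 \<Omega> \<Longrightarrow> L2.nrm \<Omega> u \<le> H1.nrm u"
  using L2_norm_le_H1[OF H01_H1] by (simp add: nrm_L2)

lemma difference_quotient_limit_L2:
  assumes t: "0 < t"
  shows "((\<lambda>s. L2.nrm \<Omega> (\<lambda>x. (\<phi> s x - \<phi> t x) / (s - t) - \<phi>' t x)) \<longlongrightarrow> 0) (at t)"
    and "((\<lambda>s. A.nrm (\<lambda>x. (\<phi> s x - \<phi> t x) / (s - t) - \<phi>' t x)) \<longlongrightarrow> 0) (at t)"
proof -
  let ?q = "\<lambda>s x. (\<phi> s x - \<phi> t x) / (s - t) - \<phi>' t x"
  have q: "\<forall>\<^sub>F s in at t. ?q s \<in> H01 \<Omega>"
    using eventually_H01[OF t]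
  proof eventually_elim
    case (elim s)
    have "(\<lambda>x. 1 / (s - t) * (\<phi> s x - \<phi> t x) - \<phi>' t x) \<in> H01 \<Omega>"
      using t by (intro H01.diff H01.scale elim \<phi>_H \<phi>'_H) auto
    then show ?case by simp
  qed
  show "((\<lambda>s. L2.nrm \<Omega> (?q s)) \<longlongrightarrow> 0) (at t)"
  proof (rule Lim_null_comparison[OF _ difference_quotient_limit[OF t]])
    show "\<forall>\<^sub>F s in at t. norm (L2.nrm \<Omega> (?q s)) \<le> H1.nrm (?q s)"
      using q by eventually_elim (simp add: L2_bound L2.nrm_nonneg H01_L2)
  qed
  have l: "((\<lambda>s. sqrt (1 + V_bound) * H1.nrm (?q s)) \<longlongrightarrow> 0) (at t)"
    by (rule tendsto_mult_right_zero[OF difference_quotient_limit[OF t]])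
  show "((\<lambda>s. A.nrm (?q s)) \<longlongrightarrow> 0) (at t)"
  proof (rule Lim_null_comparison[OF _ l])
    show "\<forall>\<^sub>F s in at t. norm (A.nrm (?q s)) \<le> sqrt (1 + V_bound) * H1.nrm (?q s)"
      using q by eventually_elim (simp add: A_nrm_le A.nrm_nonneg)
  qed
qed

text \<open>\<open>mu\<close> is the very factor for which the equation tested with the solution
  cancels. Its denominator calls for a separate argument at norm zero, because conservation of the
  norm is deduced from this lemma.\<close>

lemma ip_phi_deriv_0:
  assumes t: "0 < t" shows "ip \<Omega> (\<phi>' t) (\<phi> t) = 0"
proof -
  have u: "\<phi> t \<in> H01 \<Omega>" and u': "\<phi>' t \<in> H01 \<Omega>" using t by (auto intro: \<phi>_H \<phi>'_H)
  show ?thesis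
  proof (cases "ip \<Omega> (\<phi> t) (\<phi> t) = 0")
    case True
    then show ?thesis
      using L2.Cauchy_Schwarz_square[OF H01_L2[OF u'] H01_L2[OF u]] by simp
  next
    case False
    have "(L2_norm \<Omega> (\<phi> t))\<^sup>2 = ip \<Omega> (\<phi> t) (\<phi> t)"
      using L2.nrm_square[OF H01_L2[OF u]] by (simp add: nrm_L2)
    then show ?thesis using False by (simp add: weak_form[OF t u] mu_eq[OF u])
  qed
qed

text \<open>The derivative of the squared norm vanishes at positive times; the constant value is
  read off at infinity from the convergence to the normalized \<open>g\<close>.\<close>

lemma norm_conserved:
  assumes t: "0 < t" shows "ip \<Omega> (\<phi> t) (\<phi> t) = 1"
proof -
  let ?n = "\<lambda>t. ip \<Omega> (\<phi> t) (\<phi> t)"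
  have d: "(?n has_real_derivative 0) (at s)" if s: "0 < s" for s
  proof -
    have "\<forall>\<^sub>F r in at s. \<phi> r \<in> L2 \<Omega>" using eventually_H01[OF s] by eventually_elim (rule H01_L2)
    then have "(?n has_real_derivative 2 * ip \<Omega> (\<phi>' s) (\<phi> s)) (at s)"
      using s by (intro L2.has_derivative_form difference_quotient_limit_L2 H01_L2 \<phi>_H \<phi>'_H) auto
    then show ?thesis by (simp add: ip_phi_deriv_0[OF s])
  qed
  have const: "?n s = ?n t" if "0 < s" for s
  proof -
    have "\<exists>c. \<forall>s\<in>{0<..}. ?n s = c"
      by (rule has_field_derivative_zero_constant) (auto intro: has_field_derivative_at_within d)
    then show ?thesis using that t by auto
  qed
  have ev: "\<forall>\<^sub>F s in at_top. \<phi> s \<in> H01 \<Omega>"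
    using eventually_ge_at_top[of 0] by eventually_elim (rule \<phi>_H)
  have L: "((\<lambda>s. L2.nrm \<Omega> (\<lambda>x. \<phi> s x - g x)) \<longlongrightarrow> 0) at_top"
  proof (rule Lim_null_comparison[OF _ convergence])
    show "\<forall>\<^sub>F s in at_top. norm (L2.nrm \<Omega> (\<lambda>x. \<phi> s x - g x)) \<le> H1_norm \<Omega> (\<lambda>x. \<phi> s x - g x)"
      using ev
    proof eventually_elim
      case (elim s)
      note d = H01.diff[OF elim g]
      show ?case using L2_bound[OF d] L2.nrm_nonneg[OF H01_L2[OF d]] nrm_H1[OF H01_H1[OF d]] by simp
    qed
  qed
  have "(?n \<longlongrightarrow> ip \<Omega> g g) at_top"
    by (intro L2.tendsto_form eventually_mono[OF ev H01_L2] H01_L2[OF g] L)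
  moreover have "(?n \<longlongrightarrow> ?n t) at_top"
  proof (rule tendsto_eventually)
    show "\<forall>\<^sub>F s in at_top. ?n s = ?n t"
      using eventually_gt_at_top[of 0] by eventually_elim (rule const)
  qed
  ultimately have "ip \<Omega> g g = ?n t" by (rule tendsto_unique[OF trivial_limit_at_top_linorder])
  then show ?thesis using ip_g by simp
qed

text \<open>The equation tested with the time derivative: the term with \<open>mu\<close> drops out
  because \<open>\<phi>'\<close> is orthogonal to \<open>\<phi>\<close>.\<close>

lemma energy_derivative:
  assumes t: "0 < t"
  shows "((\<lambda>t. energy \<Omega> V \<beta> (\<phi> t)) has_real_derivative - ip \<Omega> (\<phi>' t) (\<phi>' t)) (at t)"
proof -
  have u: "\<phi> t \<in> H01 \<Omega>" and u': "\<phi>' t \<in> H01 \<Omega>" using t by (auto intro: \<phi>_H \<phi>'_H)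
  have "((\<lambda>s. A (\<phi> s) (\<phi> s) / 2 + \<beta> / 4 * quad (\<phi> s) (\<phi> s) (\<phi> s) (\<phi> s)) has_real_derivative
      (2 * A (\<phi>' t) (\<phi> t)) / 2 + \<beta> / 4 * (4 * quad (\<phi> t) (\<phi> t) (\<phi> t) (\<phi>' t))) (at t)"
    by (intro DERIV_add DERIV_cdivide DERIV_cmult has_derivative_quad A.has_derivative_form
        eventually_H01 difference_quotient_limit difference_quotient_limit_L2 u u' t)
  moreover have "(2 * A (\<phi>' t) (\<phi> t)) / 2 + \<beta> / 4 * (4 * quad (\<phi> t) (\<phi> t) (\<phi> t) (\<phi>' t)) = - ip \<Omega> (\<phi>' t) (\<phi>' t)"
    using weak_form[OF t u'] ip_phi_deriv_0[OF t] A.sym[OF u u'] L2.sym[OF H01_L2[OF u] H01_L2[OF u']] by simp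
  ultimately have "((\<lambda>s. A (\<phi> s) (\<phi> s) / 2 + \<beta> / 4 * quad (\<phi> s) (\<phi> s) (\<phi> s) (\<phi> s)) has_real_derivative - ip \<Omega> (\<phi>' t) (\<phi>' t)) (at t)"
    by simp
  then show ?thesis
    by (rule has_field_derivative_transform_within_open[of _ _ _ "{0<..}"])
      (use t in \<open>auto simp: energy_eq \<phi>_H\<close>)
qed

section \<open>Expansion around the ground state\<close>

abbreviation w :: "real \<Rightarrow> real^3 \<Rightarrow> real" where "w t \<equiv> \<lambda>x. \<phi> t x - g x"

definition y :: "real \<Rightarrow> real" where "y t = ip \<Omega> (w t) (w t)"
definition G :: "real \<Rightarrow> real" where "G t = dir (w t) (w t)"
definition N :: "real \<Rightarrow> real" where "N t = H1.nrm (w t)"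
definition D :: "real \<Rightarrow> real" where "D t = energy \<Omega> V \<beta> (\<phi> t) - energy \<Omega> V \<beta> g"

lemma w_H01: "0 < t \<Longrightarrow> w t \<in> H01 \<Omega>" by (intro H01.diff g \<phi>_H) simp

lemma y_derivative:
  assumes t: "0 < t" shows "(y has_real_derivative 2 * ip \<Omega> (\<phi>' t) (w t)) (at t)"
proof -
  have w: "\<forall>\<^sub>F s in at t. w s \<in> L2 \<Omega>"
    using eventually_H01[OF t] by eventually_elim (intro H01_L2 H01.diff g)
  show ?thesis
    unfolding y_def[abs_def]
  proof (rule L2.has_derivative_form[OF w])
    show "w t \<in> L2 \<Omega>" by (rule H01_L2[OF w_H01[OF t]])
    show "\<phi>' t \<in> L2 \<Omega>" using t by (intro H01_L2 \<phi>'_H) simp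
    show "((\<lambda>s. L2.nrm \<Omega> (\<lambda>x. (w s x - w t x) / (s - t) - \<phi>' t x)) \<longlongrightarrow> 0) (at t)"
      using difference_quotient_limit_L2(1)[OF t] by simp
  qed
qed

lemma lam_nonneg: "0 \<le> lam"
  unfolding lam_def by (intro add_nonneg_nonneg mult_nonneg_nonneg A.nonneg g \<beta>_nonneg quad_square_nonneg)

lemma N_square: "0 < t \<Longrightarrow> (N t)\<^sup>2 = y t + G t"
  using H1.nrm_square[OF H01_H1[OF w_H01]] by (simp add: N_def y_def G_def h1_def)

lemma nonneg:
  assumes "0 < t" shows "0 \<le> y t" "0 \<le> G t" "0 \<le> N t" "0 \<le> D t"
proof -
  show "0 \<le> y t" "0 \<le> G t" "0 \<le> N t"
    using w_H01[OF assms] by (auto simp: y_def G_def N_def intro: L2.nonneg dir.nonneg H1.nrm_nonneg H01_L2 H01_H1)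
  show "0 \<le> D t"
    using energy_minimal[OF \<phi>_H(1) norm_conserved[OF assms]] assms by (simp add: D_def)
qed

text \<open>Matches the left-hand sides of the expansion rules for linear combinations at
  coefficient 1.\<close>

lemma phi_eq: "(\<lambda>x. g x + 1 * w t x) = \<phi> t" by simp

lemma ip_g_w: assumes t: "0 < t" shows "ip \<Omega> g (w t) = - y t / 2"
  using L2.square_lincomb[OF H01_L2[OF g] H01_L2[OF w_H01[OF t]], of 1] norm_conserved[OF t] ip_g
  by (simp add: phi_eq y_def)

lemma A_w_le: "0 < t \<Longrightarrow> A (w t) (w t) \<le> (1 + V_bound) * (N t)\<^sup>2"
  using A_bounds(2)[OF w_H01] H1.nrm_square[OF H01_H1[OF w_H01]] by (simp add: N_def)

abbreviation "q1 t \<equiv> quad g g g (w t)"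
abbreviation "q2 t \<equiv> quad g g (w t) (w t)"
abbreviation "q3 t \<equiv> quad g (w t) (w t) (w t)"
abbreviation "q4 t \<equiv> quad (w t) (w t) (w t) (w t)"
abbreviation "Ng \<equiv> H1.nrm g"

lemma q_bounds:
  assumes t: "0 < t"
  shows "\<bar>q1 t\<bar> \<le> 4 * Ng^3 * N t" "0 \<le> q2 t" "q2 t \<le> 4 * Ng\<^sup>2 * (N t)\<^sup>2"
    "\<bar>q3 t\<bar> \<le> 4 * Ng * (N t)^3" "0 \<le> q4 t" "q4 t \<le> 4 * (N t)^4" "4 * \<bar>q3 t\<bar> \<le> 4 * q2 t + q4 t"
proof -
  note w = w_H01[OF t]
  show "\<bar>q1 t\<bar> \<le> 4 * Ng^3 * N t" using quad_bound[OF g g g w] by (simp add: N_def power3_eq_cube mult_ac)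
  show q2: "0 \<le> q2 t" and q4: "0 \<le> q4 t" by (rule quad_square_nonneg)+
  show "q2 t \<le> 4 * Ng\<^sup>2 * (N t)\<^sup>2" using quad_bound[OF g g w w] by (simp add: N_def power2_eq_square mult_ac)
  show "\<bar>q3 t\<bar> \<le> 4 * Ng * (N t)^3" using quad_bound[OF g w w w] by (simp add: N_def power3_eq_cube mult_ac)
  show "q4 t \<le> 4 * (N t)^4" using quad_bound[OF w w w w] by (simp add: N_def power4_eq_xxxx mult_ac)
  \<comment> \<open>Integrated form of completing a square: Cauchy-Schwarz for the pair g w and w^2,
    then 16ab <= (4a + b)^2. It makes the combination \<open>6 * q2 t + 4 * q3 t + q4 t\<close>
    nonnegative.\<close>
  have "(q3 t)\<^sup>2 \<le> quad g (w t) g (w t) * q4 t"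
    unfolding quad_def by (rule L2.Cauchy_Schwarz_square) (intro mult_L2 g w)+
  also have "quad g (w t) g (w t) = q2 t" by (rule quad_commute)
  finally have "(4 * \<bar>q3 t\<bar>)\<^sup>2 \<le> 16 * (q2 t * q4 t)" by (simp add: power_mult_distrib)
  also have "\<dots> \<le> (4 * q2 t + q4 t)\<^sup>2"
    using zero_le_power2[of "4 * q2 t - q4 t"] by (simp add: power2_eq_square algebra_simps)
  finally show "4 * \<bar>q3 t\<bar> \<le> 4 * q2 t + q4 t" by (rule power2_le_imp_le) (use q2 q4 in simp)
qed

text \<open>The first-order part is \<open>A g (w t) + \<beta> * q1 t\<close>. The Euler-Lagrange
  equation turns it into \<open>lam * ip \<Omega> g (w t)\<close>, which norm conservation makes
  quadratic, so the excess has no linear term.\<close>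

lemma D_expansion:
  assumes t: "0 < t"
  shows "D t = - lam * y t / 2 + A (w t) (w t) / 2 + \<beta> / 4 * (6 * q2 t + 4 * q3 t + q4 t)"
proof -
  have u: "\<phi> t \<in> H01 \<Omega>" using t by (intro \<phi>_H) simp
  have "A (\<phi> t) (\<phi> t) = A g g + 2 * A g (w t) + A (w t) (w t)"
    using A.square_lincomb[OF g w_H01[OF t], of 1] by (simp add: phi_eq)
  moreover have "quad (\<phi> t) (\<phi> t) (\<phi> t) (\<phi> t) = quad g g g g + 4 * q1 t + 6 * q2 t + 4 * q3 t + q4 t"
    using quad_power4_lincomb[OF g w_H01[OF t], of 1] by (simp add: phi_eq)
  moreover have "A g (w t) + \<beta> * q1 t = - lam * y t / 2"
    using Euler_Lagrange[OF w_H01[OF t]] by (simp add: a_def ip_g_w[OF t])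
  ultimately show ?thesis by (simp add: D_def energy_eq[OF u] energy_eq[OF g] algebra_simps add_divide_distrib)
qed

lemma D_lower: assumes t: "0 < t" shows "G t \<le> 2 * D t + lam * y t"
proof -
  have "0 \<le> \<beta> / 4 * (6 * q2 t + 4 * q3 t + q4 t)"
    using q_bounds[OF t] \<beta>_nonneg by (intro mult_nonneg_nonneg) auto
  moreover have "G t \<le> A (w t) (w t)" unfolding G_def by (rule A_bounds(1)[OF w_H01[OF t]])
  ultimately show ?thesis using D_expansion[OF t] by simp
qed

lemma powers_le:
  assumes "0 < t" "N t \<le> 1"
  shows "(N t)^4 \<le> (N t)\<^sup>2" "(N t)^3 \<le> (N t)\<^sup>2" "(N t)\<^sup>2 \<le> N t"
  using assms nonneg(3)[OF assms(1)] power_decreasing[of 2 4 "N t"] power_decreasing[of 2 3 "N t"]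
    power_decreasing[of 1 2 "N t"] by auto

text \<open>The numbers 24, 16 and 4 are the binomial coefficients 6, 4 and 1 of \<open>q2\<close>,
  \<open>q3\<close> and \<open>q4\<close> times the constant 4 of \<open>quad_bound\<close>, with
  higher powers of \<open>N t\<close> lowered by \<open>N t \<le> 1\<close>.\<close>

definition C_D :: real where "C_D = (1 + V_bound) / 2 + \<beta> / 4 * (24 * Ng\<^sup>2 + 16 * Ng + 4)"

lemma Ng_nonneg: "0 \<le> Ng" by (rule H1.nrm_nonneg[OF H01_H1[OF g]])

lemma C_D_pos: "0 < C_D"
  unfolding C_D_def using V_bound(1) \<beta>_nonneg Ng_nonneg by (intro add_pos_nonneg) auto

lemma higher_order_le:
  assumes t: "0 < t" and N1: "N t \<le> 1"
  shows "\<bar>6 * q2 t + 4 * q3 t + q4 t\<bar> \<le> (24 * Ng\<^sup>2 + 16 * Ng + 4) * (N t)\<^sup>2"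
proof -
  have "4 * Ng * (N t)^3 \<le> 4 * Ng * (N t)\<^sup>2"
    using powers_le[OF t N1] Ng_nonneg by (intro mult_left_mono) auto
  then show ?thesis
    using q_bounds[OF t] powers_le[OF t N1] by (simp add: algebra_simps abs_le_iff)
qed

lemma D_upper:
  assumes t: "0 < t" and N1: "N t \<le> 1" shows "D t \<le> C_D * (y t + G t)"
proof -
  have "\<beta> / 4 * (6 * q2 t + 4 * q3 t + q4 t) \<le> \<beta> / 4 * ((24 * Ng\<^sup>2 + 16 * Ng + 4) * (N t)\<^sup>2)"
    using higher_order_le[OF t N1] \<beta>_nonneg by (intro mult_left_mono) auto
  moreover have "0 \<le> lam * y t" using lam_nonneg nonneg[OF t] by simp
  ultimately have "D t \<le> C_D * (N t)\<^sup>2"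
    using D_expansion[OF t] A_w_le[OF t] by (simp add: C_D_def algebra_simps add_divide_distrib)
  then show ?thesis by (simp add: N_square[OF t])
qed

text \<open>Built like \<open>C_D\<close>, with two additions for the linear terms:
  \<open>2 * Ng\<close> from \<open>2 * A g (w t)\<close> and \<open>16 * Ng^3\<close> from
  \<open>4 * q1 t\<close>.\<close>

definition C_mu :: real where
  "C_mu = (1 + V_bound) * (1 + 2 * Ng) + \<beta> * (16 * Ng^3 + 24 * Ng\<^sup>2 + 16 * Ng + 4)"

lemma C_mu_nonneg: "0 \<le> C_mu"
  unfolding C_mu_def using V_bound(1) \<beta>_nonneg Ng_nonneg by simp

text \<open>Linear in \<open>N t\<close>, in contrast to \<open>D_upper\<close>: in the expansion of
  \<open>mu\<close> the quartic part has weight \<open>\<beta>\<close> instead of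
  \<open>\<beta> / 4\<close>, so the Euler-Lagrange equation leaves a term
  \<open>2 * \<beta> * q1 t\<close> behind.\<close>

lemma mu_diff_le:
  assumes t: "0 < t" and N1: "N t \<le> 1" shows "\<bar>mu \<Omega> V \<beta> (\<phi> t) - lam\<bar> \<le> C_mu * N t"
proof -
  note w = w_H01[OF t]
  have u: "\<phi> t \<in> H01 \<Omega>" using t by (intro \<phi>_H) simp
  have "(L2_norm \<Omega> (\<phi> t))\<^sup>2 = 1"
    using L2.nrm_square[OF H01_L2[OF u]] norm_conserved[OF t] by (simp add: nrm_L2)
  then have "mu \<Omega> V \<beta> (\<phi> t) = A (\<phi> t) (\<phi> t) + \<beta> * quad (\<phi> t) (\<phi> t) (\<phi> t) (\<phi> t)" by (simp add: mu_eq[OF u])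
  moreover have "A (\<phi> t) (\<phi> t) = A g g + 2 * A g (w t) + A (w t) (w t)"
    using A.square_lincomb[OF g w, of 1] by (simp add: phi_eq)
  moreover have "quad (\<phi> t) (\<phi> t) (\<phi> t) (\<phi> t) = quad g g g g + 4 * q1 t + 6 * q2 t + 4 * q3 t + q4 t"
    using quad_power4_lincomb[OF g w, of 1] by (simp add: phi_eq)
  ultimately have eq: "mu \<Omega> V \<beta> (\<phi> t) - lam = 2 * A g (w t) + A (w t) (w t) + \<beta> * (4 * q1 t + (6 * q2 t + 4 * q3 t + q4 t))"
    by (simp add: lam_def algebra_simps)
  have "\<bar>A g (w t)\<bar> \<le> A.nrm g * A.nrm (w t)" by (rule A.Cauchy_Schwarz[OF g w])
  also have "\<dots> \<le> (sqrt (1 + V_bound) * Ng) * (sqrt (1 + V_bound) * N t)"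
    unfolding N_def by (intro mult_mono A_nrm_le g w A.nrm_nonneg mult_nonneg_nonneg Ng_nonneg) (use V_bound(1) in auto)
  also have "\<dots> = (1 + V_bound) * (Ng * N t)" using V_bound(1) by simp
  finally have 1: "\<bar>2 * A g (w t)\<bar> \<le> 2 * ((1 + V_bound) * (Ng * N t))" by simp
  have "A (w t) (w t) \<le> (1 + V_bound) * N t"
    by (rule order_trans[OF A_w_le[OF t] mult_left_mono[OF powers_le(3)[OF t N1]]]) (use V_bound(1) in simp)
  then have 2: "\<bar>A (w t) (w t)\<bar> \<le> (1 + V_bound) * N t" using A.nonneg[OF w] by simp
  have "(24 * Ng\<^sup>2 + 16 * Ng + 4) * (N t)\<^sup>2 \<le> (24 * Ng\<^sup>2 + 16 * Ng + 4) * N t"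
    using Ng_nonneg by (intro mult_left_mono powers_le[OF t N1]) auto
  then have "\<bar>4 * q1 t + (6 * q2 t + 4 * q3 t + q4 t)\<bar> \<le> 4 * (4 * Ng^3 * N t) + (24 * Ng\<^sup>2 + 16 * Ng + 4) * N t"
    using q_bounds(1)[OF t] higher_order_le[OF t N1] by linarith
  then have "\<beta> * \<bar>4 * q1 t + (6 * q2 t + 4 * q3 t + q4 t)\<bar> \<le> \<beta> * (4 * (4 * Ng^3 * N t) + (24 * Ng\<^sup>2 + 16 * Ng + 4) * N t)"
    using \<beta>_nonneg by (rule mult_left_mono)
  then have 3: "\<bar>\<beta> * (4 * q1 t + (6 * q2 t + 4 * q3 t + q4 t))\<bar> \<le> \<beta> * (4 * (4 * Ng^3 * N t) + (24 * Ng\<^sup>2 + 16 * Ng + 4) * N t)"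
    using \<beta>_nonneg by (simp only: abs_mult abs_of_nonneg)
  have "\<bar>mu \<Omega> V \<beta> (\<phi> t) - lam\<bar> \<le> 2 * ((1 + V_bound) * (Ng * N t)) + (1 + V_bound) * N t
      + \<beta> * (4 * (4 * Ng^3 * N t) + (24 * Ng\<^sup>2 + 16 * Ng + 4) * N t)"
    unfolding eq using 1 2 3 by linarith
  also have "\<dots> = C_mu * N t" by (simp add: C_mu_def algebra_simps)
  finally show ?thesis .
qed

text \<open>Testing with \<open>w\<close>, the first-order terms combine to
  \<open>lam * y t / 2\<close>; together with \<open>mu * y t / 2\<close> this is
  \<open>lam * y t\<close> plus the error from \<open>mu\<close>. Of the three copies of
  \<open>q2\<close> one completes \<open>A\<close> to \<open>a\<close>.\<close>

lemma ip_deriv_w: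
  assumes t: "0 < t"
  shows "ip \<Omega> (\<phi>' t) (w t) = - (a (w t) (w t) - lam * y t) - 2 * \<beta> * q2 t - 3 * \<beta> * q3 t - \<beta> * q4 t
    + (mu \<Omega> V \<beta> (\<phi> t) - lam) * y t / 2"
proof -
  note w = w_H01[OF t]
  have e1: "A (\<phi> t) (w t) = A g (w t) + A (w t) (w t)"
    using A.lin_left[OF g w w, of 1] by (simp add: phi_eq)
  have e2: "quad (\<phi> t) (\<phi> t) (\<phi> t) (w t) = q1 t + 3 * q2 t + 3 * q3 t + q4 t"
    using quad_cube_lincomb[OF g w w, of 1] by (simp add: phi_eq)
  have e3: "ip \<Omega> (\<phi> t) (w t) = y t / 2"
    using L2.lin_left[OF H01_L2[OF g] H01_L2[OF w] H01_L2[OF w], of 1] ip_g_w[OF t] by (simp add: phi_eq y_def)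
  have e4: "A g (w t) + \<beta> * q1 t = - lam * y t / 2"
    using Euler_Lagrange[OF w] by (simp add: a_def ip_g_w[OF t])
  show ?thesis
    unfolding weak_form[OF t w] e1 e2 e3 a_def using e4
    by (simp add: algebra_simps add_divide_distrib diff_divide_distrib)
qed

text \<open>A convex combination of two lower bounds for \<open>a\<close> minus
  \<open>lam * y t\<close>: weight \<open>1 - \<theta>\<close> on the spectral gap, which gives the
  rate, and weight \<open>\<theta>\<close> on coercivity, which gives the gradient term needed
  against errors of size \<open>N t * (y t + G t)\<close>.\<close>

lemma dissipation:
  assumes gap: "lam < gap_value" and t: "0 < t" and N1: "N t \<le> 1" and \<theta>: "0 \<le> \<theta>" "\<theta> \<le> 1"
  defines "\<kappa> \<equiv> gap_value - lam"
  shows "ip \<Omega> (\<phi>' t) (w t) \<le> - \<kappa> * y t + (\<theta> * (\<kappa> + lam) + \<kappa> / 4 * N t) * y t - \<theta> * G t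
    + (12 * \<beta> * Ng + C_mu / 2) * N t * (y t + G t)"
proof -
  note w = w_H01[OF t] and nn = nonneg[OF t]
  have \<kappa>: "0 < \<kappa>" using gap by (simp add: \<kappa>_def)
  have "\<kappa> * (y t - (y t)\<^sup>2 / 4) \<le> a (w t) (w t) - lam * y t"
    using spectral_gap[OF gap w] by (simp add: y_def \<kappa>_def ip_g_w[OF t] power_divide)
  \<comment> \<open>The defect \<open>(y t)\<^sup>2 / 4\<close> stems from the component of
    \<open>w\<close> along \<open>g\<close>; it is a small multiple of \<open>y t\<close>.\<close>
  moreover have "(y t)\<^sup>2 \<le> N t * y t"
  proof -
    have "y t \<le> (N t)\<^sup>2" using nn by (simp add: N_square[OF t])
    also have "\<dots> \<le> N t" by (rule powers_le[OF t N1])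
    finally show ?thesis using nn by (simp add: power2_eq_square mult_right_mono)
  qed
  then have "\<kappa> * ((y t)\<^sup>2 / 4) \<le> \<kappa> * (N t * y t / 4)" using \<kappa> by (intro mult_left_mono) auto
  ultimately have g1: "\<kappa> * y t - \<kappa> / 4 * N t * y t \<le> a (w t) (w t) - lam * y t" by (simp add: algebra_simps)
  have g2: "G t - lam * y t \<le> a (w t) (w t) - lam * y t" using a_bounds(1)[OF w] by (simp add: G_def)
  have "(1 - \<theta>) * (\<kappa> * y t - \<kappa> / 4 * N t * y t) + \<theta> * (G t - lam * y t) \<le>
      (1 - \<theta>) * (a (w t) (w t) - lam * y t) + \<theta> * (a (w t) (w t) - lam * y t)"
    using \<theta> by (intro add_mono mult_left_mono g1 g2) auto
  then have "(1 - \<theta>) * (\<kappa> * y t - \<kappa> / 4 * N t * y t) + \<theta> * (G t - lam * y t) \<le> a (w t) (w t) - lam * y t"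
    by (simp add: algebra_simps)
  moreover have "0 \<le> \<theta> * (\<kappa> / 4 * N t * y t)" using \<theta> \<kappa> nn by simp
  ultimately have gap': "\<kappa> * y t - (\<theta> * (\<kappa> + lam) + \<kappa> / 4 * N t) * y t + \<theta> * G t \<le> a (w t) (w t) - lam * y t"
    by (simp add: algebra_simps diff_divide_distrib)
  \<comment> \<open>Of the nonlinear terms only the cubic one lacks a sign. The constant 12 is its
    coefficient 3 times the 4 of \<open>quad_bound\<close>, and \<open>(N t)^3\<close> is
    \<open>N t * (y t + G t)\<close>.\<close>
  have "- q3 t \<le> 4 * Ng * (N t)^3" using q_bounds(4)[OF t] by linarith
  then have "3 * (\<beta> * (- q3 t)) \<le> 3 * (\<beta> * (4 * Ng * (N t)^3))"
    by (intro mult_left_mono \<beta>_nonneg) auto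
  moreover have "3 * (\<beta> * (4 * Ng * (N t)^3)) = 12 * \<beta> * Ng * N t * (y t + G t)"
    unfolding N_square[OF t, symmetric] by (simp add: power3_eq_cube power2_eq_square)
  ultimately have c: "- (3 * \<beta> * q3 t) \<le> 12 * \<beta> * Ng * N t * (y t + G t)" by simp
  have "(mu \<Omega> V \<beta> (\<phi> t) - lam) * y t \<le> C_mu * N t * y t"
    using mu_diff_le[OF t N1] nn by (intro mult_right_mono) auto
  also have "\<dots> \<le> C_mu * N t * (y t + G t)" using nn C_mu_nonneg by (intro mult_left_mono) auto
  finally have m: "(mu \<Omega> V \<beta> (\<phi> t) - lam) * y t / 2 \<le> C_mu / 2 * N t * (y t + G t)" by simp
  have "0 \<le> 2 * \<beta> * q2 t" "0 \<le> \<beta> * q4 t" using q_bounds[OF t] \<beta>_nonneg by auto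
  moreover have "(12 * \<beta> * Ng + C_mu / 2) * N t * (y t + G t) =
      12 * \<beta> * Ng * N t * (y t + G t) + C_mu / 2 * N t * (y t + G t)" by (simp only: distrib_right)
  ultimately show ?thesis unfolding ip_deriv_w[OF t] using gap' c m by linarith
qed

section \<open>Choice of the parameters and the exponential rates\<close>

lemma N_tendsto: "(N \<longlongrightarrow> 0) at_top"
proof (rule Lim_transform_eventually[OF convergence])
  show "\<forall>\<^sub>F t in at_top. H1_norm \<Omega> (w t) = N t"
    using eventually_gt_at_top[of 0]
    by eventually_elim (simp add: N_def nrm_H1[OF H01_H1[OF w_H01]])
qed

text \<open>Half of \<open>\<epsilon>\<close> is spent on errors multiplying \<open>y\<close>: a
  quarter through \<open>\<theta>\<close>, an eighth on the defect of orthogonality, an eighth on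
  the cubic and \<open>mu\<close> errors. After doubling, the other half leaves
  \<open>\<epsilon> * y t + \<theta> * G t\<close>, which pays for the decay of
  \<open>\<eta> * D t\<close>.\<close>

theorem exponential_convergence:
  assumes \<epsilon>: "0 < \<epsilon>" "\<epsilon> < gap_value - lam"
  defines "\<gamma> \<equiv> gap_value - lam - \<epsilon>"
  shows "\<exists>T>0. \<exists>C>0. \<forall>t\<ge>T. D t \<le> C * exp (- 2 * \<gamma> * t) \<and>
    L2_norm \<Omega> (w t) \<le> C * exp (- \<gamma> * t) \<and> \<bar>mu \<Omega> V \<beta> (\<phi> t) - lam\<bar> \<le> C * exp (- \<gamma> * t)"
proof -
  define \<kappa> where "\<kappa> = gap_value - lam"
  have \<kappa>: "0 < \<kappa>" "\<epsilon> < \<kappa>" and gap: "lam < gap_value" using \<epsilon> by (auto simp: \<kappa>_def)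
  have \<gamma>: "0 < \<gamma>" "\<gamma> = \<kappa> - \<epsilon>" using \<epsilon> by (auto simp: \<gamma>_def \<kappa>_def)
  \<comment> \<open>The second entry limits the loss of rate
    \<open>\<theta> * (\<kappa> + lam)\<close> to \<open>\<epsilon> / 4\<close>; the first keeps the
    combination convex.\<close>
  define \<theta> where "\<theta> = min (1/2) (\<epsilon> / (4 * (\<kappa> + lam)))"
  have kl: "0 < \<kappa> + lam" using \<kappa> lam_nonneg by simp
  have \<theta>: "0 < \<theta>" "\<theta> \<le> 1" using \<epsilon> kl by (auto simp: \<theta>_def)
  have "\<theta> * (\<kappa> + lam) \<le> \<epsilon> / (4 * (\<kappa> + lam)) * (\<kappa> + lam)"
    using kl by (intro mult_right_mono) (auto simp: \<theta>_def)
  also have "\<epsilon> / (4 * k) * k = \<epsilon> / 4" if "0 < k" for k using that by simp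
  note this[OF kl]
  finally have \<theta>kl: "\<theta> * (\<kappa> + lam) \<le> \<epsilon> / 4" .
  define C1 where "C1 = 12 * \<beta> * Ng + C_mu / 2"
  \<comment> \<open>The error multiplies \<open>y t + G t\<close>, so it must fit both the budget
    for \<open>y t\<close> and half of the retained gradient term.\<close>
  define d where "d = min (\<epsilon> / 8) (\<theta> / 2)"
  have d: "0 < d" using \<epsilon> \<theta> by (simp add: d_def)
  have "\<forall>\<^sub>F t in at_top. N t < 1" by (rule order_tendstoD(2)[OF N_tendsto]) simp
  moreover have "\<forall>\<^sub>F t in at_top. \<kappa> / 4 * N t < \<epsilon> / 8"
    by (rule order_tendstoD(2)[OF tendsto_mult_right_zero[OF N_tendsto]]) (use \<epsilon> in simp)
  moreover have "\<forall>\<^sub>F t in at_top. C1 * N t < d"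
    by (rule order_tendstoD(2)[OF tendsto_mult_right_zero[OF N_tendsto]]) (rule d)
  ultimately have "\<forall>\<^sub>F t in at_top. N t < 1 \<and> \<kappa> / 4 * N t < \<epsilon> / 8 \<and> C1 * N t < d"
    by eventually_elim auto
  then obtain T0 where T0: "\<And>t. T0 \<le> t \<Longrightarrow> N t < 1 \<and> \<kappa> / 4 * N t < \<epsilon> / 8 \<and> C1 * N t < d"
    by (auto simp: eventually_at_top_linorder)
  define T where "T = max T0 1"
  have T: "0 < T" "\<And>t. T \<le> t \<Longrightarrow> 0 < t" "\<And>t. T \<le> t \<Longrightarrow> N t \<le> 1" "\<And>t. T \<le> t \<Longrightarrow> \<kappa> / 4 * N t \<le> \<epsilon> / 8" "\<And>t. T \<le> t \<Longrightarrow> C1 * N t \<le> d"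
    using T0 by (auto simp: T_def intro: less_imp_le)
  \<comment> \<open>With \<open>D_upper\<close> this makes
    \<open>2 * \<gamma> * \<eta> * D t\<close> at most
    \<open>min \<epsilon> \<theta> * (y t + G t)\<close>, just what is left over.\<close>
  define \<eta> where "\<eta> = min \<epsilon> \<theta> / (2 * \<gamma> * C_D)"
  have \<eta>: "0 < \<eta>" "2 * \<gamma> * \<eta> * C_D = min \<epsilon> \<theta>" using \<epsilon> \<theta> \<gamma> C_D_pos by (auto simp: \<eta>_def)
  have decay: "2 * ip \<Omega> (\<phi>' t) (w t) \<le> - 2 * \<gamma> * (y t + \<eta> * D t)" if Tt: "T \<le> t" for t
  proof -
    note t = T(2)[OF Tt] and N1 = T(3)[OF Tt]
    note nn = nonneg[OF t]
    have "ip \<Omega> (\<phi>' t) (w t) \<le> - \<kappa> * y t + (\<theta> * (\<kappa> + lam) + \<kappa> / 4 * N t) * y t - \<theta> * G t + C1 * N t * (y t + G t)"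
      unfolding C1_def \<kappa>_def by (rule dissipation[OF gap t N1 less_imp_le[OF \<theta>(1)] \<theta>(2)])
    also have "\<dots> \<le> - \<kappa> * y t + (\<epsilon> / 4 + \<epsilon> / 8) * y t - \<theta> * G t + d * (y t + G t)"
      using \<theta>kl T(4,5)[OF Tt] nn by (intro add_mono diff_mono mult_right_mono order_refl) auto
    also have "d * (y t + G t) \<le> \<epsilon> / 8 * y t + \<theta> / 2 * G t"
      unfolding distrib_left using nn by (intro add_mono mult_right_mono) (auto simp: d_def)
    finally have 1: "2 * ip \<Omega> (\<phi>' t) (w t) \<le> - 2 * \<gamma> * y t - (\<epsilon> * y t + \<theta> * G t)"
      by (simp add: \<gamma>(2) algebra_simps)
    have "2 * \<gamma> * \<eta> * D t \<le> 2 * \<gamma> * \<eta> * (C_D * (y t + G t))"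
      using \<gamma> \<eta> by (intro mult_left_mono D_upper[OF t N1]) auto
    also have "\<dots> = min \<epsilon> \<theta> * (y t + G t)" by (simp only: \<eta>(2)[symmetric] mult.assoc)
    also have "\<dots> \<le> \<epsilon> * y t + \<theta> * G t"
      unfolding distrib_left using nn by (intro add_mono mult_right_mono) auto
    finally show ?thesis using 1 by (simp add: algebra_simps)
  qed
  define Z where "Z = exp (2 * \<gamma> * T) * (y T + \<eta> * D T)"
  have Z: "0 \<le> Z" using nonneg[OF T(1)] \<eta> by (simp add: Z_def)
  have main: "y t + \<eta> * D t \<le> Z * exp (- 2 * \<gamma> * t)" if Tt: "T \<le> t" for t
    unfolding Z_def
  proof (rule Lyapunov_decay[where y' = "\<lambda>t. 2 * ip \<Omega> (\<phi>' t) (w t)" and D' = "\<lambda>t. - ip \<Omega> (\<phi>' t) (\<phi>' t)"])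
    fix s assume s: "T \<le> s"
    show "(y has_real_derivative 2 * ip \<Omega> (\<phi>' s) (w s)) (at s)" by (rule y_derivative[OF T(2)[OF s]])
    have "((\<lambda>t. energy \<Omega> V \<beta> (\<phi> t) - energy \<Omega> V \<beta> g) has_real_derivative - ip \<Omega> (\<phi>' s) (\<phi>' s) - 0) (at s)"
      by (intro DERIV_diff energy_derivative T(2)[OF s] DERIV_const)
    then show "(D has_real_derivative - ip \<Omega> (\<phi>' s) (\<phi>' s)) (at s)" by (simp add: D_def[abs_def])
    show "- ip \<Omega> (\<phi>' s) (\<phi>' s) \<le> 0"
      using L2.nonneg[OF H01_L2[OF \<phi>'_H]] T(2)[OF s] by simp
    show "2 * ip \<Omega> (\<phi>' s) (w s) \<le> - 2 * \<gamma> * (y s + \<eta> * D s)" by (rule decay[OF s])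
  qed (use \<eta> Tt in auto)
  \<comment> \<open>Constant in the decay of \<open>(N t)\<^sup>2\<close>: by \<open>D_lower\<close>
    it is at most \<open>(1 + lam) * y t + 2 * D t\<close>, and the Lyapunov bound gives the factors
    \<open>Z\<close> and \<open>Z / \<eta>\<close>.\<close>
  define K where "K = (1 + lam) * Z + 2 * (Z / \<eta>)"
  have K: "0 \<le> K" using Z lam_nonneg \<eta> by (simp add: K_def)
  define C where "C = Z / \<eta> + sqrt Z + C_mu * sqrt K + 1"
  have C: "0 < C" "Z / \<eta> \<le> C" "sqrt Z \<le> C" "C_mu * sqrt K \<le> C"
    using Z \<eta> K C_mu_nonneg by (auto simp: C_def add_nonneg_pos)
  have "D t \<le> C * exp (- 2 * \<gamma> * t) \<and> L2_norm \<Omega> (w t) \<le> C * exp (- \<gamma> * t) \<and>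
      \<bar>mu \<Omega> V \<beta> (\<phi> t) - lam\<bar> \<le> C * exp (- \<gamma> * t)" if Tt: "T \<le> t" for t
  proof -
    note t = T(2)[OF Tt] and N1 = T(3)[OF Tt]
    note nn = nonneg[OF t]
    let ?e = "exp (- \<gamma> * t)"
    have e2: "exp (- 2 * \<gamma> * t) = ?e\<^sup>2" by (simp add: power2_eq_square exp_add[symmetric])
    have m: "y t + \<eta> * D t \<le> Z * ?e\<^sup>2" using main[OF Tt] by (simp only: e2)
    have yb: "y t \<le> Z * ?e\<^sup>2" using m mult_nonneg_nonneg[OF less_imp_le[OF \<eta>(1)] nn(4)] by linarith
    have "\<eta> * D t \<le> Z * ?e\<^sup>2" using m nn by simp
    then have Db: "D t \<le> Z / \<eta> * ?e\<^sup>2" using \<eta> by (simp add: field_simps)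
    have 1: "D t \<le> C * exp (- 2 * \<gamma> * t)"
      unfolding e2 using Db mult_right_mono[OF C(2), of "?e\<^sup>2"] by simp
    have "L2_norm \<Omega> (w t) = sqrt (y t)" by (simp add: y_def L2.nrm_def flip: nrm_L2)
    also have "\<dots> \<le> sqrt (Z * ?e\<^sup>2)" by (rule real_sqrt_le_mono[OF yb])
    also have "\<dots> = sqrt Z * ?e" by (simp add: real_sqrt_mult)
    also have "\<dots> \<le> C * ?e" by (intro mult_right_mono C) simp
    finally have 2: "L2_norm \<Omega> (w t) \<le> C * ?e" .
    have "(N t)\<^sup>2 \<le> (1 + lam) * y t + 2 * D t"
      unfolding N_square[OF t] using D_lower[OF t] by (simp add: algebra_simps)
    also have "\<dots> \<le> (1 + lam) * (Z * ?e\<^sup>2) + 2 * (Z / \<eta> * ?e\<^sup>2)"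
      using lam_nonneg by (intro add_mono mult_left_mono yb Db) auto
    also have "\<dots> = K * ?e\<^sup>2" by (simp add: K_def algebra_simps)
    finally have "sqrt ((N t)\<^sup>2) \<le> sqrt (K * ?e\<^sup>2)" by (rule real_sqrt_le_mono)
    then have "N t \<le> sqrt K * ?e" using nn by (simp add: real_sqrt_mult)
    then have "C_mu * N t \<le> C_mu * (sqrt K * ?e)" by (rule mult_left_mono[OF _ C_mu_nonneg])
    then have "\<bar>mu \<Omega> V \<beta> (\<phi> t) - lam\<bar> \<le> (C_mu * sqrt K) * ?e" using mu_diff_le[OF t N1] by (simp add: mult.assoc)
    also have "\<dots> \<le> C * ?e" by (intro mult_right_mono C) simp
    finally show ?thesis using 1 2 by blast
  qed
  then show ?thesis using T(1) C(1) by blast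
qed

end

theorem theorem3p9:
  fixes \<Omega> :: "(real^3) set" and V :: "real^3 \<Rightarrow> real" and \<beta> :: real
    and \<phi>\<^sub>0 phi_GS :: "real^3 \<Rightarrow> real" and \<phi> :: "real \<Rightarrow> real^3 \<Rightarrow> real"
    and lambda_GS lambda_2 :: real
  assumes "open \<Omega>" "\<Omega> \<noteq> {}" "bounded \<Omega>" "convex \<Omega>" "smooth_boundary \<Omega>"
    and "V \<in> Linfty \<Omega>" "AE x in lebesgue_on \<Omega>. V x \<ge> 0" "\<beta> \<ge> 0"
    and "is_ground_state \<Omega> V \<beta> phi_GS"
    and "lambda_GS = mu \<Omega> V \<beta> phi_GS"
    and "lambda_2 = nth_eigenvalue \<Omega> (\<lambda>x. V x + \<beta> * \<bar>phi_GS x\<bar>\<^sup>2) 2"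
    and "is_flow_solution \<Omega> V \<beta> \<phi>\<^sub>0 \<phi>"
    and "L2_norm \<Omega> \<phi>\<^sub>0 = 1"
    and "((\<lambda>t. H1_norm \<Omega> (\<lambda>x. \<phi> t x - phi_GS x)) \<longlongrightarrow> 0) at_top"
  shows "\<forall>\<epsilon>\<in>{0<..<lambda_2 - lambda_GS}. \<exists>T>0. \<exists>C>0. \<forall>t\<ge>T.
           energy \<Omega> V \<beta> (\<phi> t) - energy \<Omega> V \<beta> phi_GS \<le> C * exp (- 2 * (lambda_2 - lambda_GS - \<epsilon>) * t) \<and>
           L2_norm \<Omega> (\<lambda>x. \<phi> t x - phi_GS x) \<le> C * exp (- (lambda_2 - lambda_GS - \<epsilon>) * t) \<and>
           \<bar>mu \<Omega> V \<beta> (\<phi> t) - lambda_GS\<bar> \<le> C * exp (- (lambda_2 - lambda_GS - \<epsilon>) * t)"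
proof
  fix \<epsilon> assume \<epsilon>: "\<epsilon> \<in> {0<..<lambda_2 - lambda_GS}"
  obtain \<phi>' where \<phi>': "\<forall>t\<ge>0. \<phi>' t \<in> H01 \<Omega>" "has_time_deriv (H1_norm \<Omega>) \<phi> \<phi>'"
    "\<forall>t>0. AE x in lebesgue_on \<Omega>. \<phi>' t x = weak_laplacian \<Omega> (\<phi> t) x - V x * \<phi> t x - \<beta> * \<bar>\<phi> t x\<bar>\<^sup>2 * \<phi> t x
                     + mu \<Omega> V \<beta> (\<phi> t) * \<phi> t x"
    using \<open>is_flow_solution \<Omega> V \<beta> \<phi>\<^sub>0 \<phi>\<close> unfolding is_flow_solution_def by blast
  interpret gp_flow \<Omega> V \<beta> phi_GS \<phi> \<phi>'
    using assms \<phi>' by unfold_locales (auto simp: is_flow_solution_def)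
  have "lambda_GS = lam" "lambda_2 = gap_value" using assms(10,11) by (simp_all only: mu_g gap_value_def)
  then show "\<exists>T>0. \<exists>C>0. \<forall>t\<ge>T.
           energy \<Omega> V \<beta> (\<phi> t) - energy \<Omega> V \<beta> phi_GS \<le> C * exp (- 2 * (lambda_2 - lambda_GS - \<epsilon>) * t) \<and>
           L2_norm \<Omega> (\<lambda>x. \<phi> t x - phi_GS x) \<le> C * exp (- (lambda_2 - lambda_GS - \<epsilon>) * t) \<and>
           \<bar>mu \<Omega> V \<beta> (\<phi> t) - lambda_GS\<bar> \<le> C * exp (- (lambda_2 - lambda_GS - \<epsilon>) * t)"
    using exponential_convergence[of \<epsilon>] \<epsilon> by (simp add: D_def)
qed

end
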